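(* Let $1\le p,q\le\infty$ with $\frac1p+\frac1q=1$, and let $\mathcal P$ be a digital net over $\mathbb{F}_2$ with $2^m$ points in $[0,1)^s$ ($m,s\in\mathbb{N}$) obtained from a Niederreiter sequence, with regular (non-singular) generating matrices. (i) Assume there exists a $\delta\in(0,1)$ such that $$C_{\mathrm{Nied}}(\delta,\boldsymbol\gamma,q):=\sup_{s\in\mathbb{N}}\left(\sum_{\emptyset\ne\mathfrak u\subseteq[s]}\left(\gamma_{\mathfrak u}\prod_{i\in\mathfrak u}\left[\frac{8\,|\mathfrak u|\,i}{\mathrm e\,\delta\ln2}\,\mathrm{ld}(i+2)\,(b_i-a_i)\right]\right)^q\right)^{1/q}<\infty$$ (with the $\ell_q$-sum replaced by a maximum over $\mathfrak u$ if $q=\infty$). Then $$\mathrm{wce}(\mathcal P;p,s,\boldsymbol\gamma,\varphi)\le\frac{3\,C_{\mathrm{Nied}}(\delta,\boldsymbol\gamma,q)}{2^{m(1-\delta)}}.$$ (ii) For strictly positive weights $\gamma_{\mathfrak u}$, if $$S_{\mathrm{Nied}}(\boldsymbol\gamma):=\sum_{i=1}^\infty[i\,\mathrm{ld}(i+2)\,(b_i-a_i)]\max_{\mathfrak v\subseteq[i-1]}\frac{\gamma_{\mathfrak v\cup\{i\}}}{\gamma_{\mathfrak v}}<\infty,$$ where in this expression $\gamma_\emptyset:=1$, then for any $\delta\in\left(0,\min\left\{1,\frac{16\,S_{\mathrm{Nied}}(\boldsymbol\gamma)}{\ln2}\right\}\right)$ we have $$\mathrm{wce}(\mathcal P;p,s,\boldsymbol\gamma,\varphi)\le\frac{C_{\mathrm{Nied,prod}}(\delta,\boldsymbol\gamma)}{2^{m(1-\delta)}},\qquad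 C_{\mathrm{Nied,prod}}(\delta,\boldsymbol\gamma)=3\left(\frac{16\,S_{\mathrm{Nied}}(\boldsymbol\gamma)}{\delta\ln2}\right)^b,$$ where the integer $b\ge0$ is such that $$\sum_{i=b+1}^\infty[i\,\mathrm{ld}(i+2)\,(b_i-a_i)]\max_{\mathfrak v\subseteq[i-1]}\frac{\gamma_{\mathfrak v\cup\{i\}}}{\gamma_{\mathfrak v}}<\frac{\delta\ln2}{16}$$ (again with $\gamma_\emptyset:=1$).
   Context: Notation: $\mathrm{ld}$ is the logarithm in base $2$, $\ln$ the natural logarithm, $\mathrm e$ Euler's number, $[s]=\{1,\ldots,s\}$, $[0]=\emptyset$. Setting. There are given sequences of reals $-\infty<a_i<b_i<\infty$, $i\in\mathbb{N}$, probability density functions $\varphi_i:[a_i,b_i]\to\mathbb{R}$ (with respect to Lebesgue measure) whose distribution functions $\Phi_i(x)=\int_{a_i}^x\varphi_i(y)\,\mathrm dy$ are invertible as maps $[a_i,b_i]\to[0,1]$, and positive weights $\boldsymbol\gamma=\{\gamma_{\mathfrak u}\}$ indexed by the finite sets $\mathfrak u\subset\mathbb{N}$. In dimension $s$: $[\boldsymbol a,\boldsymbol b]=\prod_{i=1}^s[a_i,b_i]$, $\varphi(\boldsymbol x)=\prod_{i=1}^s\varphi_i(x_i)$, $\Phi^{-1}(\boldsymbol x)=(\Phi_1^{-1}(x_1),\ldots,\Phi_s^{-1}(x_s))$. Norm. For $\mathfrak u=\{u_1<\cdots<u_k\}\subseteq[s]$ let $\frac{\partial^{|\mathfrak u|}F}{\partial\boldsymbol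 x_{\mathfrak u}}=\frac{\partial^kF}{\partial x_{u_1}\cdots\partial x_{u_k}}$ (equal to $F$ for $\mathfrak u=\emptyset$). For functions $F:[\boldsymbol a,\boldsymbol b]\to\mathbb{R}$ for which these mixed partial derivatives exist, $\|F\|_{p,s,\boldsymbol\gamma}=\left(\sum_{\mathfrak u\subseteq[s]}\left(\frac1{\gamma_{\mathfrak u}}\sup_{\boldsymbol x\in[\boldsymbol a,\boldsymbol b]}\left|\frac{\partial^{|\mathfrak u|}F}{\partial\boldsymbol x_{\mathfrak u}}(\boldsymbol x)\right|\right)^p\right)^{1/p}$, with the maximum over $\mathfrak u$ if $p=\infty$. Worst-case error. For points $\mathcal P=\{\boldsymbol y_0,\ldots,\boldsymbol y_{N-1}\}$ in $[0,1]^s$, $\mathrm{wce}(\mathcal P;p,s,\boldsymbol\gamma,\varphi)=\sup_{\|F\|_{p,s,\boldsymbol\gamma}\le1}\left|\frac1N\sum_{n=0}^{N-1}F(\Phi^{-1}(\boldsymbol y_n))-\int_{[\boldsymbol a,\boldsymbol b]}F(\boldsymbol x)\varphi(\boldsymbol x)\,\mathrm d\boldsymbol x\right|$. Digital nets. Given $m\times m$ matrices $A_1,\ldots,A_s$ over $\mathbb{F}_2=\{0,1\}$ (generating matrices), the digital net generated by them consists of the points $\boldsymbol x_n=(x_n^{(1)},\ldots,x_n^{(s)})$, $0\le n<2^m$, where for $n=n_0+n_12+\cdots+n_{m-1}2^{m-1}$, $\vec n=(n_0,\ldots,n_{m-1})^\top$ and $A_i\vec n=(y_1^{(i)},\ldots,y_m^{(i)})^\top$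 over $\mathbb{F}_2$ one sets $x_n^{(i)}=\sum_{k=1}^my_k^{(i)}2^{-k}$. Niederreiter sequence over $\mathbb{F}_2$. Let $p_1,p_2,p_3,\ldots$ be the distinct irreducible polynomials over $\mathbb{F}_2$ listed in order of non-decreasing degree, $e_i=\deg p_i$. The generating matrix $C_i=(c^{(i)}_{j,r})_{j,r\in\mathbb{N}}\in\mathbb{F}_2^{\mathbb{N}\times\mathbb{N}}$ of the $i$-th coordinate is given as follows: for $j\ge1$ write $j-1=Qe_i+z$ with integers $Q\ge0$ and $0\le z<e_i$; then $c^{(i)}_{j,r}$ is the coefficient of $x^{-r}$ in the expansion of $\rho_{i,z}(x)/p_i(x)^{Q+1}$ in $\mathbb{F}_2((x^{-1}))$, where either $\rho_{i,z}(x)=x^z$ for all $z$, or $\rho_{i,z}(x)=x^{e_i-z-1}$ for all $z$ (the two customary orderings of the rows; in the second case all $C_i$ are non-singular upper triangular). A digital net with $2^m$ points in $[0,1)^s$ obtained from a Niederreiter sequence is the digital net generated by the upper left $m\times m$ submatrices of $C_1,\ldots,C_s$. *)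

theory Defs
  imports
    "HOL-Analysis.Analysis"
    "HOL-Library.Z2"
    "HOL-Computational_Algebra.Polynomial"
    "HOL-Computational_Algebra.Formal_Laurent_Series"
    "Jordan_Normal_Form.Matrix"
begin

(* Coordinates are numbered from 1, so [s] is {1..s}.  A vector of length s is a function
   nat => real which is "undefined" outside {1..s}. *)

definition coord_box :: "(nat \<Rightarrow> real) \<Rightarrow> (nat \<Rightarrow> real) \<Rightarrow> nat \<Rightarrow> (nat \<Rightarrow> real) set" where
  "coord_box a b s = (\<Pi>\<^sub>E i\<in>{1..s}. {a i..b i})"

definition prob_density_on :: "real \<Rightarrow> real \<Rightarrow> (real \<Rightarrow> real) \<Rightarrow> bool" where
  "prob_density_on l h f \<longleftrightarrow>
     (\<forall>x\<in>{l..h}. 0 \<le> f x) \<and>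
     set_integrable lebesgue {l..h} f \<and>
     (LINT x:{l..h}|lebesgue. f x) = 1"

definition distr_fun :: "real \<Rightarrow> (real \<Rightarrow> real) \<Rightarrow> real \<Rightarrow> real" where
  "distr_fun l f x = (LINT y:{l..x}|lebesgue. f y)"

definition inv_distr ::
  "(nat \<Rightarrow> real) \<Rightarrow> (nat \<Rightarrow> real) \<Rightarrow> (nat \<Rightarrow> real \<Rightarrow> real) \<Rightarrow> nat \<Rightarrow> (nat \<Rightarrow> real) \<Rightarrow> (nat \<Rightarrow> real)" where
  "inv_distr a b \<phi> s y =
     (\<lambda>i\<in>{1..s}. the_inv_into {a i..b i} (distr_fun (a i) (\<phi> i)) (y i))"

(* Derivatives are taken within the interval {a i..b i}, hence they are one-sided on the
   boundary of the box. *)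
definition partial_deriv ::
  "(nat \<Rightarrow> real) \<Rightarrow> (nat \<Rightarrow> real) \<Rightarrow> nat \<Rightarrow> ((nat \<Rightarrow> real) \<Rightarrow> real) \<Rightarrow> (nat \<Rightarrow> real) \<Rightarrow> real" where
  "partial_deriv a b i F x =
     vector_derivative (\<lambda>t. F (x(i := t))) (at (x i) within {a i..b i})"

(* For u = {u1 < ... < uk} this is d/dx_u1 (d/dx_u2 (... (d/dx_uk F))). *)
definition mixed_partial ::
  "(nat \<Rightarrow> real) \<Rightarrow> (nat \<Rightarrow> real) \<Rightarrow> nat set \<Rightarrow> ((nat \<Rightarrow> real) \<Rightarrow> real) \<Rightarrow> (nat \<Rightarrow> real) \<Rightarrow> real" where
  "mixed_partial a b u F = foldr (partial_deriv a b) (sorted_list_of_set u) F"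

(* The vector_derivative in partial_deriv is meaningful only under this predicate.  The
   outermost differentiation of the mixed partial derivative for u is in direction Min u. *)
definition has_mixed_partials ::
  "(nat \<Rightarrow> real) \<Rightarrow> (nat \<Rightarrow> real) \<Rightarrow> nat \<Rightarrow> ((nat \<Rightarrow> real) \<Rightarrow> real) \<Rightarrow> bool" where
  "has_mixed_partials a b s F \<longleftrightarrow>
     (\<forall>u. u \<subseteq> {1..s} \<and> u \<noteq> {} \<longrightarrow>
        (\<forall>x\<in>coord_box a b s.
           (\<lambda>t. mixed_partial a b (u - {Min u}) F (x(Min u := t)))
             differentiable (at (x (Min u)) within {a (Min u)..b (Min u)})))"

(* Intended for r > 0 only. *)
definition ennreal_powr :: "ennreal \<Rightarrow> real \<Rightarrow> ennreal" where
  "ennreal_powr x r = (if x = \<infinity> then \<infinity> else ennreal (enn2real x powr r))"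

definition lp_sum :: "ennreal \<Rightarrow> 'i set \<Rightarrow> ('i \<Rightarrow> ennreal) \<Rightarrow> ennreal" where
  "lp_sum p I f =
     (if p = \<infinity> then Max (f ` I)
      else ennreal_powr (\<Sum>i\<in>I. ennreal_powr (f i) (enn2real p)) (1 / enn2real p))"

definition weighted_norm ::
  "(nat \<Rightarrow> real) \<Rightarrow> (nat \<Rightarrow> real) \<Rightarrow> (nat set \<Rightarrow> real) \<Rightarrow> ennreal \<Rightarrow> nat \<Rightarrow>
     ((nat \<Rightarrow> real) \<Rightarrow> real) \<Rightarrow> ennreal" where
  "weighted_norm a b \<gamma> p s F =
     lp_sum p (Pow {1..s})
       (\<lambda>u. ennreal (1 / \<gamma> u) * (SUP x\<in>coord_box a b s. ennreal \<bar>mixed_partial a b u F x\<bar>))"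

(* The points y 0, ..., y (N - 1) are counted with multiplicity. *)
definition wce ::
  "(nat \<Rightarrow> real) \<Rightarrow> (nat \<Rightarrow> real) \<Rightarrow> (nat \<Rightarrow> real \<Rightarrow> real) \<Rightarrow> (nat set \<Rightarrow> real) \<Rightarrow> ennreal \<Rightarrow> nat \<Rightarrow>
     nat \<Rightarrow> (nat \<Rightarrow> nat \<Rightarrow> real) \<Rightarrow> ennreal" where
  "wce a b \<phi> \<gamma> p s N y =
     (SUP F\<in>{F. has_mixed_partials a b s F \<and> weighted_norm a b \<gamma> p s F \<le> 1}.
        ennreal \<bar>(\<Sum>n<N. F (inv_distr a b \<phi> s (y n))) / real N
           - (LINT x:coord_box a b s|Pi\<^sub>M {1..s} (\<lambda>_. lebesgue). F x * (\<Prod>i=1..s. \<phi> i (x i)))\<bar>)"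

(* Vectors and matrices are indexed from 0 here: component k of digit_vec m n is the digit
   n_k, and row k of A i yields the digit y_(k+1). *)
definition digit_vec :: "nat \<Rightarrow> nat \<Rightarrow> bit vec" where
  "digit_vec m n = vec m (\<lambda>k. of_nat (n div 2 ^ k mod 2))"

definition digital_net :: "nat \<Rightarrow> (nat \<Rightarrow> bit mat) \<Rightarrow> nat \<Rightarrow> nat \<Rightarrow> real" where
  "digital_net m A n i =
     (\<Sum>k<m. of_bool (vec_index (A i *\<^sub>v digit_vec m n) k = 1) / 2 ^ (k + 1))"

definition irreducible_listing :: "(nat \<Rightarrow> bit poly) \<Rightarrow> bool" where
  "irreducible_listing P \<longleftrightarrow>
     bij_betw P {1..} {f. irreducible f} \<and>
     (\<forall>i j. 1 \<le> i \<and> i \<le> j \<longrightarrow> degree (P i) \<le> degree (P j))"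

(* The field of Laurent series in 1/x is modelled by bit fls, whose formal variable plays the
   role of 1/x.  Thus x becomes fls_X_inv, and the coefficient of x^(-r) is the r-th one. *)
definition laurent_of_poly :: "bit poly \<Rightarrow> bit fls" where
  "laurent_of_poly f = poly (map_poly fls_const f) fls_X_inv"

definition row_numerators :: "(nat \<Rightarrow> bit poly) \<Rightarrow> (nat \<Rightarrow> nat \<Rightarrow> bit poly) \<Rightarrow> bool" where
  "row_numerators P \<rho> \<longleftrightarrow>
     (\<forall>i\<ge>1. \<forall>z<degree (P i). \<rho> i z = monom 1 z) \<or>
     (\<forall>i\<ge>1. \<forall>z<degree (P i). \<rho> i z = monom 1 (degree (P i) - z - 1))"

definition nied_entry ::
  "(nat \<Rightarrow> bit poly) \<Rightarrow> (nat \<Rightarrow> nat \<Rightarrow> bit poly) \<Rightarrow> nat \<Rightarrow> nat \<Rightarrow> nat \<Rightarrow> bit" where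
  "nied_entry P \<rho> i j r =
     (let e = degree (P i); Q = (j - 1) div e; z = (j - 1) mod e
      in fls_nth (laurent_of_poly (\<rho> i z) / laurent_of_poly (P i) ^ (Q + 1)) (int r))"

definition nied_matrix ::
  "(nat \<Rightarrow> bit poly) \<Rightarrow> (nat \<Rightarrow> nat \<Rightarrow> bit poly) \<Rightarrow> nat \<Rightarrow> nat \<Rightarrow> bit mat" where
  "nied_matrix P \<rho> m i = mat m m (\<lambda>(j, r). nied_entry P \<rho> i (j + 1) (r + 1))"

definition C_Nied ::
  "(nat \<Rightarrow> real) \<Rightarrow> (nat \<Rightarrow> real) \<Rightarrow> real \<Rightarrow> (nat set \<Rightarrow> real) \<Rightarrow> ennreal \<Rightarrow> ennreal" where
  "C_Nied a b \<delta> \<gamma> q =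
     (SUP s\<in>{1..}. lp_sum q (Pow {1..s} - {{}})
        (\<lambda>u. ennreal (\<gamma> u * (\<Prod>i\<in>u. 8 * real (card u) * real i / (exp 1 * \<delta> * ln 2)
                                  * log 2 (real i + 2) * (b i - a i)))))"

definition nied_term ::
  "(nat \<Rightarrow> real) \<Rightarrow> (nat \<Rightarrow> real) \<Rightarrow> (nat set \<Rightarrow> real) \<Rightarrow> nat \<Rightarrow> real" where
  "nied_term a b \<gamma> i =
     (let \<gamma>' = \<gamma>({} := 1)
      in real i * log 2 (real i + 2) * (b i - a i)
           * Max ((\<lambda>v. \<gamma>' (v \<union> {i}) / \<gamma>' v) ` Pow {1..i - 1}))"

definition S_Nied ::
  "(nat \<Rightarrow> real) \<Rightarrow> (nat \<Rightarrow> real) \<Rightarrow> (nat set \<Rightarrow> real) \<Rightarrow> real" where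
  "S_Nied a b \<gamma> = (\<Sum>\<^sub>\<infinity>i\<in>{1..}. nied_term a b \<gamma> i)"

definition C_Nied_prod ::
  "(nat \<Rightarrow> real) \<Rightarrow> (nat \<Rightarrow> real) \<Rightarrow> real \<Rightarrow> (nat set \<Rightarrow> real) \<Rightarrow> nat \<Rightarrow> real" where
  "C_Nied_prod a b \<delta> \<gamma> k = 3 * (16 * S_Nied a b \<gamma> / (\<delta> * ln 2)) ^ k"

end

theory Submission
  imports Defs "HOL-Computational_Algebra.Polynomial_Factorial"
begin

text \<open>
  Rounding every coordinate of a point of the unit cube down to the dyadic levels 0, 1, 2, ... and
  telescoping splits the integrand (composed with the inverse distribution functions) into details
  indexed by a level vector k. A detail is constant on the dyadic boxes of levels k, and its values
  are iterated differences of F, which the mean value theorem bounds by the supremum of the mixed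
  partial derivative for the support u of k. This replaces the Koksma-Hlawka inequality and needs
  neither continuity nor integrability of the mixed derivatives.

  Let e i be the degree of the i-th polynomial. The net integrates the detail of level k without error if
  the sum of k i + e i - 1 over u is at most m, because by partial fractions the corresponding rows
  of the generating matrices are linearly independent; for all other k no box contains more than
  2 to the sum of e i - 1 points. Levels beyond m together count like a single one, which
  leaves (m + 1)^card u level vectors for each u. Comparing degrees in the product of all polynomials of degree n shows that there
  are at least 2^n / n irreducible polynomials of degree at most n, whence 2^(e i) is at most
  8 i ld (i + 2).

  For (i), Hoelder's inequality is combined with the maximum of m^k 2^(- \<delta> m) over m. For (ii),
  a weight is at most the product of the successive ratios, so that the sum over u is dominated by
  the product of the factors 1 + 8 m T(i), where T(i) is the i-th term of S; the first b factors are
  compared with X exp(8 m T(i) / X), where X = 16 S / (\<delta> ln 2), and the others with exp(8 m T(i)).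
\<close>

section \<open>Counting irreducible polynomials over the two-element field\<close>

text \<open>F is only known to have mixed partial derivatives with finite suprema, so no integral
  representation of F is at hand. The comparison is therefore kept finite: the net is compared with
  the full grid of 2^M points per axis, whose box frequencies are exactly the volumes, and the bound
  does not depend on M. The integral enters only as the limit of the grid averages, where the
  first-order bounds make F Lipschitz.

  A level is measured by the sum of its details over all cells, not by their maximum times the
  number of cells. As every inverse distribution function is monotone, this sum is at most the bound
  on the derivative times the product of the widths b i - a i, at every level and for every density.

  Constants: completing d i rows to full powers of the i-th polynomial costs up to e i - 1 in
  degree, and 2^(e i - 1) \<le> 4 i ld (i + 2). Together with m + 1 \<le> 2 m this yields 8 m i ld
  (i + 2) per coordinate. In (ii) both groups of factors contribute exp(y d) with y = 8 m and d =
  \<delta> ln 2 / 16, and the square of this is 2^(\<delta> m).\<close>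

lemma exists_irreducible_divisor:
  fixes f :: "'a::field poly"
  assumes "degree f > 0"
  obtains p where "irreducible p" "p dvd f"
proof -
  define p where "p = arg_min degree (\<lambda>p. p dvd f \<and> degree p > 0)"
  have "p dvd f \<and> degree p > 0"
    unfolding p_def by (rule arg_min_natI[where k=f]) (use assms in auto)
  hence p: "p dvd f" "degree p > 0" by auto
  have min: "degree p \<le> degree g" if "g dvd f" "degree g > 0" for g
    unfolding p_def by (rule arg_min_nat_le) (use that in auto)
  have f0: "f \<noteq> 0" using assms by auto
  have "irreducible p"
  proof (rule irreducibleI)
    show "p \<noteq> 0" using p by auto
    show "\<not> p dvd 1"
      by (metis is_unit_iff_degree less_irrefl p(2) degree_0)
    fix a b assume ab: "p = a * b"
    hence nz: "a \<noteq> 0" "b \<noteq> 0" using p by auto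
    have "degree p = degree a + degree b" using ab nz by (simp add: degree_mult_eq)
    moreover have "degree a = 0 \<or> degree p \<le> degree a"
      using min[of a] ab p(1) dvd_trans[of a p f] by auto
    moreover have "degree b = 0 \<or> degree p \<le> degree b"
      using min[of b] ab p(1) dvd_trans[of b p f] by auto
    ultimately have "degree a = 0 \<or> degree b = 0" by linarith
    thus "a dvd 1 \<or> b dvd 1" using nz by (auto simp: is_unit_iff_degree)
  qed
  thus thesis using that p by blast
qed

lemma prime_elem_power_dvd_mult:
  fixes p :: "'a::idom"
  assumes "prime_elem p" "\<not> p dvd q" "p ^ n dvd q * g"
  shows "p ^ n dvd g"
  using assms(3)
proof (induction n arbitrary: g)
  case (Suc n)
  have "p dvd q * g" using Suc.prems by (metis dvd_mult_left power_Suc)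
  hence "p dvd g" using assms prime_elem_dvd_multD by blast
  then obtain h where h: "g = p * h" ..
  have p0: "p \<noteq> 0" using assms(1) unfolding prime_elem_def by blast
  have eq: "q * g = p * (q * h)" unfolding h by (rule mult.left_commute)
  have "p * p ^ n dvd p * (q * h)"
    by (rule Suc.prems[unfolded power_Suc eq])
  hence "p ^ n dvd q * h" using p0 dvd_mult_cancel_left[THEN iffD1] by blast
  hence "p ^ n dvd h" by (rule Suc.IH)
  thus ?case unfolding h power_Suc by (rule mult_dvd_mono[OF dvd_refl])
qed simp

text \<open>The only unit among the polynomials over the two-element field is 1, so associates are
  equal.\<close>

lemma irreducible_bit_poly_dvd_eq:
  fixes p q :: "bit poly"
  assumes "irreducible p" "irreducible q" "p dvd q"
  shows "p = q"
proof -
  obtain r where r: "q = p * r" using assms by auto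
  hence "r dvd 1" using assms irreducible_not_unit irreducibleD by blast
  moreover from this have "r \<noteq> 0" by auto
  ultimately have "degree r = 0" "r \<noteq> 0" using is_unit_iff_degree by auto
  then obtain c where "r = [:c:]" "c \<noteq> 0" by (metis degree_0_id pCons_0_0)
  hence "r = 1" by (simp add: one_pCons)
  thus ?thesis using r by simp
qed

lemma irreducible_degree_pos:
  fixes p :: "'a::field poly"
  shows "irreducible p \<Longrightarrow> degree p > 0"
  using irreducible_not_unit[of p] is_unit_iff_degree[of p] by (cases "p = 0") auto

section \<open>Polynomials of a given degree over the two-element field\<close>

abbreviation bit_polys :: "nat \<Rightarrow> bit poly set" where
  "bit_polys n \<equiv> {f. f \<noteq> 0 \<and> degree f = n}"

lemma bit_polys_Suc: "bit_polys (Suc n) = pCons 0 ` bit_polys n \<union> pCons 1 ` bit_polys n"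
proof (intro equalityI subsetI)
  fix f assume f: "f \<in> bit_polys (Suc n)"
  obtain c g where cg: "f = pCons c g" by (cases f)
  have "g \<noteq> 0" using f cg by auto
  hence "g \<in> bit_polys n" using f cg by simp
  thus "f \<in> pCons 0 ` bit_polys n \<union> pCons 1 ` bit_polys n"
    using cg by (cases c) auto
qed auto

lemma bit_polys_0: "bit_polys 0 = {1}"
proof (intro equalityI subsetI)
  fix f assume f: "f \<in> bit_polys 0"
  then obtain c where "f = [:c:]" "c \<noteq> 0" by (metis (mono_tags, lifting) degree_0_id mem_Collect_eq pCons_0_0)
  thus "f \<in> {1}" by (simp add: one_pCons)
qed auto

lemma finite_card_bit_polys: "finite (bit_polys n) \<and> card (bit_polys n) = 2 ^ n"
proof (induction n)
  case 0
  show ?case unfolding bit_polys_0 by simp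
next
  case (Suc n)
  have "card (pCons 0 ` bit_polys n \<union> pCons 1 ` bit_polys n)
      = card (pCons 0 ` bit_polys n) + card (pCons 1 ` bit_polys n)"
    using Suc by (intro card_Un_disjoint) auto
  also have "\<dots> = 2 ^ Suc n"
    using Suc by (simp add: card_image inj_on_def)
  finally show ?case using Suc unfolding bit_polys_Suc by simp
qed

lemma finite_bit_polys_le: "finite {f :: bit poly. degree f \<le> n \<and> Q f}"
proof -
  have "{f :: bit poly. degree f \<le> n \<and> Q f} \<subseteq> insert 0 (\<Union>k\<le>n. bit_polys k)" by auto
  thus ?thesis using finite_card_bit_polys by (meson finite_UN_I finite_atMost finite_insert finite_subset)
qed

lemma card_bit_poly_multiples:
  assumes "g \<noteq> 0"
  shows "card {f \<in> bit_polys n. g dvd f} = (if degree g \<le> n then 2 ^ (n - degree g) else 0)"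
proof (cases "degree g \<le> n")
  case True
  have "{f \<in> bit_polys n. g dvd f} = (\<lambda>h. g * h) ` bit_polys (n - degree g)"
    using assms True by (auto simp: degree_mult_eq elim!: dvdE)
  moreover have "inj_on (\<lambda>h. g * h) (bit_polys (n - degree g))"
    using assms by (auto simp: inj_on_def)
  ultimately show ?thesis using True finite_card_bit_polys by (simp add: card_image)
next
  case False
  hence "{f \<in> bit_polys n. g dvd f} = {}" by (auto dest: dvd_imp_degree_le)
  thus ?thesis using False by (simp only: card.empty if_False)
qed

abbreviation irreds :: "nat \<Rightarrow> bit poly set" where
  "irreds n \<equiv> {p. degree p \<le> n \<and> irreducible p}"

text \<open>Unique factorization in additive form: p contributes its degree once for each power p^j
  dividing f, like log n as a sum of the von Mangoldt function over the divisors of n. The bound N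
  gives index ranges common to all f. The induction splits off one irreducible factor.\<close>

lemma degree_eq_sum_irreducible_powers:
  fixes f :: "bit poly"
  assumes "f \<noteq> 0" "degree f \<le> N"
  shows "degree f = (\<Sum>p\<in>irreds N. \<Sum>j=1..N. if p ^ j dvd f then degree p else 0)"
  using assms
proof (induction "degree f" arbitrary: f rule: less_induct)
  case less
  show ?case
  proof (cases "degree f = 0")
    case True
    have "\<not> p ^ j dvd f" if "irreducible p" "j \<in> {1..N}" for p j
    proof
      assume "p ^ j dvd f"
      hence "degree (p ^ j) \<le> 0" using dvd_imp_degree_le[of "p ^ j" f] less.prems True by simp
      moreover have "p \<noteq> 0" using that by auto
      ultimately have "j * degree p = 0" by (simp add: degree_power_eq)
      thus False using irreducible_degree_pos[OF that(1)] that(2) by simp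
    qed
    thus ?thesis using True by simp
  next
    case False
    then obtain q where q: "irreducible q" "q dvd f" using exists_irreducible_divisor by blast
    then obtain g where fg: "f = q * g" by auto
    have nz: "q \<noteq> 0" "g \<noteq> 0" using fg less.prems by auto
    have dq: "degree q > 0" using q irreducible_degree_pos by auto
    have deg: "degree f = degree q + degree g" using fg nz by (simp add: degree_mult_eq)
    have qN: "q \<in> irreds N" using q deg less.prems by auto
    have IH: "degree g = (\<Sum>p\<in>irreds N. \<Sum>j=1..N. if p ^ j dvd g then degree p else 0)"
      using less.hyps[of g] deg dq nz less.prems by auto
    have other: "p ^ j dvd f \<longleftrightarrow> p ^ j dvd g" if "irreducible p" "p \<noteq> q" for p j
    proof -
      have "\<not> p dvd q" using irreducible_bit_poly_dvd_eq[OF that(1) q(1)] that(2) by blast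
      hence "p ^ j dvd q * g \<Longrightarrow> p ^ j dvd g"
        by (rule prime_elem_power_dvd_mult[OF field_poly_irreducible_imp_prime[OF that(1)]])
      thus ?thesis unfolding fg using dvd_mult by blast
    qed
    have self: "q ^ Suc j dvd f \<longleftrightarrow> q ^ j dvd g" for j
      using dvd_times_left_cancel_iff[OF nz(1), of "q ^ j" g] fg by simp
    have Npos: "N \<ge> 1" using deg dq less.prems by auto
    \<comment> \<open>Removing q shifts the exponents {1..N} to {0..N-1}. Since the term for N is
      zero, the range can be refilled to {1..N} and only the term for exponent 0 is gained.\<close>
    have top: "\<not> q ^ N dvd g"
    proof
      assume "q ^ N dvd g"
      hence "degree (q ^ N) \<le> degree g" using nz by (intro dvd_imp_degree_le)
      hence "N * degree q \<le> degree g" using nz by (simp add: degree_power_eq)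
      moreover have "N * 1 \<le> N * degree q" using dq by (intro mult_le_mono2) simp
      ultimately show False using deg dq less.prems by linarith
    qed
    have "(\<Sum>j=1..N. if q ^ j dvd f then degree q else 0) = (\<Sum>j<N. if q ^ Suc j dvd f then degree q else 0)"
      by (rule sum.reindex_bij_witness[of _ Suc "\<lambda>j. j - 1"]) auto
    also have "\<dots> = (\<Sum>j<N. if q ^ j dvd g then degree q else 0)"
      by (simp only: self)
    also have "\<dots> = (\<Sum>j\<in>insert 0 {1..N}. if q ^ j dvd g then degree q else 0)"
    proof -
      have "insert 0 {1..N} = insert N {..<N}" using Npos by auto
      thus ?thesis using top by simp
    qed
    also have "\<dots> = degree q + (\<Sum>j=1..N. if q ^ j dvd g then degree q else 0)"
      by (subst sum.insert) auto
    finally have qsum: "(\<Sum>j=1..N. if q ^ j dvd f then degree q else 0)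
        = degree q + (\<Sum>j=1..N. if q ^ j dvd g then degree q else 0)" .
    have fin: "finite (irreds N)" by (rule finite_bit_polys_le)
    have rest: "(\<Sum>p\<in>irreds N - {q}. \<Sum>j=1..N. if p ^ j dvd f then degree p else 0)
        = (\<Sum>p\<in>irreds N - {q}. \<Sum>j=1..N. if p ^ j dvd g then degree p else 0)"
      using other by (intro sum.cong refl) auto
    let ?h = "\<lambda>f p. \<Sum>j=1..N. if p ^ j dvd f then degree p else 0"
    have "degree f = degree q + degree g" by (rule deg)
    also have "degree g = ?h g q + (\<Sum>p\<in>irreds N - {q}. ?h g p)"
      by (rule trans[OF IH sum.remove[OF fin qN]])
    also have "degree q + (?h g q + (\<Sum>p\<in>irreds N - {q}. ?h g p)) = ?h f q + (\<Sum>p\<in>irreds N - {q}. ?h f p)"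
      by (simp only: qsum rest add.assoc)
    also have "\<dots> = (\<Sum>p\<in>irreds N. ?h f p)"
      by (rule sum.remove[OF fin qN, symmetric])
    finally show ?thesis .
  qed
qed

text \<open>The product of all polynomials of degree k has degree k 2^k, and counting the multiples
  of p^j expresses this by irreducible polynomials. From n - 1 to n every term doubles except those
  with j deg p = n, so these account for the difference 2^n: the degrees of the irreducible
  polynomials whose degree divides n add up to 2^n. Each of them is at most n.\<close>

lemma card_irreds_lower:
  assumes "n \<ge> 1"
  shows "2 ^ n \<le> n * card (irreds n)"
proof -
  have fin: "finite (irreds n)" by (rule finite_bit_polys_le)
  \<comment> \<open>The total degree of all polynomials of degree k. The index ranges are those of n
    for every k, so that \<open>T n\<close> and \<open>T (n - 1)\<close> can be compared term by
    term.\<close>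
  define T where "T k = (\<Sum>p\<in>irreds n. \<Sum>j=1..n. if j * degree p \<le> k then 2 ^ (k - j * degree p) * degree p else 0)"
    for k :: nat
  have T: "T k = k * 2 ^ k" if "k \<le> n" for k
  proof -
    have "k * 2 ^ k = (\<Sum>f\<in>bit_polys k. degree f)"
      using finite_card_bit_polys[of k] by simp
    also have "\<dots> = (\<Sum>f\<in>bit_polys k. \<Sum>p\<in>irreds n. \<Sum>j=1..n. if p ^ j dvd f then degree p else 0)"
      using that by (intro sum.cong refl degree_eq_sum_irreducible_powers) auto
    also have "\<dots> = (\<Sum>p\<in>irreds n. \<Sum>j=1..n. \<Sum>f\<in>bit_polys k. if p ^ j dvd f then degree p else 0)"
    proof -
      have "(\<Sum>p\<in>irreds n. \<Sum>j=1..n. \<Sum>f\<in>bit_polys k. if p ^ j dvd f then degree p else 0)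
        = (\<Sum>p\<in>irreds n. \<Sum>f\<in>bit_polys k. \<Sum>j=1..n. if p ^ j dvd f then degree p else 0)"
        by (intro sum.cong refl sum.swap)
      also have "\<dots> = (\<Sum>f\<in>bit_polys k. \<Sum>p\<in>irreds n. \<Sum>j=1..n. if p ^ j dvd f then degree p else 0)"
        by (rule sum.swap)
      finally show ?thesis by simp
    qed
    also have "\<dots> = T k"
      unfolding T_def
    proof (intro sum.cong refl)
      fix p j assume p: "p \<in> irreds n" "j \<in> {1..n}"
      hence p0: "p \<noteq> 0" by auto
      have "(\<Sum>f\<in>bit_polys k. if p ^ j dvd f then degree p else 0)
          = card {f \<in> bit_polys k. p ^ j dvd f} * degree p"
        using finite_card_bit_polys[of k] by (subst sum.inter_filter[symmetric]) auto
      also have "\<dots> = (if j * degree p \<le> k then 2 ^ (k - j * degree p) * degree p else 0)"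
        using p0 by (subst card_bit_poly_multiples) (auto simp: degree_power_eq)
      finally show "(\<Sum>f\<in>bit_polys k. if p ^ j dvd f then degree p else 0)
          = (if j * degree p \<le> k then 2 ^ (k - j * degree p) * degree p else 0)" .
    qed
    finally show ?thesis by simp
  qed
  have inner: "(\<Sum>j=1..n. if j * degree p = n then degree p else 0) \<le> n" if "p \<in> irreds n" for p
  proof -
    have d: "degree p > 0" "degree p \<le> n" using that irreducible_degree_pos by auto
    have "(\<Sum>j=1..n. if j * degree p = n then degree p else 0)
        = (\<Sum>j\<in>{j\<in>{1..n}. j * degree p = n}. degree p)"
      by (subst sum.inter_filter) auto
    also have "\<dots> = card {j\<in>{1..n}. j * degree p = n} * degree p" by simp
    also have "\<dots> \<le> card {n div degree p} * degree p"
      using d by (intro mult_le_mono1 card_mono) auto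
    finally show ?thesis using d by simp
  qed
  have "T n = (\<Sum>p\<in>irreds n. \<Sum>j=1..n.
      2 * (if j * degree p \<le> n - 1 then 2 ^ (n - 1 - j * degree p) * degree p else 0)
      + (if j * degree p = n then degree p else 0))"
    unfolding T_def
  proof (intro sum.cong refl)
    fix p j
    show "(if j * degree p \<le> n then 2 ^ (n - j * degree p) * degree p else 0) =
       2 * (if j * degree p \<le> n - 1 then 2 ^ (n - 1 - j * degree p) * degree p else 0) +
       (if j * degree p = n then degree p else 0)"
    proof (cases "j * degree p \<le> n - 1")
      case True
      hence "n - j * degree p = Suc (n - 1 - j * degree p)" "j * degree p \<noteq> n" using assms by auto
      thus ?thesis using True by simp
    next
      case False
      thus ?thesis using assms by auto
    qed
  qed
  also have "\<dots> = 2 * T (n - 1) + (\<Sum>p\<in>irreds n. \<Sum>j=1..n. if j * degree p = n then degree p else 0)"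
    unfolding T_def by (simp only: sum.distrib sum_distrib_left)
  also have "\<dots> \<le> 2 * T (n - 1) + (\<Sum>p\<in>irreds n. n)"
    using inner by (intro add_left_mono sum_mono) auto
  finally have "T n \<le> 2 * T (n - 1) + n * card (irreds n)" by (simp add: mult.commute)
  moreover have "T n = n * 2 ^ n" "T (n - 1) = (n - 1) * 2 ^ (n - 1)" by (auto intro: T)
  moreover have "n * 2 ^ n = 2 * ((n - 1) * 2 ^ (n - 1)) + 2 ^ n"
    using assms by (cases n) (auto simp: algebra_simps)
  ultimately show ?thesis by linarith
qed

text \<open>For positive k this says that the binary logarithm of k is at most 3 k / 4, the form in
  which it is applied. The induction starts at 3, from where k + 1 \<le> 4 k / 3, and (4/3)^4 <
  8.\<close>

lemma power4_le_power8: "k ^ 4 \<le> 8 ^ k" for k :: nat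
proof (cases "k \<le> 3")
  case True
  hence "k \<in> {0, 1, 2, 3}" by auto
  thus ?thesis by auto
next
  case False
  hence "k \<ge> 3" by simp
  thus ?thesis
  proof (induction k rule: dec_induct)
    case base show ?case by simp
  next
    case (step k)
    have "(Suc k) ^ 4 \<le> 8 * k ^ 4"
    proof -
      have "(3 * Suc k) ^ 4 \<le> (4 * k) ^ 4" using step by (intro power_mono) auto
      hence "81 * Suc k ^ 4 \<le> 256 * k ^ 4" by (simp add: power_mult_distrib del: mult_Suc_right)
      thus ?thesis by linarith
    qed
    thus ?case using step by simp
  qed
qed

text \<open>With k = deg - 1, every irreducible polynomial of degree at most k is listed before
  \<open>P i\<close>. So there are fewer than i of them, and 2^k \<le> k i. Binary logarithms give k
  \<le> ld k + ld i, and ld k \<le> 3 k / 4 turns this into k \<le> 4 ld i; insert it into 2^(k + 1)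
  \<le> 2 k i.\<close>

lemma two_power_degree_le:
  assumes "irreducible_listing P" "i \<ge> 1"
  shows "2 ^ degree (P i) \<le> 8 * real i * log 2 (real i + 2)"
proof -
  define k where "k = degree (P i) - 1"
  have bij: "bij_betw P {1..} {f. irreducible f}"
    and mono: "\<And>i j. 1 \<le> i \<Longrightarrow> i \<le> j \<Longrightarrow> degree (P i) \<le> degree (P j)"
    using assms(1) by (auto simp: irreducible_listing_def)
  have irr: "irreducible (P i)" using bij assms(2) by (auto simp: bij_betw_def)
  have Pk: "degree (P i) = Suc k" using irreducible_degree_pos[OF irr] by (simp add: k_def)
  have sub: "irreds k \<subseteq> P ` {1..<i}"
  proof
    fix f assume f: "f \<in> irreds k"
    then obtain j where j: "j \<ge> 1" "f = P j" using bij by (fastforce simp: bij_betw_def)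
    have "j < i"
    proof (rule ccontr)
      assume "\<not> j < i"
      hence "degree (P i) \<le> degree (P j)" using mono assms(2) by simp
      thus False using f j Pk by simp
    qed
    thus "f \<in> P ` {1..<i}" using j by auto
  qed
  have card: "card (irreds k) < i"
  proof -
    have "card (irreds k) \<le> card {1..<i}" using sub by (rule surj_card_le[rotated]) simp
    thus ?thesis using assms(2) by simp
  qed
  have log1: "log 2 (real i + 2) \<ge> 1" using assms(2) by (subst le_log_iff) auto
  show ?thesis
  proof (cases "k = 0")
    case True
    have "8 * 1 * 1 \<le> 8 * real i * log 2 (real i + 2)"
      using assms(2) log1 by (intro mult_mono) auto
    thus ?thesis using True Pk by simp
  next
    case False
    hence k: "k \<ge> 1" by simp
    have "2 ^ k \<le> k * card (irreds k)" using k by (rule card_irreds_lower)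
    also have "\<dots> \<le> k * i" using card by simp
    finally have "real (2 ^ k) \<le> real (k * i)" by (rule of_nat_mono)
    hence ki: "2 ^ k \<le> real k * real i" by simp
    have "log 2 (real k ^ 4) \<le> log 2 (8 ^ k)"
      using k power4_le_power8[of k] by (subst log_le_cancel_iff) (auto simp flip: of_nat_power simp del: of_nat_power)
    hence logk: "4 * log 2 (real k) \<le> 3 * real k"
    proof -
      have "(8::real) ^ k = 2 ^ (3 * k)" by (simp add: power_mult)
      hence "log 2 ((8::real) ^ k) = 3 * real k" by (simp add: log_nat_power)
      thus ?thesis using \<open>log 2 (real k ^ 4) \<le> log 2 (8 ^ k)\<close> k by (simp add: log_nat_power)
    qed
    have "real k = log 2 (2 ^ k)" by (simp add: log_nat_power)
    also have "\<dots> \<le> log 2 (real k * real i)"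
      using ki k assms(2) by (subst log_le_cancel_iff) auto
    also have "\<dots> = log 2 (real k) + log 2 (real i)"
      using k assms(2) by (simp add: log_mult)
    also have "log 2 (real i) \<le> log 2 (real i + 2)" using assms(2) by (subst log_le_cancel_iff) auto
    finally have "real k \<le> 4 * log 2 (real i + 2)" using logk by linarith
    hence "real i * real k \<le> real i * (4 * log 2 (real i + 2))" by (intro mult_left_mono) auto
    moreover have "(2::real) ^ degree (P i) = 2 * 2 ^ k" unfolding Pk by (rule power_Suc)
    ultimately show ?thesis using ki by (simp only: mult.assoc mult.commute[of "real k"])
  qed
qed

section \<open>Linear independence of the rows of the generating matrices\<close>

lemma laurent_of_poly_pCons:
  "laurent_of_poly (pCons c f) = fls_const c + fls_X_inv * laurent_of_poly f"
  by (simp add: laurent_of_poly_def map_poly_pCons)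

lemma laurent_of_poly_0: "laurent_of_poly 0 = 0"
  by (simp add: laurent_of_poly_def)

lemma laurent_of_poly_1: "laurent_of_poly 1 = 1"
  by (simp add: one_pCons laurent_of_poly_pCons laurent_of_poly_0)

lemma laurent_of_poly_add: "laurent_of_poly (f + g) = laurent_of_poly f + laurent_of_poly g"
proof (induction f g rule: poly_induct2)
  case 0
  show ?case by (simp add: laurent_of_poly_0)
next
  case (pCons a f b g)
  show ?case
    unfolding add_pCons laurent_of_poly_pCons pCons.IH fls_plus_const[symmetric]
    by (simp only: distrib_left ac_simps)
qed

lemma laurent_of_poly_smult: "laurent_of_poly (Polynomial.smult c f) = fls_const c * laurent_of_poly f"
proof (induction f)
  case 0
  show ?case by (simp add: laurent_of_poly_0)
next
  case (pCons a f)
  show ?case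
    unfolding smult_pCons laurent_of_poly_pCons pCons.IH fls_const_mult_const[symmetric]
    by (simp only: distrib_left ac_simps)
qed

lemma laurent_of_poly_mult: "laurent_of_poly (f * g) = laurent_of_poly f * laurent_of_poly g"
proof (induction f)
  case 0
  show ?case by (simp add: laurent_of_poly_0)
next
  case (pCons a f)
  show ?case
    unfolding mult_pCons_left laurent_of_poly_add laurent_of_poly_pCons pCons.IH laurent_of_poly_smult
      fls_const_0
    by (simp only: distrib_left distrib_right ac_simps add_0_left)
qed

lemma laurent_of_poly_power: "laurent_of_poly (f ^ n) = laurent_of_poly f ^ n"
  by (induction n) (simp_all only: power_0 power_Suc laurent_of_poly_1 laurent_of_poly_mult)

lemma laurent_of_poly_sum: "laurent_of_poly (sum f A) = (\<Sum>x\<in>A. laurent_of_poly (f x))"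
  by (induction A rule: infinite_finite_induct) (simp_all add: laurent_of_poly_0 laurent_of_poly_add)

text \<open>The formal variable stands for 1/x, so the subdegree is the valuation at infinity.
  Multiplying by x lowers it by one below zero, where a constant cannot cancel the leading
  term.\<close>

lemma laurent_of_poly_nonzero_subdegree:
  assumes "f \<noteq> 0"
  shows "laurent_of_poly f \<noteq> 0 \<and> fls_subdegree (laurent_of_poly f) = - int (degree f)"
  using assms
proof (induction f)
  case (pCons c f)
  show ?case
  proof (cases "f = 0")
    case True
    thus ?thesis using pCons.hyps pCons.prems by (simp add: laurent_of_poly_pCons laurent_of_poly_0)
  next
    case False
    let ?g = "fls_X_inv * laurent_of_poly f"
    have IH: "laurent_of_poly f \<noteq> 0" "fls_subdegree (laurent_of_poly f) = - int (degree f)"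
      using pCons.IH False by auto
    have X: "(fls_X_inv :: bit fls) \<noteq> 0" by simp
    have g: "?g \<noteq> 0" "fls_subdegree ?g = - int (Suc (degree f))"
      using IH X by (auto simp: fls_subdegree_mult)
    have sub: "fls_subdegree (?g + fls_const c) = fls_subdegree ?g"
      by (rule fls_subdegree_add_eq1[OF g(1)]) (simp add: g(2))
    hence "?g + fls_const c \<noteq> 0" using g(2) by (metis fls_zero_subdegree neg_equal_0_iff_equal of_nat_eq_0_iff Zero_not_Suc)
    thus ?thesis using sub g(2) False by (simp only: laurent_of_poly_pCons add.commute[of "fls_const c"] degree_pCons_eq simp_thms)
  qed
qed simp

section \<open>Partial fractions and independence of the rows\<close>

lemma sum_nonzero_distinct_degrees:
  fixes f :: "'i \<Rightarrow> 'a::comm_ring_1 poly"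
  assumes "finite A" "A \<noteq> {}" "\<And>x. x \<in> A \<Longrightarrow> f x \<noteq> 0" "inj_on (\<lambda>x. degree (f x)) A"
  shows "sum f A \<noteq> 0"
proof -
  have "Max ((\<lambda>x. degree (f x)) ` A) \<in> (\<lambda>x. degree (f x)) ` A"
    using assms by (intro Max_in) auto
  then obtain a where a: "a \<in> A" "Max ((\<lambda>x. degree (f x)) ` A) = degree (f a)" by auto
  have le: "degree (f x) \<le> degree (f a)" if "x \<in> A" for x
    using that assms(1) unfolding a(2)[symmetric] by (intro Max_ge) auto
  have "coeff (sum f A) (degree (f a)) = (\<Sum>x\<in>A. coeff (f x) (degree (f a)))"
    by (rule coeff_sum)
  also have "\<dots> = coeff (f a) (degree (f a))"
  proof (subst sum.remove[OF assms(1) a(1)], subst sum.neutral)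
    show "\<forall>x\<in>A - {a}. coeff (f x) (degree (f a)) = 0"
    proof
      fix x assume x: "x \<in> A - {a}"
      hence "degree (f x) \<noteq> degree (f a)" using inj_onD[OF assms(4), of x a] a by auto
      with le[of x] x show "coeff (f x) (degree (f a)) = 0" by (intro coeff_eq_0) auto
    qed
  qed simp
  also have "\<dots> \<noteq> 0" using assms(3)[OF a(1)] by simp
  finally show ?thesis by auto
qed

lemma prime_elem_dvd_prod:
  assumes "finite A" "prime_elem p" "p dvd prod f A"
  shows "\<exists>x\<in>A. p dvd f x"
  using assms
proof (induction A rule: finite_induct)
  case (insert x A)
  hence "p dvd f x \<or> p dvd prod f A"
    using prime_elem_dvd_multD[of p "f x" "prod f A"] by simp
  thus ?case using insert by auto
qed (auto simp: prime_elem_def)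

text \<open>Over the two-element field a linear combination of rows is a sum over a set
  \<open>S\<close>. If it vanished in the first m columns, the sum \<open>W\<close> of the
  corresponding fractions would have valuation above m. Multiplied by the common denominator
  \<open>D\<close>, of degree at most m, it would be a polynomial of positive valuation, hence 0.
  Modulo a power of one \<open>P i0\<close> only the rows of coordinate i0 survive, and their
  numerators have distinct degrees.\<close>

lemma nied_rows_independent:
  assumes P: "irreducible_listing P" and \<rho>: "row_numerators P \<rho>"
    and u: "finite u" "u \<subseteq> {1..}"
    and S: "S \<subseteq> (SIGMA i:u. {..<d i})" "S \<noteq> {}"
    and m: "(\<Sum>i\<in>u. d i + degree (P i) - 1) \<le> m"
  shows "\<exists>r\<in>{1..m}. (\<Sum>(i, j)\<in>S. nied_entry P \<rho> i (j + 1) r) \<noteq> 0"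
proof (rule ccontr)
  assume "\<not> ?thesis"
  hence zero: "(\<Sum>(i, j)\<in>S. nied_entry P \<rho> i (j + 1) r) = 0" if "r \<in> {1..m}" for r
    using that by blast
  define e where "e i = degree (P i)" for i
  \<comment> \<open>This is d i / e i rounded up, the number of powers of \<open>P i\<close> that
    the first d i rows involve. Hence n i e i is at most d i + e i - 1, which explains the
    hypothesis on m.\<close>
  define n where "n i = (d i + e i - 1) div e i" for i
  define num where "num i j = \<rho> i (j mod e i)" for i j
  define t where "t i j = laurent_of_poly (num i j) / laurent_of_poly (P i) ^ (j div e i + 1)" for i j
  define D where "D = (\<Prod>i\<in>u. P i ^ n i)"
  define R where "R i = (\<Prod>i'\<in>u - {i}. P i' ^ n i')" for i
  define h where "h i j = num i j * P i ^ (n i - j div e i - 1)" for i j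
  define N where "N = (\<Sum>(i, j)\<in>S. h i j * R i)"
  define W where "W = (\<Sum>(i, j)\<in>S. t i j)"
  have finS: "finite S" by (rule finite_subset[OF S(1)]) (use u in auto)
  have irr: "irreducible (P i)" if "i \<in> u" for i
    using P that u by (auto simp: irreducible_listing_def bij_betw_def)
  have e1: "e i \<ge> 1" if "i \<in> u" for i
    using irreducible_degree_pos[OF irr[OF that]] by (simp add: e_def)
  have Pnz: "P i \<noteq> 0" if "i \<in> u" for i using e1[OF that] by (auto simp: e_def)
  have Pinj: "i = i'" if "i \<in> u" "i' \<in> u" "P i = P i'" for i i'
  proof (rule inj_onD[of P "{1..}"])
    show "inj_on P {1..}" using P by (auto simp: irreducible_listing_def bij_betw_def)
  qed (use that u in auto)
  have Qn: "j div e i < n i" if "i \<in> u" "j < d i" for i j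
  proof -
    have "j div e i + 1 = (j + e i) div e i" using e1[OF that(1)] by simp
    also have "\<dots> \<le> n i" unfolding n_def using that e1[OF that(1)] by (intro div_le_mono) auto
    finally show ?thesis by simp
  qed
  have num_deg: "num i j \<noteq> 0 \<and> degree (num i j) < e i" if "i \<in> u" for i j
  proof -
    have "j mod e i < e i" using e1[OF that] by simp
    moreover have "i \<ge> 1" using that u by auto
    ultimately have "num i j = monom 1 (j mod e i) \<or> num i j = monom 1 (e i - j mod e i - 1)"
      using \<rho> unfolding row_numerators_def num_def e_def by blast
    thus ?thesis using \<open>j mod e i < e i\<close> by (auto simp: degree_monom_eq)
  qed
  have Sin: "i \<in> u" "j < d i" if "(i, j) \<in> S" for i j using that S by auto
  \<comment> \<open>The fractions are proper, so their expansions have only negative powers of x and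
    the columns 1, 2, ... capture them completely.\<close>
  have t_sub: "fls_nth (t i j) k = 0" if "i \<in> u" "k \<le> 0" for i j k
  proof (rule fls_eq0_below_subdegree)
    let ?Q = "j div e i + 1"
    note num = laurent_of_poly_nonzero_subdegree[OF conjunct1[OF num_deg[OF that(1), of j]]]
    note pp = laurent_of_poly_nonzero_subdegree[OF Pnz[OF that(1)]]
    have "fls_subdegree (t i j) = - int (degree (num i j)) - int ?Q * (- int (e i))"
      unfolding t_def using num pp by (subst fls_divide_subdegree) (auto simp: fls_subdegree_pow e_def algebra_simps)
    moreover have "int (degree (num i j)) < int (e i)" using num_deg[OF that(1)] by simp
    moreover have "int ?Q * int (e i) \<ge> 1 * int (e i)" by (intro mult_right_mono) auto
    ultimately show "k < fls_subdegree (t i j)" using that(2) by linarith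
  qed
  have W0: "fls_nth W k = 0" if "k < int m + 1" for k
  proof -
    have Wk: "fls_nth W k = (\<Sum>(i, j)\<in>S. fls_nth (t i j) k)"
      unfolding W_def fls_nth_sum by (simp add: case_prod_unfold)
    show ?thesis
    proof (cases "k \<le> 0")
      case True
      show ?thesis unfolding Wk using True Sin by (intro sum.neutral) (auto intro!: t_sub)
    next
      case False
      define r where "r = nat k"
      have r: "k = int r" "r \<in> {1..m}" using False \<open>k < int m + 1\<close> by (auto simp: r_def)
      have "(\<Sum>(i, j)\<in>S. fls_nth (t i j) k) = (\<Sum>(i, j)\<in>S. nied_entry P \<rho> i (j + 1) r)"
        by (intro sum.cong refl) (auto simp: nied_entry_def t_def num_def e_def r Let_def)
      thus ?thesis using Wk zero[OF r(2)] by simp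
    qed
  qed
  have D_eq: "D = P i ^ n i * R i" if "i \<in> u" for i
    unfolding D_def R_def using u that by (simp add: prod.remove)
  have LN: "laurent_of_poly N = laurent_of_poly D * W"
  proof -
    have teq: "laurent_of_poly (h i j * R i) = laurent_of_poly D * t i j" if "(i, j) \<in> S" for i j
    proof -
      let ?Q = "j div e i + 1" and ?p = "laurent_of_poly (P i)"
      have iu: "i \<in> u" "j < d i" using Sin that by auto
      have p0: "?p \<noteq> 0" using laurent_of_poly_nonzero_subdegree Pnz iu by blast
      have "n i = (n i - j div e i - 1) + ?Q" using Qn[OF iu] by simp
      hence "?p ^ n i = ?p ^ (n i - j div e i - 1) * ?p ^ ?Q" by (metis power_add)
      hence "laurent_of_poly D * t i j
          = ?p ^ (n i - j div e i - 1) * laurent_of_poly (R i) * (?p ^ ?Q * (laurent_of_poly (num i j) / ?p ^ ?Q))"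
        unfolding D_eq[OF iu(1)] laurent_of_poly_mult laurent_of_poly_power t_def by (simp only: ac_simps)
      also have "?p ^ ?Q * (laurent_of_poly (num i j) / ?p ^ ?Q) = laurent_of_poly (num i j)"
        unfolding times_divide_eq_right by (rule nonzero_mult_div_cancel_left[OF power_not_zero[OF p0]])
      finally show ?thesis
        unfolding h_def laurent_of_poly_mult laurent_of_poly_power by (simp only: ac_simps)
    qed
    show ?thesis unfolding N_def W_def laurent_of_poly_sum sum_distrib_left
    proof (rule sum.cong[OF refl])
      fix x assume "x \<in> S"
      thus "laurent_of_poly (case x of (i, j) \<Rightarrow> h i j * R i) = laurent_of_poly D * (case x of (i, j) \<Rightarrow> t i j)"
        using teq[of "fst x" "snd x"] by (simp only: case_prod_beta prod.collapse)
    qed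
  qed
  have D0: "D \<noteq> 0" unfolding D_def using u Pnz by simp
  have degD: "degree D \<le> m"
  proof -
    have "P i ^ n i \<noteq> 0" if "i \<in> u" for i using Pnz[OF that] by (rule power_not_zero)
    hence "degree D = (\<Sum>i\<in>u. degree (P i ^ n i))"
      unfolding D_def by (intro degree_prod_eq_sum_degree ballI)
    also have "\<dots> \<le> (\<Sum>i\<in>u. d i + degree (P i) - 1)"
    proof (rule sum_mono)
      fix i assume "i \<in> u"
      have "degree (P i ^ n i) = n i * e i"
        unfolding e_def by (rule degree_power_eq[OF Pnz[OF \<open>i \<in> u\<close>]])
      also have "\<dots> \<le> d i + e i - 1" unfolding n_def by (rule div_times_less_eq_dividend)
      finally show "degree (P i ^ n i) \<le> d i + degree (P i) - 1" by (simp only: e_def)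
    qed
    finally show ?thesis using m by simp
  qed
  \<comment> \<open>A nonzero polynomial has valuation - deg \<le> 0, whereas \<open>D\<close> times
    \<open>W\<close> has valuation at least m + 1 - deg D > 0.\<close>
  have "N = 0"
  proof (rule ccontr)
    assume N: "N \<noteq> 0"
    note LNz = laurent_of_poly_nonzero_subdegree[OF N]
    have W: "W \<noteq> 0" using LNz LN by auto
    have "fls_subdegree W \<ge> int m + 1" by (rule fls_subdegree_geI[OF W W0])
    moreover have "fls_subdegree (laurent_of_poly D * W) = - int (degree D) + fls_subdegree W"
      using laurent_of_poly_nonzero_subdegree[OF D0] W by (simp add: fls_subdegree_mult)
    ultimately show False using LNz degD unfolding LN by linarith
  qed
  \<comment> \<open>The cofactor \<open>R i\<close> of any other coordinate contains the full power
    of \<open>P i0\<close>, while \<open>R i0\<close> is prime to it. So the power divides the part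
    \<open>H\<close> of coordinate i0, which is too small in degree.\<close>
  obtain i0 j0 where ij0: "(i0, j0) \<in> S" using S(2) by auto
  hence i0: "i0 \<in> u" using Sin by auto
  define J where "J = {j. (i0, j) \<in> S}"
  have finJ: "finite J" unfolding J_def by (rule finite_subset[of _ "snd ` S"]) (use finS in force)+
  define H where "H = (\<Sum>j\<in>J. h i0 j)"
  define rest where "rest = (\<Sum>(i, j)\<in>S - {i0} \<times> J. h i j * R i)"
  have N_split: "N = H * R i0 + rest"
  proof -
    have "N = (\<Sum>(i, j)\<in>S - {i0} \<times> J. h i j * R i) + (\<Sum>(i, j)\<in>{i0} \<times> J. h i j * R i)"
      unfolding N_def using finS by (intro sum.subset_diff) (auto simp: J_def)
    also have "(\<Sum>(i, j)\<in>{i0} \<times> J. h i j * R i) = H * R i0"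
      unfolding H_def sum_distrib_right by (subst sum.cartesian_product[symmetric]) simp
    finally show ?thesis by (simp only: rest_def add.commute)
  qed
  have "P i0 ^ n i0 dvd rest"
    unfolding rest_def
  proof (intro dvd_sum)
    fix x assume x: "x \<in> S - {i0} \<times> J"
    obtain i j where ij: "x = (i, j)" by (cases x)
    have "i \<noteq> i0" using x by (auto simp: ij J_def)
    hence "P i0 ^ n i0 dvd R i" unfolding R_def using i0 u by (intro dvd_prodI) auto
    thus "P i0 ^ n i0 dvd (case x of (i, j) \<Rightarrow> h i j * R i)" by (simp add: ij)
  qed
  moreover have "P i0 ^ n i0 dvd H * R i0 + rest" using \<open>N = 0\<close> N_split by simp
  ultimately have dvdRH: "P i0 ^ n i0 dvd R i0 * H" by (metis dvd_add_left_iff mult.commute)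
  have pr: "prime_elem (P i0)" by (rule field_poly_irreducible_imp_prime[OF irr[OF i0]])
  have ndvd: "\<not> P i0 dvd R i0"
  proof
    assume "P i0 dvd R i0"
    hence dv: "P i0 dvd (\<Prod>i'\<in>u - {i0}. P i' ^ n i')" by (simp only: R_def)
    have fin: "finite (u - {i0})" using u by simp
    obtain i' where i': "i' \<in> u - {i0}" "P i0 dvd P i' ^ n i'"
      using prime_elem_dvd_prod[OF fin pr dv] ..
    from i'(2) have "P i0 dvd P i'" by (rule prime_elem_dvd_power[OF pr])
    hence "P i0 = P i'" using irr i0 i' by (intro irreducible_bit_poly_dvd_eq) auto
    thus False using Pinj i0 i' by blast
  qed
  have dvdH: "P i0 ^ n i0 dvd H" by (rule prime_elem_power_dvd_mult[OF pr ndvd dvdRH])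
  have hnz: "h i0 j \<noteq> 0" for j unfolding h_def using Pnz[OF i0] num_deg[OF i0] by simp
  have hdeg: "degree (h i0 j) = degree (num i0 j) + e i0 * (n i0 - j div e i0 - 1)" for j
    unfolding h_def using Pnz[OF i0] num_deg[OF i0]
    by (simp add: degree_mult_eq degree_power_eq e_def)
  have Jd: "j < d i0" if "j \<in> J" for j using that Sin by (auto simp: J_def)
  have Hnz: "H \<noteq> 0"
    unfolding H_def
  proof (rule sum_nonzero_distinct_degrees[OF finJ])
    show "J \<noteq> {}" using ij0 by (auto simp: J_def)
    \<comment> \<open>The degree is e (n - Q - 1) plus a numerator degree below e. Division with
      remainder by e recovers Q and that numerator degree, and either ordering of the numerators
      then recovers z.\<close>
    show "inj_on (\<lambda>j. degree (h i0 j)) J"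
    proof (rule inj_onI)
      fix j j' assume jj: "j \<in> J" "j' \<in> J" "degree (h i0 j) = degree (h i0 j')"
      have dm: "degree (num i0 j) < e i0" "degree (num i0 j') < e i0" using num_deg[OF i0] by auto
      have eq: "degree (num i0 j) + e i0 * (n i0 - j div e i0 - 1)
          = degree (num i0 j') + e i0 * (n i0 - j' div e i0 - 1)"
        using jj(3) by (simp only: hdeg)
      have d1: "degree (num i0 j) = degree (num i0 j')"
        using arg_cong[OF eq, of "\<lambda>x. x mod e i0"] dm by simp
      hence "n i0 - j div e i0 - 1 = n i0 - j' div e i0 - 1" using eq e1[OF i0] by simp
      hence dv: "j div e i0 = j' div e i0" using Qn[OF i0 Jd[OF jj(1)]] Qn[OF i0 Jd[OF jj(2)]] by linarith
      have lt: "j mod e i0 < e i0" "j' mod e i0 < e i0" using e1[OF i0] by auto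
      have cancel: "x = y" if "x < e i0" "y < e i0" "e i0 - x - 1 = e i0 - y - 1" for x y
        using that by linarith
      have i1: "i0 \<ge> 1" using i0 u by auto
      have "(\<forall>z<e i0. \<rho> i0 z = monom 1 z) \<or> (\<forall>z<e i0. \<rho> i0 z = monom 1 (e i0 - z - 1))"
        using \<rho> i1 unfolding row_numerators_def e_def by blast
      hence "j mod e i0 = j' mod e i0"
      proof
        assume a: "\<forall>z<e i0. \<rho> i0 z = monom 1 z"
        show ?thesis
          using d1 unfolding num_def a[rule_format, OF lt(1)] a[rule_format, OF lt(2)]
          by (simp add: degree_monom_eq)
      next
        assume a: "\<forall>z<e i0. \<rho> i0 z = monom 1 (e i0 - z - 1)"
        show ?thesis
          using d1 unfolding num_def a[rule_format, OF lt(1)] a[rule_format, OF lt(2)]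
            degree_monom_eq[OF one_neq_zero] by (rule cancel[OF lt])
      qed
      with dv show "j = j'" by (metis div_mult_mod_eq)
    qed
  qed (rule hnz)
  have "degree H < n i0 * e i0"
  proof -
    have n0: "n i0 > 0" using Qn[OF i0 Sin(2)[OF ij0]] by simp
    have "degree (h i0 j) < n i0 * e i0" if "j \<in> J" for j
    proof -
      have "degree (h i0 j) < e i0 + e i0 * (n i0 - 1)"
        unfolding hdeg using num_deg[OF i0, of j] by (intro add_less_le_mono mult_le_mono2) auto
      also have "\<dots> = n i0 * e i0" proof -
        have "1 + (n i0 - 1) = n i0" using n0 by linarith
        thus ?thesis by (metis add_mult_distrib mult.commute mult_1)
      qed
      finally show ?thesis .
    qed
    moreover have "0 < n i0 * e i0" using n0 e1[OF i0] by simp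
    ultimately show ?thesis unfolding H_def by (rule degree_sum_less)
  qed
  moreover have "degree (P i0 ^ n i0) = n i0 * e i0"
    unfolding e_def by (rule degree_power_eq[OF Pnz[OF i0]])
  ultimately show False
    using dvd_imp_degree_le[OF dvdH Hnz] by linarith
qed

section \<open>Points of the net in dyadic boxes\<close>

text \<open>These simplification rules rewrite field arithmetic on bits to bit operations.\<close>

declare add_bit_eq_xor [simp del] mult_bit_eq_and [simp del]

section \<open>Dyadic intervals and binary expansions\<close>

definition cell :: "nat \<Rightarrow> real \<Rightarrow> nat" where
  "cell k t = nat \<lfloor>2 ^ k * t\<rfloor>"

lemma cell_dyadic: "d \<le> M \<Longrightarrow> cell d (real N / 2 ^ M) = N div 2 ^ (M - d)"
proof -
  assume "d \<le> M"
  hence "(2::real) ^ M = 2 ^ d * 2 ^ (M - d)" by (simp flip: power_add)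
  hence "2 ^ d * (real N / 2 ^ M) = real N / real (2 ^ (M - d))" by simp
  thus ?thesis unfolding cell_def by (simp only: floor_divide_of_nat_eq nat_int)
qed

lemma cell_dyadic_fine: "M \<le> d \<Longrightarrow> cell d (real N / 2 ^ M) = N * 2 ^ (d - M)"
proof -
  assume "M \<le> d"
  hence "(2::real) ^ d = 2 ^ M * 2 ^ (d - M)" by (simp flip: power_add)
  hence "2 ^ d * (real N / 2 ^ M) = real (N * 2 ^ (d - M))" by simp
  thus ?thesis unfolding cell_def by (simp only: floor_of_nat nat_int)
qed

lemma cell_coarsen:
  assumes "d' \<le> d" "0 \<le> t"
  shows "cell d' t = cell d t div 2 ^ (d - d')"
proof -
  have "(2::real) ^ d = 2 ^ d' * 2 ^ (d - d')" using assms by (simp flip: power_add)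
  hence "2 ^ d' * t = (2 ^ d * t) / real_of_int (2 ^ (d - d'))" by simp
  hence "\<lfloor>2 ^ d' * t\<rfloor> = \<lfloor>2 ^ d * t\<rfloor> div 2 ^ (d - d')"
    by (simp only: floor_divide_real_eq_div zero_le_power zero_le_numeral)
  moreover have "0 \<le> \<lfloor>2 ^ d * t\<rfloor>" using assms by simp
  ultimately show ?thesis unfolding cell_def by (simp add: nat_div_distrib nat_power_eq)
qed

lemma cell_less: "0 \<le> t \<Longrightarrow> t < 1 \<Longrightarrow> cell k t < 2 ^ k"
proof -
  assume t: "0 \<le> t" "t < 1"
  have "2 ^ k * t < 2 ^ k * 1" using t by (intro mult_strict_left_mono) auto
  hence "\<lfloor>2 ^ k * t\<rfloor> < 2 ^ k" by (simp add: floor_less_iff)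
  thus ?thesis unfolding cell_def by (simp add: nat_less_iff t)
qed

text \<open>Horner's scheme with the leading digit first, the order in which the rows of a
  generating matrix deliver the digits. Keeping the first d digits thus amounts to rounding down to
  level d.\<close>

fun binary_value :: "(nat \<Rightarrow> bool) \<Rightarrow> nat \<Rightarrow> nat" where
  "binary_value f 0 = 0"
| "binary_value f (Suc d) = 2 * binary_value f d + of_bool (f d)"

lemma binary_value_less: "binary_value f d < 2 ^ d"
  by (induction d) auto

lemma binary_value_div: "binary_value f (d + j) div 2 ^ j = binary_value f d"
proof (induction j)
  case (Suc j)
  have "binary_value f (d + Suc j) div 2 ^ Suc j = (binary_value f (d + Suc j) div 2) div 2 ^ j"
    by (simp add: div_mult2_eq)
  also have "binary_value f (d + Suc j) div 2 = binary_value f (d + j)" by simp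
  finally show ?case using Suc by simp
qed simp

lemma binary_value_eq_sum: "real (binary_value f m) / 2 ^ m = (\<Sum>k<m. of_bool (f k) / 2 ^ (k + 1))"
proof (induction m)
  case (Suc m)
  have "real (binary_value f (Suc m)) / 2 ^ Suc m
      = real (binary_value f m) / 2 ^ m + of_bool (f m) / 2 ^ (m + 1)"
    by (simp add: add_divide_distrib)
  thus ?case using Suc by simp
qed simp

lemma binary_value_eq_iff:
  "c < 2 ^ d \<Longrightarrow> binary_value f d = c \<longleftrightarrow> (\<forall>k<d. f k = odd (c div 2 ^ (d - 1 - k)))"
proof (induction d arbitrary: c)
  case (Suc d)
  have "binary_value f (Suc d) = c \<longleftrightarrow> binary_value f d = c div 2 \<and> f d = odd c"
    by (cases "f d") auto
  also have "binary_value f d = c div 2 \<longleftrightarrow> (\<forall>k<d. f k = odd (c div 2 div 2 ^ (d - 1 - k)))"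
    using Suc.prems by (intro Suc.IH) simp
  also have "\<dots> \<longleftrightarrow> (\<forall>k<d. f k = odd (c div 2 ^ (d - k)))"
  proof -
    have "c div 2 div 2 ^ (d - 1 - k) = c div 2 ^ (d - k)" if "k < d" for k
    proof -
      have "d - k = Suc (d - 1 - k)" using that by simp
      thus ?thesis by (simp only: power_Suc div_mult2_eq)
    qed
    thus ?thesis by simp
  qed
  finally show ?case by (auto simp: less_Suc_eq)
qed simp

section \<open>The non-trivial additive character of the two-element field, and linear
  systems\<close>

definition bit_sign :: "bit \<Rightarrow> real" where
  "bit_sign b = (if b = 0 then 1 else - 1)"

lemma bit_sign_0: "bit_sign 0 = 1"
  by (simp add: bit_sign_def)

lemma bit_add_self: "b + b = (0 :: bit)"
  by (cases b) (simp_all add: add_bit_eq_xor)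

lemma bit_sign_add: "bit_sign (a + b) = bit_sign a * bit_sign b"
  by (cases a; cases b) (simp_all add: bit_sign_def bit_add_self)

lemma bit_sign_sum: "bit_sign (sum f A) = (\<Prod>x\<in>A. bit_sign (f x))"
  by (induction A rule: infinite_finite_induct) (simp_all add: bit_sign_0 bit_sign_add)

abbreviation digit :: "nat \<Rightarrow> nat \<Rightarrow> bit" where
  "digit n r \<equiv> of_nat (n div 2 ^ r mod 2)"

lemma sum_lessThan_add:
  fixes f :: "nat \<Rightarrow> 'a::comm_monoid_add"
  shows "sum f {..<k + N} = sum f {..<N} + (\<Sum>n<k. f (n + N))"
  by (induction k) (simp_all add: add.assoc)

text \<open>Orthogonality of characters. The upper half of the range differs from the lower one only
  in the top digit, so each digit contributes a factor 1 + \<open>bit_sign (w r)\<close>, which is 2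
  or 0.\<close>

lemma sum_bit_sign_linear:
  "(\<Sum>n<2 ^ m. bit_sign (\<Sum>r<m. w r * digit n r)) = (if \<forall>r<m. w r = 0 then 2 ^ m else 0)"
proof (induction m)
  case 0
  show ?case by (simp add: bit_sign_0)
next
  case (Suc m)
  let ?S = "\<lambda>n. bit_sign (\<Sum>r<m. w r * digit n r)"
  let ?T = "\<lambda>n. bit_sign (\<Sum>r<Suc m. w r * digit n r)"
  have low: "?T n = ?S n" if "n < 2 ^ m" for n using that by simp
  have high: "?T (n + 2 ^ m) = bit_sign (w m) * ?S n" if "n < 2 ^ m" for n
  proof -
    have "(n + 2 ^ m) div 2 ^ r mod 2 = n div 2 ^ r mod 2" if "r < m" for r
    proof -
      have m: "m = r + Suc (m - r - 1)" using that by simp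
      have "(2::nat) ^ m = 2 ^ r * (2 * 2 ^ (m - r - 1))" by (subst m) (simp only: power_add power_Suc)
      thus ?thesis by simp
    qed
    hence "(\<Sum>r<m. w r * digit (n + 2 ^ m) r) = (\<Sum>r<m. w r * digit n r)"
      by (intro sum.cong refl) simp
    moreover have "digit (n + 2 ^ m) m = 1" using that by simp
    ultimately have "(\<Sum>r<Suc m. w r * digit (n + 2 ^ m) r) = (\<Sum>r<m. w r * digit n r) + w m"
      by (simp only: sum.lessThan_Suc mult_1_right)
    thus ?thesis by (simp only: bit_sign_add mult.commute)
  qed
  have "(\<Sum>n<2 ^ Suc m. ?T n) = (\<Sum>n<2 ^ m. ?T n) + (\<Sum>n<2 ^ m. ?T (n + 2 ^ m))"
    unfolding power_Suc mult_2 by (rule sum_lessThan_add)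
  also have "(\<Sum>n<2 ^ m. ?T (n + 2 ^ m)) = bit_sign (w m) * (\<Sum>n<2 ^ m. ?S n)"
    unfolding sum_distrib_left by (intro sum.cong refl high) simp
  also have "(\<Sum>n<2 ^ m. ?T n) = (\<Sum>n<2 ^ m. ?S n)" by (intro sum.cong refl low) simp
  finally have eq: "(\<Sum>n<2 ^ Suc m. ?T n) = (1 + bit_sign (w m)) * (\<Sum>n<2 ^ m. ?S n)"
    by (simp add: algebra_simps)
  show ?case
    unfolding eq Suc.IH by (cases "w m") (auto simp: bit_sign_def less_Suc_eq)
qed

text \<open>
  The indicator of a solution is the product of the factors (1 + character) / 2. Expanding it leaves
  only the trivial character, as every other product of the characters is non-trivial.
\<close>

lemma card_linear_system_bit:
  fixes v :: "'j \<Rightarrow> nat \<Rightarrow> bit"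
  assumes J: "finite J"
    and indep: "\<And>S. S \<subseteq> J \<Longrightarrow> S \<noteq> {} \<Longrightarrow> \<exists>r<m. (\<Sum>j\<in>S. v j r) \<noteq> 0"
  shows "real (card {n\<in>{..<2 ^ m}. \<forall>j\<in>J. (\<Sum>r<m. v j r * digit n r) = \<tau> j}) = 2 ^ m / 2 ^ card J"
proof -
  let ?l = "\<lambda>j n. \<Sum>r<m. v j r * digit n r"
  have ind: "(1 + bit_sign (\<tau> j + ?l j n)) / 2 = of_bool (?l j n = \<tau> j)" for j n
    by (cases "\<tau> j"; cases "?l j n") (simp_all add: bit_sign_def bit_add_self)
  have "real (card {n\<in>{..<2 ^ m}. \<forall>j\<in>J. ?l j n = \<tau> j}) = (\<Sum>n<2 ^ m. of_bool (\<forall>j\<in>J. ?l j n = \<tau> j))"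
    by (simp add: of_bool_def sum.If_cases Int_def)
  also have "\<dots> = (\<Sum>n<2 ^ m. \<Prod>j\<in>J. (1 + bit_sign (\<tau> j + ?l j n)) / 2)"
  proof (intro sum.cong refl)
    fix n
    show "of_bool (\<forall>j\<in>J. ?l j n = \<tau> j) = (\<Prod>j\<in>J. (1 + bit_sign (\<tau> j + ?l j n)) / 2)"
      unfolding ind using J by (induction J rule: finite_induct) (simp_all add: of_bool_conj)
  qed
  also have "\<dots> = (\<Sum>n<2 ^ m. (\<Sum>S\<in>Pow J. bit_sign (\<Sum>j\<in>S. \<tau> j) * bit_sign (\<Sum>r<m. (\<Sum>j\<in>S. v j r) * digit n r))) / 2 ^ card J"
  proof (subst sum_divide_distrib, intro sum.cong refl)
    fix n
    have "(\<Prod>j\<in>J. (1 + bit_sign (\<tau> j + ?l j n)) / 2) = (\<Prod>j\<in>J. bit_sign (\<tau> j + ?l j n) + 1) / 2 ^ card J"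
      by (simp add: prod_dividef add.commute)
    also have "(\<Prod>j\<in>J. bit_sign (\<tau> j + ?l j n) + 1) = (\<Sum>S\<in>Pow J. \<Prod>j\<in>S. bit_sign (\<tau> j + ?l j n))"
      unfolding prod_add[OF J] by simp
    also have "\<dots> = (\<Sum>S\<in>Pow J. bit_sign (\<Sum>j\<in>S. \<tau> j) * bit_sign (\<Sum>r<m. (\<Sum>j\<in>S. v j r) * digit n r))"
    proof (intro sum.cong refl)
      fix S
      have "(\<Sum>j\<in>S. ?l j n) = (\<Sum>r<m. (\<Sum>j\<in>S. v j r) * digit n r)"
        by (subst sum.swap) (simp only: sum_distrib_right)
      thus "(\<Prod>j\<in>S. bit_sign (\<tau> j + ?l j n)) = bit_sign (\<Sum>j\<in>S. \<tau> j) * bit_sign (\<Sum>r<m. (\<Sum>j\<in>S. v j r) * digit n r)"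
        by (simp only: bit_sign_sum[symmetric] bit_sign_add[symmetric] sum.distrib)
    qed
    finally show "(\<Prod>j\<in>J. (1 + bit_sign (\<tau> j + ?l j n)) / 2)
        = (\<Sum>S\<in>Pow J. bit_sign (\<Sum>j\<in>S. \<tau> j) * bit_sign (\<Sum>r<m. (\<Sum>j\<in>S. v j r) * digit n r)) / 2 ^ card J" .
  qed
  also have "(\<Sum>n<2 ^ m. (\<Sum>S\<in>Pow J. bit_sign (\<Sum>j\<in>S. \<tau> j) * bit_sign (\<Sum>r<m. (\<Sum>j\<in>S. v j r) * digit n r)))
      = (\<Sum>S\<in>Pow J. bit_sign (\<Sum>j\<in>S. \<tau> j) * (\<Sum>n<2 ^ m. bit_sign (\<Sum>r<m. (\<Sum>j\<in>S. v j r) * digit n r)))"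
    by (subst sum.swap) (simp only: sum_distrib_left)
  also have "\<dots> = (\<Sum>S\<in>Pow J. if S = {} then 2 ^ m else 0)"
  proof (intro sum.cong refl)
    fix S assume "S \<in> Pow J"
    thus "bit_sign (\<Sum>j\<in>S. \<tau> j) * (\<Sum>n<2 ^ m. bit_sign (\<Sum>r<m. (\<Sum>j\<in>S. v j r) * digit n r)) = (if S = {} then 2 ^ m else 0)"
      unfolding sum_bit_sign_linear using indep[of S] by (cases "S = {}") (auto simp: bit_sign_0)
  qed
  also have "\<dots> = 2 ^ m" using J by (simp add: sum.delta)
  finally show ?thesis .
qed

text \<open>Serves to enlarge a dyadic box until its levels add up to a prescribed value; the levels
  are filled greedily.\<close>

lemma exists_smaller_with_sum:
  fixes d :: "'i \<Rightarrow> nat"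
  assumes "finite u" "x \<le> sum d u"
  shows "\<exists>d'. (\<forall>i\<in>u. d' i \<le> d i) \<and> sum d' u = x"
  using assms
proof (induction u arbitrary: x rule: finite_induct)
  case (insert i u)
  have "x - min x (d i) \<le> sum d u" using insert by (auto simp: min_def)
  then obtain d' where d': "\<forall>j\<in>u. d' j \<le> d j" "sum d' u = x - min x (d i)" using insert.IH by blast
  have "sum (d'(i := min x (d i))) u = sum d' u" using insert.hyps by (intro sum.cong) auto
  thus ?case using insert.hyps d' by (intro exI[of _ "d'(i := min x (d i))"]) auto
qed simp

section \<open>Equidistribution of the net in dyadic boxes\<close>

locale niederreiter =
  fixes P :: "nat \<Rightarrow> bit poly" and \<rho> :: "nat \<Rightarrow> nat \<Rightarrow> bit poly" and m :: nat
    and y :: "nat \<Rightarrow> nat \<Rightarrow> real"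
  assumes P: "irreducible_listing P" and \<rho>: "row_numerators P \<rho>"
    and y: "y = digital_net m (nied_matrix P \<rho> m)"
begin

definition e :: "nat \<Rightarrow> nat" where "e i = degree (P i)"

lemma e_pos: "i \<ge> 1 \<Longrightarrow> e i \<ge> 1"
proof -
  assume "i \<ge> 1"
  hence "P i \<in> {f. irreducible f}"
    using P bij_betwE[of P "{1..}"] by (auto simp: irreducible_listing_def)
  thus ?thesis using irreducible_degree_pos[of "P i"] by (simp add: e_def)
qed

definition out_bit :: "nat \<Rightarrow> nat \<Rightarrow> nat \<Rightarrow> bit" where
  "out_bit n i k = (\<Sum>r<m. nied_entry P \<rho> i (k + 1) (r + 1) * digit n r)"

definition numer :: "nat \<Rightarrow> nat \<Rightarrow> nat" where
  "numer n i = binary_value (\<lambda>k. out_bit n i k = 1) m"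

lemma net_point_eq: "y n i = real (numer n i) / 2 ^ m"
proof -
  have "vec_index (nied_matrix P \<rho> m i *\<^sub>v digit_vec m n) k = out_bit n i k" if "k < m" for k
    using that unfolding out_bit_def
    by (simp add: nied_matrix_def digit_vec_def scalar_prod_def lessThan_atLeast0)
  thus ?thesis unfolding y digital_net_def numer_def binary_value_eq_sum by (intro sum.cong refl) simp
qed

lemma numer_less: "numer n i < 2 ^ m"
  unfolding numer_def by (rule binary_value_less)

lemma net_point_range: "0 \<le> y n i" "y n i < 1"
  using numer_less[of n i] unfolding net_point_eq
  by (simp_all add: divide_less_eq)

lemma cell_net_point:
  assumes "d \<le> m"
  shows "cell d (y n i) = binary_value (\<lambda>k. out_bit n i k = 1) d"
  unfolding net_point_eq cell_dyadic[OF assms] numer_def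
  using binary_value_div[of _ d "m - d"] assms by simp

text \<open>To lie in the box means that the leading d i digits of every coordinate in u are
  prescribed. These are linear equations for the digits of n, as many as the d i add up to, and they
  are independent.\<close>

lemma card_net_box:
  assumes u: "finite u" "u \<subseteq> {1..}"
    and d: "(\<Sum>i\<in>u. d i + e i - 1) \<le> m"
    and c: "\<And>i. i \<in> u \<Longrightarrow> c i < 2 ^ d i"
  shows "real (card {n\<in>{..<2 ^ m}. \<forall>i\<in>u. cell (d i) (y n i) = c i}) = 2 ^ m / 2 ^ (\<Sum>i\<in>u. d i)"
proof -
  define J where "J = (SIGMA i:u. {..<d i})"
  define v where "v = (\<lambda>(i, k) r. nied_entry P \<rho> i (k + 1) (r + 1))"
  define \<tau> :: "nat \<times> nat \<Rightarrow> bit" where "\<tau> = (\<lambda>(i, k). of_bool (odd (c i div 2 ^ (d i - 1 - k))))"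
  \<comment> \<open>The digits in question exist only if d i \<le> m. This follows from the
    hypothesis on the sum because e i \<ge> 1.\<close>
  have dm: "d i \<le> m" if "i \<in> u" for i
  proof -
    have "d i \<le> d i + e i - 1" using e_pos[of i] that u by auto
    also have "\<dots> \<le> (\<Sum>i\<in>u. d i + e i - 1)" using that u by (intro member_le_sum) auto
    finally show ?thesis using d by simp
  qed
  have finJ: "finite J" unfolding J_def using u by auto
  have cardJ: "card J = (\<Sum>i\<in>u. d i)" unfolding J_def using u by (subst card_SigmaI) auto
  have key: "cell (d i) (y n i) = c i \<longleftrightarrow> (\<forall>k<d i. (\<Sum>r<m. v (i, k) r * digit n r) = \<tau> (i, k))" if "i \<in> u" for i n
  proof -
    have bQ: "(b = 1) = Q \<longleftrightarrow> b = of_bool Q" for b :: bit and Q by (cases b) auto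
    show ?thesis
      unfolding cell_net_point[OF dm[OF that]] binary_value_eq_iff[OF c[OF that]] bQ
      by (simp only: out_bit_def v_def \<tau>_def split_conv)
  qed
  have "(\<forall>i\<in>u. cell (d i) (y n i) = c i) \<longleftrightarrow> (\<forall>j\<in>J. (\<Sum>r<m. v j r * digit n r) = \<tau> j)" for n
  proof -
    have "(\<forall>j\<in>J. Q j) \<longleftrightarrow> (\<forall>i\<in>u. \<forall>k<d i. Q (i, k))" for Q by (auto simp: J_def)
    thus ?thesis using key by (simp cong: ball_cong)
  qed
  hence "{n\<in>{..<2 ^ m}. \<forall>i\<in>u. cell (d i) (y n i) = c i}
      = {n\<in>{..<2 ^ m}. \<forall>j\<in>J. (\<Sum>r<m. v j r * digit n r) = \<tau> j}"
    by (simp only:)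
  moreover have "real (card {n\<in>{..<2 ^ m}. \<forall>j\<in>J. (\<Sum>r<m. v j r * digit n r) = \<tau> j}) = 2 ^ m / 2 ^ card J"
  proof (rule card_linear_system_bit[OF finJ])
    fix S assume S: "S \<subseteq> J" "S \<noteq> {}"
    obtain r where r: "r \<in> {1..m}" "(\<Sum>(i, j)\<in>S. nied_entry P \<rho> i (j + 1) r) \<noteq> 0"
      using nied_rows_independent[OF P \<rho> u S[unfolded J_def] d[unfolded e_def]] by blast
    \<comment> \<open>The columns of \<open>v\<close> are numbered from 0, those of
      \<open>nied_entry\<close> from 1.\<close>
    hence "(\<Sum>j\<in>S. v j (r - 1)) \<noteq> 0" by (simp add: v_def case_prod_beta)
    thus "\<exists>r<m. (\<Sum>j\<in>S. v j r) \<noteq> 0" using r(1) by (intro exI[of _ "r - 1"]) auto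
  qed
  ultimately show ?thesis by (simp only: cardJ)
qed

text \<open>Enlarge the box until its levels add up to m - t, where t is the sum of the e i - 1; the
  exact count is then 2^t. If t is at least m, then 2^t already exceeds or equals the number of all
  points.\<close>

lemma card_net_box_le:
  assumes u: "finite u" "u \<subseteq> {1..}"
    and d: "m \<le> (\<Sum>i\<in>u. d i + e i - 1)"
    and c: "\<And>i. i \<in> u \<Longrightarrow> c i < 2 ^ d i"
  shows "real (card {n\<in>{..<2 ^ m}. \<forall>i\<in>u. cell (d i) (y n i) = c i}) \<le> 2 ^ (\<Sum>i\<in>u. e i - 1)"
proof -
  define t where "t = (\<Sum>i\<in>u. e i - 1)"
  \<comment> \<open>The subtraction is truncated, so this identity rests on e i \<ge> 1.\<close>
  have split: "(\<Sum>i\<in>u. d' i + e i - 1) = (\<Sum>i\<in>u. d' i) + t" for d'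
    unfolding t_def sum.distrib[symmetric] using e_pos u by (intro sum.cong refl) force
  show ?thesis
  proof (cases "m \<le> t")
    case True
    have "real (card {n\<in>{..<2 ^ m}. \<forall>i\<in>u. cell (d i) (y n i) = c i}) \<le> real (card {..<2 ^ m :: nat})"
      by (intro of_nat_mono card_mono) auto
    also have "\<dots> = 2 ^ m" by simp
    also have "\<dots> \<le> 2 ^ t" using True by (intro power_increasing) auto
    finally show ?thesis unfolding t_def .
  next
    case False
    have "m - t \<le> (\<Sum>i\<in>u. d i)" using d split[of d] by simp
    then obtain d' where d': "\<forall>i\<in>u. d' i \<le> d i" "(\<Sum>i\<in>u. d' i) = m - t"
      using exists_smaller_with_sum[OF u(1)] by metis
    define c' where "c' i = c i div 2 ^ (d i - d' i)" for i
    have c': "c' i < 2 ^ d' i" if "i \<in> u" for i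
    proof -
      have "c i < 2 ^ (d i - d' i) * 2 ^ d' i" using c[OF that] d'(1) that by (simp flip: power_add)
      thus ?thesis unfolding c'_def by (simp add: less_mult_imp_div_less mult.commute)
    qed
    have "{n\<in>{..<2 ^ m}. \<forall>i\<in>u. cell (d i) (y n i) = c i}
        \<subseteq> {n\<in>{..<2 ^ m}. \<forall>i\<in>u. cell (d' i) (y n i) = c' i}"
    proof safe
      fix n i assume i: "i \<in> u" and "\<forall>i\<in>u. cell (d i) (y n i) = c i"
      thus "cell (d' i) (y n i) = c' i"
        using cell_coarsen[of "d' i" "d i" "y n i"] d'(1) net_point_range by (simp add: c'_def)
    qed
    hence "real (card {n\<in>{..<2 ^ m}. \<forall>i\<in>u. cell (d i) (y n i) = c i})
        \<le> real (card {n\<in>{..<2 ^ m}. \<forall>i\<in>u. cell (d' i) (y n i) = c' i})"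
      by (intro of_nat_mono card_mono) auto
    also have "\<dots> = 2 ^ m / 2 ^ (\<Sum>i\<in>u. d' i)"
      using d' split[of d'] False by (intro card_net_box u c') auto
    also have "\<dots> = 2 ^ t" unfolding d'(2) using False by (simp add: power_diff)
    finally show ?thesis unfolding t_def .
  qed
qed

end

section \<open>Iterated differences and mixed partial derivatives\<close>

lemma coord_box_upd:
  "x \<in> coord_box a b s \<Longrightarrow> i \<in> {1..s} \<Longrightarrow> t \<in> {a i..b i} \<Longrightarrow> x(i := t) \<in> coord_box a b s"
  unfolding coord_box_def by (auto simp: PiE_iff extensional_def)

lemma coord_box_comp: "x \<in> coord_box a b s \<Longrightarrow> i \<in> {1..s} \<Longrightarrow> x i \<in> {a i..b i}"
  unfolding coord_box_def by (rule PiE_mem)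

definition diff_op ::
  "(nat \<Rightarrow> real) \<Rightarrow> (nat \<Rightarrow> real) \<Rightarrow> nat \<Rightarrow> ((nat \<Rightarrow> real) \<Rightarrow> real) \<Rightarrow> (nat \<Rightarrow> real) \<Rightarrow> real" where
  "diff_op \<alpha> \<beta> i F x = F (x(i := \<beta> i)) - F (x(i := \<alpha> i))"

lemma foldr_Nil_apply: "foldr f [] z = z"
  by simp

lemma foldr_Cons_apply: "foldr f (x # xs) z = f x (foldr f xs z)"
  by simp

text \<open>Differences in distinct coordinates commute. The innermost one can thus be taken last,
  as a difference of a function of the single variable k.\<close>

lemma foldr_diff_op_snoc:
  "k \<notin> set us \<Longrightarrow> foldr (diff_op \<alpha> \<beta>) us (diff_op \<alpha> \<beta> k F) x
     = foldr (diff_op \<alpha> \<beta>) us F (x(k := \<beta> k)) - foldr (diff_op \<alpha> \<beta>) us F (x(k := \<alpha> k))"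
proof (induction us arbitrary: x)
  case (Cons j us)
  have upd: "x(j := p, k := q) = x(k := q, j := p)" for p q
    using Cons.prems by (intro fun_upd_twist) auto
  have nk: "k \<notin> set us" using Cons.prems by simp
  show ?case
    unfolding foldr_Cons_apply diff_op_def[of \<alpha> \<beta> j] Cons.IH[OF nk] upd by linarith
qed (simp only: foldr_Nil_apply diff_op_def[of \<alpha> \<beta> k])

text \<open>Differences in other coordinates are combinations of copies of F with shifted arguments,
  so they commute with differentiation in direction k.\<close>

lemma foldr_diff_op_has_vector_derivative:
  assumes k: "k \<in> {1..s}" and us: "set us \<subseteq> {1..s} - {k}"
    and F: "\<And>x. x \<in> coord_box a b s \<Longrightarrow>
      ((\<lambda>t. F (x(k := t))) has_vector_derivative F' x) (at (x k) within {a k..b k})"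
    and rng: "\<And>i. i \<in> set us \<Longrightarrow> \<alpha> i \<in> {a i..b i} \<and> \<beta> i \<in> {a i..b i}"
    and x: "x \<in> coord_box a b s"
  shows "((\<lambda>t. foldr (diff_op \<alpha> \<beta>) us F (x(k := t))) has_vector_derivative
      foldr (diff_op \<alpha> \<beta>) us F' x) (at (x k) within {a k..b k})"
  using us rng x
proof (induction us arbitrary: x)
  case Nil
  thus ?case using F by (simp only: foldr_Nil_apply)
next
  case (Cons j us)
  have jk: "j \<noteq> k" "j \<in> {1..s}" using Cons.prems by auto
  have upd: "x(j := p, k := q) = x(k := q, j := p)" for p q
    using jk by (intro fun_upd_twist) auto
  have "((\<lambda>t. foldr (diff_op \<alpha> \<beta>) us F ((x(j := p))(k := t))) has_vector_derivative
      foldr (diff_op \<alpha> \<beta>) us F' (x(j := p))) (at (x k) within {a k..b k})"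
    if "p \<in> {a j..b j}" for p
  proof -
    have "x(j := p) \<in> coord_box a b s" using Cons.prems(3) jk(2) that by (rule coord_box_upd)
    moreover have "set us \<subseteq> {1..s} - {k}" using Cons.prems(1) by simp
    moreover have "\<alpha> i \<in> {a i..b i} \<and> \<beta> i \<in> {a i..b i}" if "i \<in> set us" for i
      using Cons.prems(2)[of i] that by simp
    ultimately have "((\<lambda>t. foldr (diff_op \<alpha> \<beta>) us F ((x(j := p))(k := t))) has_vector_derivative
      foldr (diff_op \<alpha> \<beta>) us F' (x(j := p))) (at ((x(j := p)) k) within {a k..b k})"
      by (intro Cons.IH)
    thus ?thesis unfolding fun_upd_other[OF jk(1)[symmetric]] .
  qed
  moreover have "\<alpha> j \<in> {a j..b j}" "\<beta> j \<in> {a j..b j}" using Cons.prems(2)[of j] by auto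
  ultimately show ?case
    unfolding foldr_Cons_apply diff_op_def[of \<alpha> \<beta> j] upd
    by (intro has_vector_derivative_diff)
qed

text \<open>
  The mean value theorem is applied in the last coordinate of the list first, so that only the
  mixed derivatives in the order of the list occur.
\<close>

lemma foldr_diff_op_bound:
  assumes "distinct us" "set us \<subseteq> {1..s}"
    and rng: "\<And>i. i \<in> set us \<Longrightarrow> \<alpha> i \<in> {a i..b i} \<and> \<beta> i \<in> {a i..b i}"
    and "\<And>ps k qs x. us = ps @ k # qs \<Longrightarrow> x \<in> coord_box a b s \<Longrightarrow>
      (\<lambda>t. foldr (partial_deriv a b) qs F (x(k := t))) differentiable (at (x k) within {a k..b k})"
    and "\<And>x. x \<in> coord_box a b s \<Longrightarrow> \<bar>foldr (partial_deriv a b) us F x\<bar> \<le> B"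
    and "x \<in> coord_box a b s"
  shows "\<bar>foldr (diff_op \<alpha> \<beta>) us F x\<bar> \<le> B * (\<Prod>i\<in>set us. \<bar>\<beta> i - \<alpha> i\<bar>)"
  using assms
proof (induction us arbitrary: F x rule: rev_induct)
  case Nil
  thus ?case by simp
next
  case (snoc k us)
  have k: "k \<in> {1..s}" "k \<notin> set us" and us: "distinct us" "set us \<subseteq> {1..s} - {k}" "set us \<subseteq> {1..s}"
    using snoc.prems(1,2) by auto
  have rk: "\<alpha> k \<in> {a k..b k}" "\<beta> k \<in> {a k..b k}" using snoc.prems(3)[of k] by auto
  have rus: "\<alpha> i \<in> {a i..b i} \<and> \<beta> i \<in> {a i..b i}" if "i \<in> set us" for i
    using snoc.prems(3)[of i] that by auto
  let ?F' = "partial_deriv a b k F"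
  let ?C = "B * (\<Prod>i\<in>set us. \<bar>\<beta> i - \<alpha> i\<bar>)"
  define G where "G t = foldr (diff_op \<alpha> \<beta>) us F (x(k := t))" for t
  have der: "((\<lambda>t. F (z(k := t))) has_vector_derivative ?F' z) (at (z k) within {a k..b k})"
    if "z \<in> coord_box a b s" for z
  proof -
    have "(\<lambda>t. F (z(k := t))) differentiable (at (z k) within {a k..b k})"
      using snoc.prems(4)[of us k "[]" z, OF _ that] unfolding foldr_Nil_apply by blast
    thus ?thesis unfolding partial_deriv_def vector_derivative_works .
  qed
  have IH: "\<bar>foldr (diff_op \<alpha> \<beta>) us ?F' z\<bar> \<le> ?C" if "z \<in> coord_box a b s" for z
  proof (rule snoc.IH[OF us(1,3) rus _ _ that])
    fix ps j qs z assume "us = ps @ j # qs" "z \<in> coord_box a b s"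
    thus "(\<lambda>t. foldr (partial_deriv a b) qs ?F' (z(j := t))) differentiable (at (z j) within {a j..b j})"
      using snoc.prems(4)[of ps j "qs @ [k]" z]
      by (simp only: append_assoc append_Cons foldr_append foldr_Cons_apply foldr_Nil_apply)
  next
    fix z assume "z \<in> coord_box a b s"
    thus "\<bar>foldr (partial_deriv a b) us ?F' z\<bar> \<le> B" using snoc.prems(5)[of z]
      by (simp only: foldr_append foldr_Cons_apply foldr_Nil_apply)
  qed
  have "norm (G (\<beta> k) - G (\<alpha> k)) \<le> ?C * norm (\<beta> k - \<alpha> k)"
  proof (rule field_differentiable_bound[where S = "{a k..b k}" and f' = "\<lambda>t. foldr (diff_op \<alpha> \<beta>) us ?F' (x(k := t))"])
    fix t assume t: "t \<in> {a k..b k}"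
    have xt: "x(k := t) \<in> coord_box a b s" using snoc.prems(6) k(1) t by (rule coord_box_upd)
    have "((\<lambda>t'. foldr (diff_op \<alpha> \<beta>) us F ((x(k := t))(k := t'))) has_vector_derivative
      foldr (diff_op \<alpha> \<beta>) us ?F' (x(k := t))) (at ((x(k := t)) k) within {a k..b k})"
      by (rule foldr_diff_op_has_vector_derivative[OF k(1) us(2) der rus xt])
    thus "(G has_field_derivative foldr (diff_op \<alpha> \<beta>) us ?F' (x(k := t))) (at t within {a k..b k})"
      by (simp add: has_real_derivative_iff_has_vector_derivative G_def[abs_def])
    show "norm (foldr (diff_op \<alpha> \<beta>) us ?F' (x(k := t))) \<le> ?C" using IH[OF xt] by simp
  qed (use rk in auto)
  moreover have "foldr (diff_op \<alpha> \<beta>) (us @ [k]) F x = G (\<beta> k) - G (\<alpha> k)"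
    unfolding foldr_append foldr_Cons_apply foldr_Nil_apply G_def by (rule foldr_diff_op_snoc[OF k(2)])
  moreover have "(\<Prod>i\<in>set (us @ [k]). \<bar>\<beta> i - \<alpha> i\<bar>) = (\<Prod>i\<in>set us. \<bar>\<beta> i - \<alpha> i\<bar>) * \<bar>\<beta> k - \<alpha> k\<bar>"
    using k(2) by (simp add: mult.commute)
  ultimately show ?case by (simp only: real_norm_def mult.assoc)
qed

section \<open>Telescoping over levels, one coordinate at a time\<close>

definition level_op ::
  "(nat \<Rightarrow> nat \<Rightarrow> real) \<Rightarrow> (nat \<Rightarrow> nat) \<Rightarrow> nat \<Rightarrow> ((nat \<Rightarrow> real) \<Rightarrow> real) \<Rightarrow> (nat \<Rightarrow> real) \<Rightarrow> real" where
  "level_op X k i F x = F (x(i := X i (k i))) - (if k i = 0 then 0 else F (x(i := X i (k i - 1))))"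

text \<open>In each coordinate the levels telescope to the value at the finest node: level 0
  contributes the value itself and every other level a correction to the preceding one.\<close>

lemma sum_level_op:
  assumes "distinct xs"
  shows "(\<Sum>k\<in>(\<Pi>\<^sub>E i\<in>set xs. {..M}). foldr (level_op X k) xs F z) = F (override_on z (\<lambda>i. X i M) (set xs))"
  using assms
proof (induction xs arbitrary: z)
  case Nil
  show ?case by simp
next
  case (Cons x xs)
  let ?H = "\<lambda>k. foldr (level_op X k) xs F"
  \<comment> \<open>The operators for \<open>xs\<close> read k only at the elements of
    \<open>xs\<close>, so the sum over the level of x can be separated.\<close>
  have fresh: "?H (k(x := j)) = ?H k" for k j
    using Cons.prems by (intro foldr_cong) (auto simp: level_op_def fun_eq_iff)
  have tele0: "(\<Sum>j\<le>M. h j - (if j = 0 then 0 else h (j - 1))) = h M" for h :: "nat \<Rightarrow> real"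
    by (induction M) auto
  have tele: "(\<Sum>j\<le>M. H (z(x := X x j)) - (if j = 0 then 0 else H (z(x := X x (j - 1))))) = H (z(x := X x M))"
    for H :: "(nat \<Rightarrow> real) \<Rightarrow> real"
    by (rule tele0)
  have "(\<Sum>k\<in>(\<Pi>\<^sub>E i\<in>set (x # xs). {..M}). foldr (level_op X k) (x # xs) F z)
      = (\<Sum>(j, k)\<in>{..M} \<times> (\<Pi>\<^sub>E i\<in>set xs. {..M}). ?H k (z(x := X x j)) - (if j = 0 then 0 else ?H k (z(x := X x (j - 1)))))"
  proof (rule sum.reindex_bij_witness[of _ "\<lambda>(j, k). k(x := j)" "\<lambda>k. (k x, k(x := undefined))"])
    fix k
    show "(case (k x, k(x := undefined)) of (j, k) \<Rightarrow> ?H k (z(x := X x j)) - (if j = 0 then 0 else ?H k (z(x := X x (j - 1)))))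
        = foldr (level_op X k) (x # xs) F z"
      unfolding foldr_Cons_apply level_op_def[of X k x] fresh split_conv by (rule refl)
  qed (use Cons.prems in \<open>auto simp: PiE_iff extensional_def\<close>)
  also have "\<dots> = (\<Sum>k\<in>(\<Pi>\<^sub>E i\<in>set xs. {..M}). ?H k (z(x := X x M)))"
    by (subst sum.cartesian_product[symmetric], subst sum.swap) (simp only: tele)
  also have "\<dots> = F (override_on (z(x := X x M)) (\<lambda>i. X i M) (set xs))"
    using Cons.prems by (intro Cons.IH) simp
  also have "override_on (z(x := X x M)) (\<lambda>i. X i M) (set xs) = override_on z (\<lambda>i. X i M) (set (x # xs))"
    by (auto simp: override_on_def fun_eq_iff)
  finally show ?case .
qed

text \<open>At level 0 the operator merely substitutes a coordinate, which is absorbed into the base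
  point. The positive levels remain as genuine differences.\<close>

lemma foldr_level_op_eq_diff_op:
  assumes "distinct xs"
  shows "foldr (level_op X k) xs F z
    = foldr (diff_op (\<lambda>i. X i (k i - 1)) (\<lambda>i. X i (k i))) (filter (\<lambda>i. k i \<noteq> 0) xs) F
        (override_on z (\<lambda>i. X i 0) {i \<in> set xs. k i = 0})"
  using assms
proof (induction xs arbitrary: z)
  case (Cons x xs)
  let ?A = "{i \<in> set xs. k i = 0}"
  let ?D = "foldr (diff_op (\<lambda>i. X i (k i - 1)) (\<lambda>i. X i (k i))) (filter (\<lambda>i. k i \<noteq> 0) xs) F"
  have IH: "foldr (level_op X k) xs F z = ?D (override_on z (\<lambda>i. X i 0) ?A)" for z
    using Cons by simp
  show ?case
  proof (cases "k x = 0")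
    case True
    have "override_on (z(x := X x 0)) (\<lambda>i. X i 0) ?A = override_on z (\<lambda>i. X i 0) {i \<in> set (x # xs). k i = 0}"
      using True by (auto simp: override_on_def fun_eq_iff)
    thus ?thesis using True unfolding foldr_Cons_apply level_op_def[of X k x] IH
      by (simp only: if_True if_False filter.simps diff_zero simp_thms)
  next
    case False
    have "override_on (z(x := t)) (\<lambda>i. X i 0) ?A = (override_on z (\<lambda>i. X i 0) {i \<in> set (x # xs). k i = 0})(x := t)" for t
      using False Cons.prems by (auto simp: override_on_def fun_eq_iff)
    thus ?thesis using False unfolding foldr_Cons_apply level_op_def[of X k x] IH
      by (simp only: if_True if_False filter.simps foldr_Cons_apply diff_op_def[of _ _ x] not_False_eq_True)
  qed
qed (simp add: override_on_def)

text \<open>A suffix of an increasing list is the sorted list of its own set, and the element before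
  it is the minimum of the enlarged set. So the hypothesis for sets provides every derivative that
  occurs when the list is differentiated from its end.\<close>

lemma has_mixed_partials_suffix:
  assumes F: "has_mixed_partials a b s F" and us: "set us \<subseteq> {1..s}" "sorted us" "distinct us"
    and eq: "us = ps @ k # qs" and x: "x \<in> coord_box a b s"
  shows "(\<lambda>t. foldr (partial_deriv a b) qs F (x(k := t))) differentiable (at (x k) within {a k..b k})"
proof -
  let ?v = "insert k (set qs)"
  have qs: "sorted qs" "distinct qs" "k \<notin> set qs" "\<forall>j\<in>set qs. k \<le> j"
    using us eq by (auto simp: sorted_append)
  have "Min ?v = k" using qs by (intro Min_eqI) auto
  moreover have "sorted_list_of_set (set qs) = qs"
    using qs by (simp add: sorted_list_of_set.idem_if_sorted_distinct)
  moreover have "?v - {k} = set qs" using qs by auto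
  moreover have "?v \<subseteq> {1..s} \<and> ?v \<noteq> {}" using us eq by auto
  ultimately show ?thesis
    using F x unfolding has_mixed_partials_def mixed_partial_def by metis
qed

text \<open>The coordinates of positive level, filtered from an increasing list, stay increasing.
  Their list is therefore the one by which \<open>mixed_partial\<close> is defined for u.\<close>

lemma foldr_level_op_bound:
  assumes F: "has_mixed_partials a b s F" and u: "u = {i\<in>{1..s}. k i \<noteq> 0}"
    and B: "\<And>x. x \<in> coord_box a b s \<Longrightarrow> \<bar>mixed_partial a b u F x\<bar> \<le> B"
    and X: "\<And>i j. i \<in> {1..s} \<Longrightarrow> X i j \<in> {a i..b i}" and z: "z \<in> coord_box a b s"
  shows "\<bar>foldr (level_op X k) [1..<Suc s] F z\<bar> \<le> B * (\<Prod>i\<in>u. \<bar>X i (k i) - X i (k i - 1)\<bar>)"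
proof -
  let ?us = "filter (\<lambda>i. k i \<noteq> 0) [1..<Suc s]"
  have us: "set ?us = u" "sorted ?us" "distinct ?us" "set ?us \<subseteq> {1..s}"
    unfolding u by (auto simp: sorted_wrt_filter simp del: upt_Suc)
  have "sorted_list_of_set u = ?us"
    using us by (metis sorted_list_of_set.idem_if_sorted_distinct)
  hence mp: "mixed_partial a b u F = foldr (partial_deriv a b) ?us F"
    by (simp only: mixed_partial_def)
  let ?z = "override_on z (\<lambda>i. X i 0) {i \<in> set [1..<Suc s]. k i = 0}"
  have z': "?z \<in> coord_box a b s"
    using z X unfolding coord_box_def by (auto simp: PiE_iff extensional_def override_on_def)
  have "\<bar>foldr (diff_op (\<lambda>i. X i (k i - 1)) (\<lambda>i. X i (k i))) ?us F ?z\<bar>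
      \<le> B * (\<Prod>i\<in>set ?us. \<bar>X i (k i) - X i (k i - 1)\<bar>)"
  proof (rule foldr_diff_op_bound[OF us(3,4) _ _ _ z'])
    fix i assume "i \<in> set ?us"
    thus "X i (k i - 1) \<in> {a i..b i} \<and> X i (k i) \<in> {a i..b i}" using X us(4) by blast
  next
    fix ps k' qs x assume "?us = ps @ k' # qs" "x \<in> coord_box a b s"
    thus "(\<lambda>t. foldr (partial_deriv a b) qs F (x(k' := t))) differentiable (at (x k') within {a k'..b k'})"
      by (rule has_mixed_partials_suffix[OF F us(4,2,3)])
  next
    fix x assume "x \<in> coord_box a b s"
    thus "\<bar>foldr (partial_deriv a b) ?us F x\<bar> \<le> B" using B mp by metis
  qed
  thus ?thesis
    by (simp only: us(1) foldr_level_op_eq_diff_op[OF distinct_upt])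
qed

text \<open>Change one coordinate at a time and apply the one-element case of the difference bound.
  The result is needed for the passage from grid averages to the integral.\<close>

lemma mixed_partials_lipschitz:
  assumes F: "has_mixed_partials a b s F"
    and L: "\<And>i x. i \<in> {1..s} \<Longrightarrow> x \<in> coord_box a b s \<Longrightarrow> \<bar>mixed_partial a b {i} F x\<bar> \<le> L i"
    and x: "x \<in> coord_box a b s" "x' \<in> coord_box a b s"
  shows "\<bar>F x - F x'\<bar> \<le> (\<Sum>i\<in>{1..s}. L i * \<bar>x i - x' i\<bar>)"
proof -
  have one: "\<bar>F (z(i := t)) - F (z(i := t'))\<bar> \<le> L i * \<bar>t - t'\<bar>"
    if "i \<in> {1..s}" "z \<in> coord_box a b s" "t \<in> {a i..b i}" "t' \<in> {a i..b i}" for i z t t'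
  proof -
    have i: "set [i] \<subseteq> {1..s}" "sorted [i]" "distinct [i]" using that(1) by auto
    have "\<bar>foldr (diff_op (\<lambda>_. t') (\<lambda>_. t)) [i] F z\<bar> \<le> L i * (\<Prod>j\<in>set [i]. \<bar>t - t'\<bar>)"
    proof (rule foldr_diff_op_bound[OF _ _ _ _ _ that(2)])
      fix ps k qs x assume "[i] = ps @ k # qs" "x \<in> coord_box a b s"
      thus "(\<lambda>t. foldr (partial_deriv a b) qs F (x(k := t))) differentiable (at (x k) within {a k..b k})"
        by (rule has_mixed_partials_suffix[OF F i])
    next
      fix x assume "x \<in> coord_box a b s"
      thus "\<bar>foldr (partial_deriv a b) [i] F x\<bar> \<le> L i" using L[OF that(1)] by (simp add: mixed_partial_def)
    qed (use that in auto)
    thus ?thesis by (simp add: diff_op_def)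
  qed
  have "\<bar>F (override_on x' x A) - F x'\<bar> \<le> (\<Sum>i\<in>A. L i * \<bar>x i - x' i\<bar>)" if "finite A" "A \<subseteq> {1..s}" for A
    using that
  proof (induction A rule: finite_induct)
    case (insert j A)
    let ?z = "override_on x' x A"
    have z: "?z \<in> coord_box a b s"
      using x unfolding coord_box_def by (auto simp: PiE_iff extensional_def override_on_def)
    have j: "j \<in> {1..s}" using insert.prems by auto
    have "?z(j := x' j) = ?z" using insert.hyps by (intro fun_upd_idem) simp
    hence "\<bar>F (override_on x' x (insert j A)) - F ?z\<bar> \<le> L j * \<bar>x j - x' j\<bar>"
      using one[OF j z coord_box_comp[OF x(1) j] coord_box_comp[OF x(2) j]]
      unfolding override_on_insert by (simp only:)
    moreover have "\<bar>F ?z - F x'\<bar> \<le> (\<Sum>i\<in>A. L i * \<bar>x i - x' i\<bar>)" using insert by simp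
    ultimately show ?case using insert.hyps by simp
  qed (simp add: override_on_def)
  from this[of "{1..s}"] have "\<bar>F (override_on x' x {1..s}) - F x'\<bar> \<le> (\<Sum>i\<in>{1..s}. L i * \<bar>x i - x' i\<bar>)" by simp
  moreover have "override_on x' x {1..s} = x"
    using x unfolding coord_box_def by (auto simp: override_on_def fun_eq_iff PiE_iff extensional_def)
  ultimately show ?thesis by simp
qed

section \<open>Quadrature error against a fine lattice\<close>

text \<open>
  The points of the net have denominator 2^m, so their details of level beyond m vanish. What remains
  there is the volume part, and all these levels together count like one further level.
\<close>

definition level_weight :: "nat \<Rightarrow> nat \<Rightarrow> real" where
  "level_weight m j = (if j \<le> m then 1 else 2 ^ m / 2 ^ j)"

lemma level_weight_pos: "level_weight m j > 0"
  by (simp add: level_weight_def)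

lemma inverse_power_le_level_weight: "1 / 2 ^ j \<le> level_weight m j"
  by (simp add: level_weight_def divide_le_eq one_le_power frac_le)

lemma sum_level_weight: "(\<Sum>j\<in>{1..M}. level_weight m j) \<le> real m + 1"
proof (cases "M \<le> m")
  case True
  have "(\<Sum>j\<in>{1..M}. level_weight m j) = (\<Sum>j\<in>{1..M}. 1)"
    using True by (intro sum.cong) (auto simp: level_weight_def)
  thus ?thesis using True by simp
next
  case False
  hence "m \<le> M" by simp
  \<comment> \<open>Strengthened by the remaining tail of the geometric series, so that the
    induction goes through.\<close>
  hence "(\<Sum>j\<in>{1..M}. level_weight m j) \<le> real m + 1 - 2 ^ m / 2 ^ M"
  proof (induction M rule: dec_induct)
    case base
    have "(\<Sum>j\<in>{1..m}. level_weight m j) = (\<Sum>j\<in>{1..m}. 1)"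
      by (intro sum.cong) (auto simp: level_weight_def)
    thus ?case by simp
  next
    case (step M)
    have "level_weight m (Suc M) = 2 ^ m / 2 ^ M - 2 ^ m / 2 ^ Suc M"
      using step.hyps by (simp add: level_weight_def)
    with step.IH show ?case by simp
  qed
  moreover have "(0::real) \<le> 2 ^ m / 2 ^ M" by simp
  ultimately show ?thesis by linarith
qed

text \<open>Rounding down to level k - 1 leaves an even c in place and moves an odd c by one step.
  The increments are thus dominated by those of consecutive grid points, which telescope by
  monotonicity. The bound is the same at every level.\<close>

lemma sum_dyadic_increments:
  fixes g :: "real \<Rightarrow> real"
  assumes mono: "\<And>x y. 0 \<le> x \<Longrightarrow> x \<le> y \<Longrightarrow> y \<le> 1 \<Longrightarrow> g x \<le> g y"
    and k: "k \<ge> 1"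
  shows "(\<Sum>c<2 ^ k. \<bar>g (real c / 2 ^ k) - g (real (c div 2) / 2 ^ (k - 1))\<bar>) \<le> g 1 - g 0"
proof -
  define h where "h c = g (real c / 2 ^ k)" for c :: nat
  have hm: "h c \<le> h c'" if "c \<le> c'" "c' \<le> 2 ^ k" for c c' :: nat
  proof -
    have "real c' \<le> 2 ^ k" using that(2) by (metis of_nat_le_iff of_nat_numeral of_nat_power)
    thus ?thesis using that(1) unfolding h_def by (intro mono) (auto intro: divide_right_mono)
  qed
  have teq: "\<bar>g (real c / 2 ^ k) - g (real (c div 2) / 2 ^ (k - 1))\<bar> \<le> h c - h (c - 1)" if "c < 2 ^ k" for c
  proof -
    have "(2::real) ^ k = 2 * 2 ^ (k - 1)" using k by (simp flip: power_Suc)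
    hence "real (c div 2) / 2 ^ (k - 1) = real (2 * (c div 2)) / 2 ^ k" by simp
    hence eq: "g (real (c div 2) / 2 ^ (k - 1)) = h (2 * (c div 2))" by (simp only: h_def)
    have "c - 1 \<le> 2 * (c div 2)" "2 * (c div 2) \<le> c" by presburger+
    hence "h (c - 1) \<le> h (2 * (c div 2))" "h (2 * (c div 2)) \<le> h c"
      using that by (auto intro!: hm)
    thus ?thesis unfolding eq h_def[symmetric] by linarith
  qed
  have tele: "(\<Sum>c<n. h c - h (c - 1)) = h (n - 1) - h 0" for n
  proof (induction n)
    case (Suc n)
    thus ?case by (cases n) auto
  qed simp
  have "(\<Sum>c<2 ^ k. \<bar>g (real c / 2 ^ k) - g (real (c div 2) / 2 ^ (k - 1))\<bar>) \<le> (\<Sum>c<2 ^ k. h c - h (c - 1))"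
    by (intro sum_mono teq) simp
  also have "\<dots> = h (2 ^ k - 1) - h 0" by (rule tele)
  also have "\<dots> \<le> h (2 ^ k) - h 0" using hm[of "2 ^ k - 1" "2 ^ k"] by simp
  also have "\<dots> = g 1 - g 0" by (simp add: h_def)
  finally show ?thesis .
qed

text \<open>Grouping by cells turns a sum over points into a sum over boxes weighted with point
  counts. It is used both for the net and for the grid.\<close>

lemma sum_by_cells:
  fixes H :: "(nat \<Rightarrow> nat) \<Rightarrow> real"
  assumes \<Omega>: "finite \<Omega>" and S: "finite S"
    and \<tau>: "\<And>\<omega> i. \<omega> \<in> \<Omega> \<Longrightarrow> i \<in> S \<Longrightarrow> 0 \<le> \<tau> \<omega> i \<and> \<tau> \<omega> i < 1"
  shows "(\<Sum>\<omega>\<in>\<Omega>. H (\<lambda>i\<in>S. cell (k i) (\<tau> \<omega> i)))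
    = (\<Sum>c\<in>(\<Pi>\<^sub>E i\<in>S. {..<2 ^ k i}). H c * real (card {\<omega>\<in>\<Omega>. \<forall>i\<in>S. cell (k i) (\<tau> \<omega> i) = c i}))"
proof -
  let ?C = "\<Pi>\<^sub>E i\<in>S. {..<2 ^ k i :: nat}" and ?v = "\<lambda>\<omega>. \<lambda>i\<in>S. cell (k i) (\<tau> \<omega> i)"
  have fin: "finite ?C" using S by (intro finite_PiE) auto
  have sub: "?v ` \<Omega> \<subseteq> ?C"
  proof (rule image_subsetI)
    fix \<omega> assume "\<omega> \<in> \<Omega>"
    thus "?v \<omega> \<in> ?C" using cell_less \<tau> by (intro restrict_PiE_iff[THEN iffD2]) auto
  qed
  have "(\<Sum>\<omega>\<in>\<Omega>. H (?v \<omega>)) = (\<Sum>c\<in>?C. \<Sum>\<omega>\<in>{\<omega>\<in>\<Omega>. ?v \<omega> = c}. H (?v \<omega>))"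
    by (rule sum.group[OF \<Omega> fin sub, symmetric])
  also have "\<dots> = (\<Sum>c\<in>?C. H c * real (card {\<omega>\<in>\<Omega>. \<forall>i\<in>S. cell (k i) (\<tau> \<omega> i) = c i}))"
  proof (rule sum.cong[OF refl])
    fix c assume c: "c \<in> ?C"
    have "?v \<omega> = c \<longleftrightarrow> (\<forall>i\<in>S. cell (k i) (\<tau> \<omega> i) = c i)" for \<omega>
    proof
      assume "\<forall>i\<in>S. cell (k i) (\<tau> \<omega> i) = c i"
      hence "?v \<omega> = restrict c S" by (intro restrict_ext) auto
      thus "?v \<omega> = c" using c by (simp only: PiE_restrict)
    qed auto
    hence "{\<omega>\<in>\<Omega>. \<forall>i\<in>S. cell (k i) (\<tau> \<omega> i) = c i} = {\<omega>\<in>\<Omega>. ?v \<omega> = c}" by simp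
    moreover have "(\<Sum>\<omega>\<in>{\<omega>\<in>\<Omega>. ?v \<omega> = c}. H (?v \<omega>)) = (\<Sum>\<omega>\<in>{\<omega>\<in>\<Omega>. ?v \<omega> = c}. H c)"
      by (intro sum.cong refl) auto
    ultimately show "(\<Sum>\<omega>\<in>{\<omega>\<in>\<Omega>. ?v \<omega> = c}. H (?v \<omega>))
        = H c * real (card {\<omega>\<in>\<Omega>. \<forall>i\<in>S. cell (k i) (\<tau> \<omega> i) = c i})"
      by (simp only: sum_constant mult.commute)
  qed
  finally show ?thesis .
qed

text \<open>A grid of level M meets each box of levels up to M in exact proportion to its volume, so
  grid averages of details equal their volume averages.\<close>

lemma card_lattice_box:
  assumes S: "finite S" and k: "\<And>i. i \<in> S \<Longrightarrow> k i \<le> M" and c: "\<And>i. i \<in> S \<Longrightarrow> c i < 2 ^ k i"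
  shows "real (card {\<omega>\<in>(\<Pi>\<^sub>E i\<in>S. {..<2 ^ M}). \<forall>i\<in>S. cell (k i) (real (\<omega> i) / 2 ^ M) = c i})
    = (2 ^ M) ^ card S * (\<Prod>i\<in>S. 1 / 2 ^ k i)"
proof -
  have one: "{n. n < 2 ^ M \<and> n div 2 ^ (M - k i) = c i} = {c i * 2 ^ (M - k i)..<(c i + 1) * 2 ^ (M - k i)}"
    if "i \<in> S" for i
  proof -
    have M: "(2::nat) ^ M = 2 ^ k i * 2 ^ (M - k i)" using k[OF that] by (simp flip: power_add)
    have le: "(c i + 1) * 2 ^ (M - k i) \<le> 2 ^ k i * 2 ^ (M - k i)"
      using c[OF that] by (intro mult_le_mono1) simp
    have iff: "n div 2 ^ (M - k i) = c i \<longleftrightarrow> c i * 2 ^ (M - k i) \<le> n \<and> n < (c i + 1) * 2 ^ (M - k i)" for n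
    proof -
      have d: "(2::nat) ^ (M - k i) > 0" by simp
      have "n div 2 ^ (M - k i) = c i \<longleftrightarrow> c i \<le> n div 2 ^ (M - k i) \<and> n div 2 ^ (M - k i) < c i + 1" by auto
      thus ?thesis by (simp only: less_eq_div_iff_mult_less_eq[OF d] div_less_iff_less_mult[OF d])
    qed
    show ?thesis
      unfolding iff M
    proof (rule Set.set_eqI)
      fix n
      show "n \<in> {n. n < 2 ^ k i * 2 ^ (M - k i) \<and> c i * 2 ^ (M - k i) \<le> n \<and> n < (c i + 1) * 2 ^ (M - k i)}
          \<longleftrightarrow> n \<in> {c i * 2 ^ (M - k i)..<(c i + 1) * 2 ^ (M - k i)}"
        unfolding mem_Collect_eq atLeastLessThan_iff using less_le_trans[OF _ le, of n] by blast
    qed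
  qed
  have "{\<omega>\<in>(\<Pi>\<^sub>E i\<in>S. {..<2 ^ M}). \<forall>i\<in>S. cell (k i) (real (\<omega> i) / 2 ^ M) = c i}
      = (\<Pi>\<^sub>E i\<in>S. {n. n < 2 ^ M \<and> n div 2 ^ (M - k i) = c i})"
  proof -
    have "cell (k i) (real (\<omega> i) / 2 ^ M) = \<omega> i div 2 ^ (M - k i)" if "i \<in> S" for \<omega> i
      using k[OF that] by (rule cell_dyadic)
    thus ?thesis by (auto simp: PiE_iff extensional_def)
  qed
  hence "card {\<omega>\<in>(\<Pi>\<^sub>E i\<in>S. {..<2 ^ M}). \<forall>i\<in>S. cell (k i) (real (\<omega> i) / 2 ^ M) = c i}
      = (\<Prod>i\<in>S. card {n. n < 2 ^ M \<and> n div 2 ^ (M - k i) = c i})"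
    using S by (simp only: card_PiE)
  also have "\<dots> = (\<Prod>i\<in>S. 2 ^ (M - k i))"
    by (intro prod.cong refl) (simp only: one card_atLeastLessThan diff_mult_distrib[symmetric], simp)
  finally have "real (card {\<omega>\<in>(\<Pi>\<^sub>E i\<in>S. {..<2 ^ M}). \<forall>i\<in>S. cell (k i) (real (\<omega> i) / 2 ^ M) = c i})
      = (\<Prod>i\<in>S. 2 ^ (M - k i))" by (simp only: of_nat_prod of_nat_power of_nat_numeral)
  also have "\<dots> = (\<Prod>i\<in>S. 2 ^ M * (1 / 2 ^ k i))"
    using k by (intro prod.cong refl) (simp add: power_diff)
  also have "\<dots> = (2 ^ M) ^ card S * (\<Prod>i\<in>S. 1 / 2 ^ k i)" by (simp only: prod.distrib prod_constant)
  finally show ?thesis .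
qed

text \<open>The inverse distribution functions are represented by monotone maps \<open>G i\<close>
  into the intervals, and F by arbitrary bounds \<open>B u\<close> on its mixed derivatives.
  Densities and weights stay outside.\<close>

locale net_quadrature = niederreiter +
  fixes a b :: "nat \<Rightarrow> real" and s :: nat and G :: "nat \<Rightarrow> real \<Rightarrow> real"
    and F :: "(nat \<Rightarrow> real) \<Rightarrow> real" and B :: "nat set \<Rightarrow> real"
  assumes G_mono: "\<And>i x x'. i \<in> {1..s} \<Longrightarrow> 0 \<le> x \<Longrightarrow> x \<le> x' \<Longrightarrow> x' \<le> 1 \<Longrightarrow> G i x \<le> G i x'"
    and G_range: "\<And>i x. i \<in> {1..s} \<Longrightarrow> 0 \<le> x \<Longrightarrow> x \<le> 1 \<Longrightarrow> G i x \<in> {a i..b i}"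
    and F: "has_mixed_partials a b s F"
    and B: "\<And>u x. u \<subseteq> {1..s} \<Longrightarrow> x \<in> coord_box a b s \<Longrightarrow> \<bar>mixed_partial a b u F x\<bar> \<le> B u"
begin

definition f :: "(nat \<Rightarrow> real) \<Rightarrow> real" where
  "f t = F (\<lambda>i\<in>{1..s}. G i (t i))"

definition corner :: "nat \<Rightarrow> real" where
  "corner = (\<lambda>i\<in>{1..s}. G i 0)"

text \<open>For j \<le> k i this is the image under \<open>G i\<close> of the left endpoint of the
  level j interval containing the level k i interval with index c i. Hence a detail is a function of
  the cell alone.\<close>

definition node :: "(nat \<Rightarrow> nat) \<Rightarrow> (nat \<Rightarrow> nat) \<Rightarrow> nat \<Rightarrow> nat \<Rightarrow> real" where
  "node k c i j = G i (real (c i div 2 ^ (k i - j)) / 2 ^ j)"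

definition detail :: "(nat \<Rightarrow> nat) \<Rightarrow> (nat \<Rightarrow> nat) \<Rightarrow> real" where
  "detail k c = foldr (level_op (node k c) k) [1..<Suc s] F corner"

abbreviation levels :: "nat \<Rightarrow> (nat \<Rightarrow> nat) set" where
  "levels M \<equiv> \<Pi>\<^sub>E i\<in>{1..s}. {..M}"

abbreviation cells :: "(nat \<Rightarrow> nat) \<Rightarrow> (nat \<Rightarrow> nat) set" where
  "cells k \<equiv> \<Pi>\<^sub>E i\<in>{1..s}. {..<2 ^ k i}"

abbreviation lattice :: "nat \<Rightarrow> (nat \<Rightarrow> nat) set" where
  "lattice M \<equiv> \<Pi>\<^sub>E i\<in>{1..s}. {..<2 ^ M}"

lemma corner_in_box: "corner \<in> coord_box a b s"
  unfolding corner_def coord_box_def by (intro restrict_PiE_iff[THEN iffD2] ballI G_range) auto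

text \<open>The level j is arbitrary, beyond k i as well, because the bound on iterated differences
  asks for all nodes to lie in the box.\<close>

lemma node_arg:
  assumes "c i < 2 ^ k i"
  shows "0 \<le> real (c i div 2 ^ (k i - j)) / 2 ^ j \<and> real (c i div 2 ^ (k i - j)) / 2 ^ j \<le> 1"
proof -
  have "c i div 2 ^ (k i - j) \<le> 2 ^ j"
  proof (cases "j \<le> k i")
    case True
    hence "c i < 2 ^ j * 2 ^ (k i - j)" using assms by (simp flip: power_add)
    thus ?thesis by (simp add: less_mult_imp_div_less less_imp_le)
  next
    case False
    hence "(2::nat) ^ k i \<le> 2 ^ j" by (intro power_increasing) auto
    hence "c i \<le> 2 ^ j" using assms by (rule order.trans[OF less_imp_le, rotated])
    moreover have "k i - j = 0" using False by simp
    ultimately show ?thesis by (simp only: power_0 div_by_1)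
  qed
  hence "real (c i div 2 ^ (k i - j)) \<le> 2 ^ j" by (metis of_nat_le_iff of_nat_numeral of_nat_power)
  thus ?thesis by (intro conjI divide_nonneg_nonneg divide_le_eq_1_pos[THEN iffD2]) auto
qed

text \<open>The point lies on the grid of level M, so the finest node reproduces it exactly and the
  finite telescoping sum leaves no remainder.\<close>

lemma decompose:
  assumes t: "\<And>i. i \<in> {1..s} \<Longrightarrow> 0 \<le> t i \<and> t i < 1 \<and> real (cell M (t i)) / 2 ^ M = t i"
  shows "f t = (\<Sum>k\<in>levels M. detail k (\<lambda>i\<in>{1..s}. cell (k i) (t i)))"
proof -
  define X where "X i j = G i (real (cell j (t i)) / 2 ^ j)" for i j
  have "(\<Sum>k\<in>(\<Pi>\<^sub>E i\<in>set [1..<Suc s]. {..M}). foldr (level_op X k) [1..<Suc s] F corner)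
      = F (override_on corner (\<lambda>i. X i M) (set [1..<Suc s]))"
    by (rule sum_level_op) simp
  moreover have S: "set [1..<Suc s] = {1..s}" by auto
  moreover have "override_on corner (\<lambda>i. X i M) (set [1..<Suc s]) = (\<lambda>i\<in>{1..s}. G i (t i))"
  proof
    fix i
    show "override_on corner (\<lambda>i. X i M) (set [1..<Suc s]) i = (\<lambda>i\<in>{1..s}. G i (t i)) i"
    proof (cases "i \<in> {1..s}")
      case True
      hence "X i M = G i (t i)" using t[OF True] by (simp only: X_def)
      thus ?thesis using True unfolding S by simp
    next
      case False
      thus ?thesis unfolding S corner_def by (simp only: override_on_def restrict_def if_False)
    qed
  qed
  moreover have "foldr (level_op X k) [1..<Suc s] F corner = detail k (\<lambda>i\<in>{1..s}. cell (k i) (t i))" for k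
  proof -
    let ?c = "\<lambda>i\<in>{1..s}. cell (k i) (t i)"
    have "foldr (level_op X k) [1..<Suc s] F = foldr (level_op (node k ?c) k) [1..<Suc s] F"
    proof (rule foldr_cong[OF refl refl])
      fix i G' assume "i \<in> set [1..<Suc s]"
      hence i: "i \<in> {1..s}" unfolding S .
      have "X i j = node k ?c i j" if "j \<le> k i" for j
        using cell_coarsen[OF that, of "t i"] t[OF i] i by (simp add: X_def node_def)
      hence "X i (k i) = node k ?c i (k i)" "X i (k i - 1) = node k ?c i (k i - 1)" by simp_all
      thus "level_op X k i G' = level_op (node k ?c) k i G'"
        by (intro ext) (simp only: level_op_def)
    qed
    thus ?thesis unfolding detail_def by (rule fun_cong)
  qed
  ultimately show ?thesis by (simp only: f_def)
qed

lemma detail_bound: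
  assumes c: "c \<in> cells k" and u: "u = {i\<in>{1..s}. k i \<noteq> 0}"
  shows "\<bar>detail k c\<bar> \<le> B u * (\<Prod>i\<in>u. \<bar>G i (real (c i) / 2 ^ k i) - G i (real (c i div 2) / 2 ^ (k i - 1))\<bar>)"
proof -
  have uS: "u \<subseteq> {1..s}" using u by auto
  have "\<bar>detail k c\<bar> \<le> B u * (\<Prod>i\<in>u. \<bar>node k c i (k i) - node k c i (k i - 1)\<bar>)"
    unfolding detail_def
  proof (rule foldr_level_op_bound[OF F u B[OF uS] _ corner_in_box])
    fix i j assume i: "i \<in> {1..s}"
    have "c i < 2 ^ k i" using c i by (auto simp: PiE_iff)
    from node_arg[of c i k j, OF this] show "node k c i j \<in> {a i..b i}"
      unfolding node_def using G_range[OF i] by blast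
  qed
  also have "(\<Prod>i\<in>u. \<bar>node k c i (k i) - node k c i (k i - 1)\<bar>)
      = (\<Prod>i\<in>u. \<bar>G i (real (c i) / 2 ^ k i) - G i (real (c i div 2) / 2 ^ (k i - 1))\<bar>)"
  proof (intro prod.cong refl)
    fix i assume "i \<in> u"
    hence "k i - (k i - 1) = 1" using u by auto
    thus "\<bar>node k c i (k i) - node k c i (k i - 1)\<bar>
        = \<bar>G i (real (c i) / 2 ^ k i) - G i (real (c i div 2) / 2 ^ (k i - 1))\<bar>"
      by (simp add: node_def)
  qed
  finally show ?thesis .
qed

lemma B_nonneg: "u \<subseteq> {1..s} \<Longrightarrow> 0 \<le> B u"
  using B[OF _ corner_in_box] abs_ge_zero order_trans by blast

lemma box_width: "i \<in> {1..s} \<Longrightarrow> 0 \<le> b i - a i"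
  using G_range[of i 0] by auto

text \<open>The bound on a detail is a product of functions of single coordinates. Its sum over all
  cells therefore factors into one-dimensional sums of increments of the \<open>G i\<close>.\<close>

lemma sum_detail_bound:
  assumes u: "u = {i\<in>{1..s}. k i \<noteq> 0}"
  shows "(\<Sum>c\<in>cells k. \<bar>detail k c\<bar>) \<le> B u * (\<Prod>i\<in>u. b i - a i)"
proof -
  have uS: "u \<subseteq> {1..s}" using u by auto
  \<comment> \<open>A coordinate outside u has level 0 and hence a single cell, so the factor 1
    extends the product to all coordinates without changing the sum.\<close>
  define q where "q i c = (if i \<in> u then \<bar>G i (real c / 2 ^ k i) - G i (real (c div 2) / 2 ^ (k i - 1))\<bar> else 1)"
    for i and c :: nat
  have q: "(\<Prod>i\<in>u. \<bar>G i (real (c i) / 2 ^ k i) - G i (real (c i div 2) / 2 ^ (k i - 1))\<bar>)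
      = (\<Prod>i\<in>{1..s}. q i (c i))" for c
    using uS by (intro prod.mono_neutral_cong_left) (auto simp: q_def)
  have "(\<Sum>c\<in>cells k. \<bar>detail k c\<bar>) \<le> (\<Sum>c\<in>cells k. B u * (\<Prod>i\<in>{1..s}. q i (c i)))"
    unfolding q[symmetric] by (intro sum_mono detail_bound u)
  also have "\<dots> = B u * (\<Prod>i\<in>{1..s}. \<Sum>c<2 ^ k i. q i c)"
    unfolding sum_distrib_left[symmetric] by (subst prod_sum_PiE) auto
  also have "\<dots> \<le> B u * (\<Prod>i\<in>{1..s}. if i \<in> u then b i - a i else 1)"
  proof (intro mult_left_mono prod_mono conjI)
    fix i assume i: "i \<in> {1..s}"
    show "0 \<le> (\<Sum>c<2 ^ k i. q i c)" by (intro sum_nonneg) (auto simp: q_def)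
    show "(\<Sum>c<2 ^ k i. q i c) \<le> (if i \<in> u then b i - a i else 1)"
    proof (cases "i \<in> u")
      case True
      hence "k i \<ge> 1" using u by auto
      have "(\<Sum>c<2 ^ k i. q i c) = (\<Sum>c<2 ^ k i. \<bar>G i (real c / 2 ^ k i) - G i (real (c div 2) / 2 ^ (k i - 1))\<bar>)"
        using True by (simp only: q_def if_True)
      also have "\<dots> \<le> G i 1 - G i 0"
        by (rule sum_dyadic_increments[OF G_mono[OF i] \<open>k i \<ge> 1\<close>])
      also have "\<dots> \<le> b i - a i" using G_range[OF i, of 1] G_range[OF i, of 0] by simp
      finally show ?thesis using True by (simp only: if_True)
    next
      case False
      hence "k i = 0" using u i by auto
      thus ?thesis using False by (simp add: q_def del: atLeastAtMost_iff)
    qed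
  qed (rule B_nonneg[OF uS])
  also have "(\<Prod>i\<in>{1..s}. if i \<in> u then b i - a i else 1) = (\<Prod>i\<in>u. b i - a i)"
    using uS by (intro prod.mono_neutral_cong_right) auto
  finally show ?thesis .
qed

section \<open>Frequencies of net points against volumes\<close>

definition net_freq :: "(nat \<Rightarrow> nat) \<Rightarrow> (nat \<Rightarrow> nat) \<Rightarrow> real" where
  "net_freq k c = real (card {n\<in>{..<2 ^ m}. \<forall>i\<in>{1..s}. cell (k i) (y n i) = c i}) / 2 ^ m"

definition volume :: "(nat \<Rightarrow> nat) \<Rightarrow> real" where
  "volume k = (\<Prod>i\<in>{1..s}. 1 / 2 ^ k i)"

text \<open>At level 0 there is only the cell 0, and it contains every point; these coordinates
  impose no condition.\<close>

lemma net_freq_support: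
  assumes c: "c \<in> cells k" and u: "u = {i\<in>{1..s}. k i \<noteq> 0}"
  shows "net_freq k c = real (card {n\<in>{..<2 ^ m}. \<forall>i\<in>u. cell (k i) (y n i) = c i}) / 2 ^ m"
proof -
  have "cell (k i) (y n i) = c i" if "i \<in> {1..s}" "i \<notin> u" for n i
  proof -
    have "k i = 0" using that u by auto
    moreover have "cell 0 (y n i) < 2 ^ 0" by (rule cell_less[OF net_point_range])
    moreover have "c i < 2 ^ k i" using c that by (auto simp: PiE_iff)
    ultimately show ?thesis by simp
  qed
  hence "(\<forall>i\<in>{1..s}. cell (k i) (y n i) = c i) \<longleftrightarrow> (\<forall>i\<in>u. cell (k i) (y n i) = c i)" for n
    using u by blast
  thus ?thesis unfolding net_freq_def by (simp only:)
qed

lemma volume_support: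
  assumes u: "u = {i\<in>{1..s}. k i \<noteq> 0}"
  shows "volume k = (\<Prod>i\<in>u. 1 / 2 ^ k i)"
  unfolding volume_def using u by (intro prod.mono_neutral_right) auto

definition detail_error :: "(nat \<Rightarrow> nat) \<Rightarrow> real" where
  "detail_error k = (\<Sum>c\<in>cells k. detail k c * (net_freq k c - volume k))"

text \<open>The bound \<open>R\<close> on the discrepancy is required only after multiplication by
  the detail, so cells with vanishing detail impose nothing. This is what the levels beyond m
  need.\<close>

lemma detail_error_le_max:
  assumes u: "u = {i\<in>{1..s}. k i \<noteq> 0}"
    and R: "\<And>c. c \<in> cells k \<Longrightarrow> \<bar>detail k c\<bar> * \<bar>net_freq k c - volume k\<bar> \<le> \<bar>detail k c\<bar> * R" and "0 \<le> R"
  shows "\<bar>detail_error k\<bar> \<le> B u * (\<Prod>i\<in>u. b i - a i) * R"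
proof -
  have "\<bar>detail_error k\<bar> \<le> (\<Sum>c\<in>cells k. \<bar>detail k c * (net_freq k c - volume k)\<bar>)"
    unfolding detail_error_def by (rule sum_abs)
  also have "\<dots> \<le> (\<Sum>c\<in>cells k. \<bar>detail k c\<bar> * R)"
    unfolding abs_mult by (intro sum_mono R)
  also have "\<dots> = (\<Sum>c\<in>cells k. \<bar>detail k c\<bar>) * R" by (rule sum_distrib_right[symmetric])
  also have "\<dots> \<le> B u * (\<Prod>i\<in>u. b i - a i) * R"
    using sum_detail_bound[OF u] \<open>0 \<le> R\<close> by (rule mult_right_mono)
  finally show ?thesis .
qed

text \<open>A net point in such a cell is a multiple of 2^(-m), so it is the left endpoint of its
  interval of level k i > m. Then c i is even, the nodes of levels k i and k i - 1 coincide, and the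
  difference in coordinate i vanishes.\<close>

lemma detail_fine_level:
  assumes c: "c \<in> cells k" and i: "i \<in> {1..s}" and ki: "m < k i" and nz: "net_freq k c \<noteq> 0"
  shows "detail k c = 0"
proof -
  define u where "u = {i\<in>{1..s}. k i \<noteq> 0}"
  have iu: "i \<in> u" "finite u" using i ki by (auto simp: u_def)
  define A where "A = {n\<in>{..<2 ^ m}. \<forall>i\<in>{1..s}. cell (k i) (y n i) = c i}"
  have "A \<noteq> {}"
  proof
    assume "A = {}"
    thus False using nz unfolding net_freq_def A_def[symmetric] by simp
  qed
  then obtain n where "n \<in> A" by blast
  hence "\<forall>i\<in>{1..s}. cell (k i) (y n i) = c i" unfolding A_def mem_Collect_eq by (rule conjunct2)
  hence "cell (k i) (y n i) = c i" using i by (rule bspec)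
  hence "c i = cell (k i) (real (numer n i) / 2 ^ m)" by (simp only: net_point_eq)
  also have "\<dots> = numer n i * 2 ^ (k i - m)" using ki by (intro cell_dyadic_fine) simp
  finally have ci0: "c i = numer n i * 2 ^ (k i - m)" .
  define d where "d = k i - m - 1"
  have d: "k i - m = Suc d" using ki by (simp add: d_def)
  have ci: "c i = 2 * (numer n i * 2 ^ d)"
    using ci0 unfolding d power_Suc by (simp only: mult.left_commute)
  have k2: "(2::real) ^ k i = 2 * 2 ^ (k i - 1)" using ki by (simp flip: power_Suc)
  have "c i div 2 = numer n i * 2 ^ d" unfolding ci by (rule nonzero_mult_div_cancel_left) simp
  hence "real (c i) = 2 * real (c i div 2)" using ci by linarith
  hence "real (c i) / 2 ^ k i = real (c i div 2) / 2 ^ (k i - 1)" unfolding k2 by simp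
  hence "\<bar>G i (real (c i) / 2 ^ k i) - G i (real (c i div 2) / 2 ^ (k i - 1))\<bar> = 0"
    by (simp only: diff_self abs_zero)
  hence "(\<Prod>i\<in>u. \<bar>G i (real (c i) / 2 ^ k i) - G i (real (c i div 2) / 2 ^ (k i - 1))\<bar>) = 0"
    by (intro prod_zero[OF iu(2)] bexI[OF _ iu(1)])
  hence "\<bar>detail k c\<bar> \<le> B u * 0" using detail_bound[OF c u_def] by (simp only:)
  thus ?thesis by simp
qed

lemma detail_error_zero:
  assumes "\<And>i. i \<in> {1..s} \<Longrightarrow> k i = 0"
  shows "detail_error k = 0"
proof -
  have u: "{} = {i\<in>{1..s}. k i \<noteq> 0}" using assms by auto
  have "net_freq k c = volume k" if "c \<in> cells k" for c
    unfolding net_freq_support[OF that u] volume_support[OF u] by simp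
  thus ?thesis by (simp add: detail_error_def)
qed

text \<open>If some level exceeds m, then either the detail or the frequency vanishes, and only the
  volume is left to estimate. Otherwise all level weights are 1: small level sums give exact
  integration, and for large ones frequency and volume both lie between 0 and 2^t / 2^m.\<close>

lemma detail_error_bound:
  assumes u: "u = {i\<in>{1..s}. k i \<noteq> 0}"
  shows "\<bar>detail_error k\<bar>
    \<le> B u * (\<Prod>i\<in>u. b i - a i) * (2 ^ (\<Sum>i\<in>u. e i - 1) / 2 ^ m * (\<Prod>i\<in>u. level_weight m (k i)))"
proof (rule detail_error_le_max[OF u])
  define t where "t = (\<Sum>i\<in>u. e i - 1)"
  have uS: "finite u" "u \<subseteq> {1..}" using u by auto
  let ?w = "\<Prod>i\<in>u. level_weight m (k i)"
  have w0: "0 \<le> ?w" by (intro prod_nonneg less_imp_le level_weight_pos)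
  show R0: "0 \<le> 2 ^ (\<Sum>i\<in>u. e i - 1) / 2 ^ m * ?w" using w0 by simp
  have vol: "volume k = 1 / 2 ^ (\<Sum>i\<in>u. k i)"
    unfolding volume_support[OF u] by (simp add: prod_dividef power_sum)
  fix c assume c: "c \<in> cells k"
  have cu: "c i < 2 ^ k i" if "i \<in> u" for i using c that u by (auto simp: PiE_iff)
  have freq0: "0 \<le> net_freq k c" by (simp add: net_freq_def)
  have vol0: "0 \<le> volume k" unfolding vol by simp
  show "\<bar>detail k c\<bar> * \<bar>net_freq k c - volume k\<bar> \<le> \<bar>detail k c\<bar> * (2 ^ (\<Sum>i\<in>u. e i - 1) / 2 ^ m * ?w)"
  proof (cases "\<exists>i\<in>u. m < k i")
    case True
    then obtain i where i: "i \<in> u" "m < k i" by blast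
    show ?thesis
    proof (cases "net_freq k c = 0")
      case False
      have "i \<in> {1..s}" using i(1) u by blast
      from detail_fine_level[OF c this i(2) False] have "detail k c = 0" .
      thus ?thesis by simp
    next
      case vanish: True
      have "volume k = 1 / 2 ^ k i * (\<Prod>j\<in>u - {i}. 1 / 2 ^ k j)"
        unfolding volume_support[OF u] by (rule prod.remove[OF uS(1) i(1)])
      \<comment> \<open>For the distinguished index, 1 / 2^(k i) equals 2^(-m) times the level
        weight. It alone supplies the factor 2^(-m).\<close>
      also have "\<dots> \<le> (1 / 2 ^ m * level_weight m (k i)) * (\<Prod>j\<in>u - {i}. level_weight m (k j))"
        using i(2) by (intro mult_mono prod_mono conjI inverse_power_le_level_weight)
          (auto simp: level_weight_def intro!: prod_nonneg)
      also have "\<dots> = 1 / 2 ^ m * ?w"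
        unfolding mult.assoc by (simp only: prod.remove[OF uS(1) i(1)])
      also have "\<dots> \<le> 2 ^ (\<Sum>i\<in>u. e i - 1) / 2 ^ m * ?w"
        using w0 by (intro mult_right_mono divide_right_mono) auto
      finally have "\<bar>net_freq k c - volume k\<bar> \<le> 2 ^ (\<Sum>i\<in>u. e i - 1) / 2 ^ m * ?w"
        using vanish vol0 by simp
      thus ?thesis by (rule mult_left_mono) simp
    qed
  next
    case False
    have w1: "?w = 1" using False by (intro prod.neutral) (auto simp: level_weight_def)
    have "\<bar>net_freq k c - volume k\<bar> \<le> 2 ^ t / 2 ^ m"
    proof (cases "(\<Sum>i\<in>u. k i + e i - 1) \<le> m")
      case True
      have "net_freq k c = volume k"
      proof -
        have "real (card {n\<in>{..<2 ^ m}. \<forall>i\<in>u. cell (k i) (y n i) = c i}) = 2 ^ m / 2 ^ (\<Sum>i\<in>u. k i)"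
          by (rule card_net_box[OF uS True cu])
        thus ?thesis unfolding net_freq_support[OF c u] vol by simp
      qed
      thus ?thesis by simp
    next
      case False
      have "net_freq k c \<le> 2 ^ t / 2 ^ m"
        unfolding net_freq_support[OF c u] t_def using False
        by (intro divide_right_mono card_net_box_le[OF uS _ cu]) auto
      moreover have "volume k \<le> 2 ^ t / 2 ^ m"
      proof -
        have "(\<Sum>i\<in>u. k i + e i - 1) = (\<Sum>i\<in>u. k i) + t"
          unfolding t_def sum.distrib[symmetric] using e_pos uS by (intro sum.cong refl) force
        hence "(2::real) ^ m \<le> 2 ^ t * 2 ^ (\<Sum>i\<in>u. k i)"
          using False by (simp flip: power_add)
        thus ?thesis unfolding vol by (simp add: field_simps)
      qed
      ultimately show ?thesis using freq0 vol0 by linarith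
    qed
    hence "\<bar>net_freq k c - volume k\<bar> \<le> 2 ^ (\<Sum>i\<in>u. e i - 1) / 2 ^ m * ?w"
      unfolding w1 t_def by simp
    thus ?thesis by (rule mult_left_mono) simp
  qed
qed

text \<open>Both point sets lie on the grid of level M \<ge> m, so both averages decompose without
  remainder. The frequencies of the grid are the volumes.\<close>

lemma net_vs_lattice_eq:
  assumes "m \<le> M"
  shows "(\<Sum>n<2 ^ m. f (y n)) / 2 ^ m - (\<Sum>\<omega>\<in>lattice M. f (\<lambda>i. real (\<omega> i) / 2 ^ M)) / (2 ^ M) ^ s
    = (\<Sum>k\<in>levels M. detail_error k)"
proof -
  have finL: "finite (lattice M)" by (intro finite_PiE) auto
  have net: "(\<Sum>n<2 ^ m. f (y n)) / 2 ^ m = (\<Sum>k\<in>levels M. \<Sum>c\<in>cells k. detail k c * net_freq k c)"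
  proof -
    have exact: "real (cell M (y n i)) / 2 ^ M = y n i" for n i
    proof -
      have "(2::real) ^ M = 2 ^ (M - m) * 2 ^ m" using assms by (simp flip: power_add)
      thus ?thesis unfolding net_point_eq cell_dyadic_fine[OF assms] by simp
    qed
    have "(\<Sum>n<2 ^ m. f (y n)) = (\<Sum>n<2 ^ m. \<Sum>k\<in>levels M. detail k (\<lambda>i\<in>{1..s}. cell (k i) (y n i)))"
      using exact net_point_range by (intro sum.cong refl decompose) simp
    also have "\<dots> = (\<Sum>k\<in>levels M. \<Sum>n<2 ^ m. detail k (\<lambda>i\<in>{1..s}. cell (k i) (y n i)))"
      by (rule sum.swap)
    also have "\<dots> = (\<Sum>k\<in>levels M. \<Sum>c\<in>cells k. detail k c * real (card {n\<in>{..<2 ^ m}. \<forall>i\<in>{1..s}. cell (k i) (y n i) = c i}))"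
      using net_point_range by (intro sum.cong refl sum_by_cells) auto
    finally show ?thesis
      by (simp only: net_freq_def sum_divide_distrib times_divide_eq_right)
  qed
  have lat: "(\<Sum>\<omega>\<in>lattice M. f (\<lambda>i. real (\<omega> i) / 2 ^ M)) / (2 ^ M) ^ s = (\<Sum>k\<in>levels M. \<Sum>c\<in>cells k. detail k c * volume k)"
  proof -
    have rng: "0 \<le> real (\<omega> i) / 2 ^ M \<and> real (\<omega> i) / 2 ^ M < 1" if "\<omega> \<in> lattice M" "i \<in> {1..s}" for \<omega> i
    proof -
      have "\<omega> i < 2 ^ M" using that by (auto simp: PiE_iff)
      hence "real (\<omega> i) < 2 ^ M" by (metis of_nat_less_iff of_nat_numeral of_nat_power)
      thus ?thesis by simp
    qed
    have exact: "real (cell M (real n / 2 ^ M)) / 2 ^ M = real n / 2 ^ M" for n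
      by (simp add: cell_dyadic)
    have "(\<Sum>\<omega>\<in>lattice M. f (\<lambda>i. real (\<omega> i) / 2 ^ M))
        = (\<Sum>\<omega>\<in>lattice M. \<Sum>k\<in>levels M. detail k (\<lambda>i\<in>{1..s}. cell (k i) (real (\<omega> i) / 2 ^ M)))"
      using exact rng by (intro sum.cong refl decompose) blast
    also have "\<dots> = (\<Sum>k\<in>levels M. \<Sum>\<omega>\<in>lattice M. detail k (\<lambda>i\<in>{1..s}. cell (k i) (real (\<omega> i) / 2 ^ M)))"
      by (rule sum.swap)
    also have "\<dots> = (\<Sum>k\<in>levels M. \<Sum>c\<in>cells k. detail k c * ((2 ^ M) ^ s * volume k))"
    proof (rule sum.cong[OF refl])
      fix k assume k: "k \<in> levels M"
      have "(\<Sum>\<omega>\<in>lattice M. detail k (\<lambda>i\<in>{1..s}. cell (k i) (real (\<omega> i) / 2 ^ M)))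
          = (\<Sum>c\<in>cells k. detail k c * real (card {\<omega>\<in>lattice M. \<forall>i\<in>{1..s}. cell (k i) (real (\<omega> i) / 2 ^ M) = c i}))"
        by (rule sum_by_cells[OF finL finite_atLeastAtMost rng])
      also have "\<dots> = (\<Sum>c\<in>cells k. detail k c * ((2 ^ M) ^ s * volume k))"
      proof (intro sum.cong refl arg_cong2[where f = "(*)"])
        fix c assume c: "c \<in> cells k"
        have "real (card {\<omega>\<in>lattice M. \<forall>i\<in>{1..s}. cell (k i) (real (\<omega> i) / 2 ^ M) = c i})
          = (2 ^ M) ^ card {1..s} * (\<Prod>i\<in>{1..s}. 1 / 2 ^ k i)"
          using k c by (intro card_lattice_box) (auto simp: PiE_iff)
        thus "real (card {\<omega>\<in>lattice M. \<forall>i\<in>{1..s}. cell (k i) (real (\<omega> i) / 2 ^ M) = c i})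
          = (2 ^ M) ^ s * volume k"
          by (simp only: volume_def card_atLeastAtMost diff_Suc_1)
      qed
      finally show "(\<Sum>\<omega>\<in>lattice M. detail k (\<lambda>i\<in>{1..s}. cell (k i) (real (\<omega> i) / 2 ^ M)))
          = (\<Sum>c\<in>cells k. detail k c * ((2 ^ M) ^ s * volume k))" .
    qed
    also have "\<dots> = (\<Sum>k\<in>levels M. \<Sum>c\<in>cells k. detail k c * volume k) * (2 ^ M) ^ s"
      by (simp only: sum_distrib_right mult.assoc mult.commute[of "(2 ^ M) ^ s"])
    finally show ?thesis by simp
  qed
  show ?thesis
    unfolding net lat detail_error_def by (simp only: sum_subtractf[symmetric] right_diff_distrib)
qed

text \<open>The level vectors are grouped by support. For fixed u the sum of the products of level
  weights factors into sums over single levels, each at most m + 1. The bound is free of M, as the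
  limit requires.\<close>

lemma net_vs_lattice:
  assumes "m \<le> M"
  shows "\<bar>(\<Sum>n<2 ^ m. f (y n)) / 2 ^ m - (\<Sum>\<omega>\<in>lattice M. f (\<lambda>i. real (\<omega> i) / 2 ^ M)) / (2 ^ M) ^ s\<bar>
    \<le> (\<Sum>u\<in>Pow {1..s} - {{}}. B u * (\<Prod>i\<in>u. (b i - a i) * 2 ^ (e i - 1) * (real m + 1))) / 2 ^ m"
proof -
  define supp where "supp k = {i\<in>{1..s}. k i \<noteq> 0}" for k :: "nat \<Rightarrow> nat"
  have fin: "finite (levels M)" by (intro finite_PiE) auto
  have "\<bar>\<Sum>k\<in>levels M. detail_error k\<bar> \<le> (\<Sum>k\<in>levels M. \<bar>detail_error k\<bar>)" by (rule sum_abs)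
  also have "\<dots> = (\<Sum>u\<in>Pow {1..s}. \<Sum>k\<in>{k\<in>levels M. supp k = u}. \<bar>detail_error k\<bar>)"
    by (rule sum.group[symmetric, OF fin]) (auto simp: supp_def)
  also have "\<dots> = (\<Sum>u\<in>Pow {1..s} - {{}}. \<Sum>k\<in>{k\<in>levels M. supp k = u}. \<bar>detail_error k\<bar>)"
  proof (rule sum.mono_neutral_right)
    have "detail_error k = 0" if "supp k = {}" for k
      using that by (intro detail_error_zero) (auto simp: supp_def)
    thus "\<forall>u\<in>Pow {1..s} - (Pow {1..s} - {{}}). (\<Sum>k\<in>{k\<in>levels M. supp k = u}. \<bar>detail_error k\<bar>) = 0"
      by (auto intro!: sum.neutral)
  qed auto
  also have "\<dots> \<le> (\<Sum>u\<in>Pow {1..s} - {{}}. B u * (\<Prod>i\<in>u. (b i - a i) * 2 ^ (e i - 1) * (real m + 1)) / 2 ^ m)"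
  proof (rule sum_mono)
    fix u assume "u \<in> Pow {1..s} - {{}}"
    hence uS: "u \<subseteq> {1..s}" by simp
    hence finu: "finite u" by (rule finite_subset) simp
    define A where "A i = (if i \<in> u then {1..M} else {0::nat})" for i
    let ?K = "B u * (\<Prod>i\<in>u. b i - a i) * (2 ^ (\<Sum>i\<in>u. e i - 1) / 2 ^ m)"
    have K0: "0 \<le> ?K"
    proof -
      have "0 \<le> (\<Prod>i\<in>u. b i - a i)" using box_width uS by (intro prod_nonneg) blast
      thus ?thesis using B_nonneg[OF uS] by simp
    qed
    have set_eq: "{k\<in>levels M. supp k = u} = (\<Pi>\<^sub>E i\<in>{1..s}. A i)"
    proof -
      have "k \<in> levels M \<and> supp k = u \<longleftrightarrow> k \<in> (\<Pi>\<^sub>E i\<in>{1..s}. A i)" for k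
      proof -
        have "supp k = u \<longleftrightarrow> (\<forall>i\<in>{1..s}. k i \<noteq> 0 \<longleftrightarrow> i \<in> u)"
          using uS unfolding supp_def by blast
        hence "k \<in> levels M \<and> supp k = u
            \<longleftrightarrow> (\<forall>i\<in>{1..s}. k i \<le> M \<and> (k i \<noteq> 0 \<longleftrightarrow> i \<in> u)) \<and> k \<in> extensional {1..s}"
          unfolding PiE_iff by auto
        also have "\<dots> \<longleftrightarrow> k \<in> (\<Pi>\<^sub>E i\<in>{1..s}. A i)"
          unfolding PiE_iff
        proof (intro arg_cong2[where f = "(\<and>)"] ball_cong refl)
          fix i
          show "(k i \<le> M \<and> (k i \<noteq> 0 \<longleftrightarrow> i \<in> u)) = (k i \<in> A i)"
            unfolding A_def by (cases "i \<in> u") auto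
        qed
        finally show ?thesis .
      qed
      thus ?thesis by blast
    qed
    have "(\<Sum>k\<in>{k\<in>levels M. supp k = u}. \<bar>detail_error k\<bar>)
        \<le> (\<Sum>k\<in>{k\<in>levels M. supp k = u}. ?K * (\<Prod>i\<in>u. level_weight m (k i)))"
    proof (rule sum_mono)
      fix k assume "k \<in> {k\<in>levels M. supp k = u}"
      hence "u = {i\<in>{1..s}. k i \<noteq> 0}" by (simp add: supp_def)
      hence "\<bar>detail_error k\<bar> \<le> B u * (\<Prod>i\<in>u. b i - a i)
          * (2 ^ (\<Sum>i\<in>u. e i - 1) / 2 ^ m * (\<Prod>i\<in>u. level_weight m (k i)))"
        by (rule detail_error_bound)
      thus "\<bar>detail_error k\<bar> \<le> ?K * (\<Prod>i\<in>u. level_weight m (k i))" by (simp only: mult.assoc)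
    qed
    also have "\<dots> = ?K * (\<Sum>k\<in>(\<Pi>\<^sub>E i\<in>{1..s}. A i). \<Prod>i\<in>{1..s}. if i \<in> u then level_weight m (k i) else 1)"
      unfolding set_eq sum_distrib_left[symmetric] using uS
      by (intro arg_cong2[where f = "(*)"] refl sum.cong prod.mono_neutral_cong_left) auto
    also have "(\<Sum>k\<in>(\<Pi>\<^sub>E i\<in>{1..s}. A i). \<Prod>i\<in>{1..s}. if i \<in> u then level_weight m (k i) else 1)
        = (\<Prod>i\<in>{1..s}. \<Sum>j\<in>A i. if i \<in> u then level_weight m j else 1)"
      by (rule prod_sum_PiE[symmetric]) (auto simp: A_def)
    also have "\<dots> = (\<Prod>i\<in>u. \<Sum>j\<in>{1..M}. level_weight m j)"
      using uS by (intro prod.mono_neutral_cong_right) (auto simp: A_def)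
    also have "?K * \<dots> \<le> ?K * (\<Prod>i\<in>u. real m + 1)"
      by (intro mult_left_mono[OF _ K0] prod_mono conjI sum_level_weight sum_nonneg)
        (auto intro: less_imp_le[OF level_weight_pos])
    also have "\<dots> = B u * (\<Prod>i\<in>u. (b i - a i) * 2 ^ (e i - 1) * (real m + 1)) / 2 ^ m"
      by (simp add: prod.distrib power_sum)
    finally show "(\<Sum>k\<in>{k\<in>levels M. supp k = u}. \<bar>detail_error k\<bar>)
        \<le> B u * (\<Prod>i\<in>u. (b i - a i) * 2 ^ (e i - 1) * (real m + 1)) / 2 ^ m" .
  qed
  finally show ?thesis unfolding net_vs_lattice_eq[OF assms] by (simp only: sum_divide_distrib)
qed

end

section \<open>Lattice averages converge to the integral\<close>

locale invertible_distr =
  fixes l h :: real and f :: "real \<Rightarrow> real"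
  assumes dens: "prob_density_on l h f" and bij: "bij_betw (distr_fun l f) {l..h} {0..1}"
begin

definition D :: "real \<Rightarrow> real" where "D = distr_fun l f"
definition g :: "real \<Rightarrow> real" where "g = the_inv_into {l..h} (distr_fun l f)"

lemma integrable_sub: "l \<le> x \<Longrightarrow> y \<le> h \<Longrightarrow> set_integrable lebesgue {x..y} f"
    "l \<le> x \<Longrightarrow> y \<le> h \<Longrightarrow> set_integrable lebesgue {x<..y} f"
  using dens unfolding prob_density_on_def by (auto intro: set_integrable_subset)

lemma D_diff:
  assumes "l \<le> x" "x \<le> y" "y \<le> h"
  shows "D y - D x = (LINT t:{x<..y}|lebesgue. f t)"
proof -
  have "{l..y} = {l..x} \<union> {x<..y}" using assms by auto
  moreover have "(LINT t:{l..x} \<union> {x<..y}|lebesgue. f t)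
      = (LINT t:{l..x}|lebesgue. f t) + (LINT t:{x<..y}|lebesgue. f t)"
    using assms by (intro set_integral_Un integrable_sub) auto
  ultimately show ?thesis unfolding D_def distr_fun_def by simp
qed

lemma D_mono: "l \<le> x \<Longrightarrow> x \<le> y \<Longrightarrow> y \<le> h \<Longrightarrow> D x \<le> D y"
proof -
  assume xy: "l \<le> x" "x \<le> y" "y \<le> h"
  have "0 \<le> (LINT t:{x<..y}|lebesgue. f t)"
    unfolding set_lebesgue_integral_def
    using xy dens by (intro integral_nonneg_AE AE_I2) (auto simp: prob_density_on_def indicator_def)
  thus ?thesis using D_diff[OF xy] by simp
qed

lemma D_range: "x \<in> {l..h} \<Longrightarrow> D x \<in> {0..1}"
  using bij_betwE[OF bij] unfolding D_def by blast

lemma D_inj: "x \<in> {l..h} \<Longrightarrow> y \<in> {l..h} \<Longrightarrow> D x = D y \<Longrightarrow> x = y"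
  using bij unfolding D_def bij_betw_def inj_on_def by blast

lemma D_strict: "l \<le> x \<Longrightarrow> x < y \<Longrightarrow> y \<le> h \<Longrightarrow> D x < D y"
  using D_mono[of x y] D_inj[of x y] by fastforce

lemma D_le_iff: "x \<in> {l..h} \<Longrightarrow> y \<in> {l..h} \<Longrightarrow> D x \<le> D y \<longleftrightarrow> x \<le> y"
  using D_strict[of y x] D_mono[of x y] by fastforce

lemma g_range: "z \<in> {0..1} \<Longrightarrow> g z \<in> {l..h}"
  unfolding g_def using bij by (intro the_inv_into_into[OF _ _ subset_refl]) (auto simp: bij_betw_def)

lemma D_g: "z \<in> {0..1} \<Longrightarrow> D (g z) = z"
  unfolding g_def D_def using bij by (intro f_the_inv_into_f) (auto simp: bij_betw_def)

lemma g_D: "x \<in> {l..h} \<Longrightarrow> g (D x) = x"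
  unfolding g_def D_def using bij by (intro the_inv_into_f_f) (auto simp: bij_betw_def)

text \<open>A Galois connection: conditions on the value of D become conditions on the position of
  x.\<close>

lemma D_le_iff_g: "x \<in> {l..h} \<Longrightarrow> z \<in> {0..1} \<Longrightarrow> D x \<le> z \<longleftrightarrow> x \<le> g z"
  using D_le_iff[of x "g z"] g_range D_g by simp

lemma g_mono: "0 \<le> z \<Longrightarrow> z \<le> z' \<Longrightarrow> z' \<le> 1 \<Longrightarrow> g z \<le> g z'"
  using D_le_iff_g[of "g z" z'] g_range[of z] D_g[of z] by simp

text \<open>The truncated subtraction puts the point with D x = 0 into the piece with index 0.\<close>

definition index :: "nat \<Rightarrow> real \<Rightarrow> nat" where
  "index M x = nat \<lceil>2 ^ M * D x\<rceil> - 1"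

definition piece :: "nat \<Rightarrow> nat \<Rightarrow> real set" where
  "piece M c = {x\<in>{l..h}. index M x = c}"

text \<open>Rounding up and subtracting 1 keeps the right endpoint, where D is 1, in the last piece;
  rounding down would give the index 2^M.\<close>

lemma index_less: "x \<in> {l..h} \<Longrightarrow> index M x < 2 ^ M"
proof -
  assume "x \<in> {l..h}"
  hence "2 ^ M * D x \<le> 2 ^ M * 1" using D_range by (intro mult_left_mono) auto
  hence "\<lceil>2 ^ M * D x\<rceil> \<le> 2 ^ M" by (simp add: ceiling_le_iff)
  hence "nat \<lceil>2 ^ M * D x\<rceil> \<le> 2 ^ M" by (simp add: nat_le_iff)
  moreover have "(0::nat) < 2 ^ M" by simp
  ultimately show ?thesis unfolding index_def by linarith
qed

lemma index_bounds:
  assumes "x \<in> {l..h}"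
  shows "real (index M x) / 2 ^ M \<le> D x" "D x \<le> (real (index M x) + 1) / 2 ^ M"
proof -
  let ?r = "2 ^ M * D x"
  have r: "0 \<le> ?r" using D_range[OF assms] by simp
  have "real (index M x) \<le> ?r" "?r \<le> real (index M x) + 1"
  proof -
    show "real (index M x) \<le> ?r"
    proof (cases "\<lceil>?r\<rceil> \<le> 1")
      case True
      hence "index M x = 0" unfolding index_def by simp
      thus ?thesis using r by simp
    next
      case False
      hence "int (index M x) = \<lceil>?r\<rceil> - 1" unfolding index_def by arith
      hence "real (index M x) = real_of_int \<lceil>?r\<rceil> - 1" by linarith
      thus ?thesis by linarith
    qed
    show "?r \<le> real (index M x) + 1"
    proof (cases "\<lceil>?r\<rceil> \<le> 1")
      case True
      hence "?r \<le> 1" by linarith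
      thus ?thesis by simp
    next
      case False
      hence "int (index M x) = \<lceil>?r\<rceil> - 1" unfolding index_def by arith
      hence "real (index M x) = real_of_int \<lceil>?r\<rceil> - 1" by linarith
      thus ?thesis by linarith
    qed
  qed
  thus "real (index M x) / 2 ^ M \<le> D x" "D x \<le> (real (index M x) + 1) / 2 ^ M"
    by (simp_all add: field_simps)
qed

lemma index_unit: "x \<in> {l..h} \<Longrightarrow> real (index M x) / 2 ^ M \<in> {0..1}"
proof -
  assume x: "x \<in> {l..h}"
  have "real (index M x) / 2 ^ M \<le> 1" using index_bounds(1)[OF x, of M] D_range[OF x] by (simp only: atLeastAtMost_iff) linarith
  moreover have "0 \<le> real (index M x) / 2 ^ M" by simp
  ultimately show ?thesis by (simp only: atLeastAtMost_iff)
qed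

lemma index_eq_iff:
  assumes x: "x \<in> {l..h}"
  shows "index M x = c \<longleftrightarrow> (c = 0 \<or> real c / 2 ^ M < D x) \<and> D x \<le> (real c + 1) / 2 ^ M"
proof -
  let ?r = "2 ^ M * D x"
  have r: "0 \<le> ?r" using D_range[OF x] by simp
  have "index M x = c \<longleftrightarrow> (c = 0 \<or> real c < ?r) \<and> ?r \<le> real c + 1"
  proof (cases c)
    case 0
    have "index M x = 0 \<longleftrightarrow> \<lceil>?r\<rceil> \<le> 1" unfolding index_def by auto
    also have "\<dots> \<longleftrightarrow> ?r \<le> 1" by (simp add: ceiling_le_iff)
    finally show ?thesis using 0 by simp
  next
    case (Suc d)
    have "index M x = c \<longleftrightarrow> \<lceil>?r\<rceil> = int c + 1" unfolding index_def Suc by auto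
    also have "\<dots> \<longleftrightarrow> real c < ?r \<and> ?r \<le> real c + 1" by (simp add: ceiling_eq_iff)
    finally show ?thesis using Suc by simp
  qed
  thus ?thesis by (simp add: field_simps)
qed

lemma dyadic_unit_interval:
  assumes "c < 2 ^ M"
  shows "real c / 2 ^ M \<in> {0..1}" "(real c + 1) / 2 ^ M \<in> {0..1}"
proof -
  have "Suc c \<le> 2 ^ M" using assms by simp
  hence "real (Suc c) \<le> real (2 ^ M)" by (rule of_nat_mono)
  hence le: "real c + 1 \<le> 2 ^ M" by simp
  have p: "(0::real) < 2 ^ M" by simp
  have n: "0 \<le> real c / 2 ^ M" "0 \<le> (real c + 1) / 2 ^ M" by simp_all
  have l: "real c / 2 ^ M \<le> 1" "(real c + 1) / 2 ^ M \<le> 1"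
    unfolding divide_le_eq_1_pos[OF p] using le by linarith+
  show "real c / 2 ^ M \<in> {0..1}" by (rule atLeastAtMost_iff[THEN iffD2, OF conjI[OF n(1) l(1)]])
  show "(real c + 1) / 2 ^ M \<in> {0..1}" by (rule atLeastAtMost_iff[THEN iffD2, OF conjI[OF n(2) l(2)]])
qed

text \<open>By the Galois connection the preimage of a dyadic interval under D is again an interval,
  so its measurability and its integral are immediate.\<close>

lemma piece_eq:
  assumes c: "c < 2 ^ M"
  shows "piece M c = (if c = 0 then {l..g (1 / 2 ^ M)} else {g (real c / 2 ^ M)<..g ((real c + 1) / 2 ^ M)})"
proof -
  note z = dyadic_unit_interval[OF c]
  define p r where "p = g (real c / 2 ^ M)" and "r = g ((real c + 1) / 2 ^ M)"
  have pr: "p \<in> {l..h}" "r \<in> {l..h}"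
    unfolding p_def r_def by (rule g_range[OF z(1)], rule g_range[OF z(2)])
  have "x \<in> piece M c \<longleftrightarrow> x \<in> {l..h} \<and> (c = 0 \<or> p < x) \<and> x \<le> r" for x
  proof (cases "x \<in> {l..h}")
    case True
    have "D x \<le> real c / 2 ^ M \<longleftrightarrow> x \<le> p"
      unfolding p_def by (rule D_le_iff_g[OF True z(1)])
    hence "real c / 2 ^ M < D x \<longleftrightarrow> p < x" by (meson not_le)
    moreover have "D x \<le> (real c + 1) / 2 ^ M \<longleftrightarrow> x \<le> r"
      unfolding r_def by (rule D_le_iff_g[OF True z(2)])
    ultimately show ?thesis using True index_eq_iff[OF True, of M c] by (simp only: piece_def mem_Collect_eq)
  qed (unfold piece_def mem_Collect_eq, blast)
  hence eq: "piece M c = {x. x \<in> {l..h} \<and> (c = 0 \<or> p < x) \<and> x \<le> r}" by blast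
  have "(if c = 0 then {l..g (1 / 2 ^ M)} else {p<..r}) = (if c = 0 then {l..r} else {p<..r})"
    by (simp add: r_def)
  also have "\<dots> = piece M c" unfolding eq using pr by auto
  finally show ?thesis unfolding p_def r_def by simp
qed

lemma piece_measurable: "c < 2 ^ M \<Longrightarrow> piece M c \<in> sets lebesgue"
  by (simp add: piece_eq)

lemma piece_subset: "piece M c \<subseteq> {l..h}"
  by (auto simp: piece_def)

text \<open>The pieces are separated by the dyadic quantiles and have equal mass; hence all grid
  points receive the same weight.\<close>

lemma integral_piece:
  assumes c: "c < 2 ^ M"
  shows "(LINT t:piece M c|lebesgue. f t) = 1 / 2 ^ M"
proof -
  note z = dyadic_unit_interval[OF c]
  show ?thesis
  proof (cases "c = 0")
    case True
    hence "piece M c = {l..g (1 / 2 ^ M)}" using piece_eq[OF c] by simp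
    hence "(LINT t:piece M c|lebesgue. f t) = D (g (1 / 2 ^ M))"
      by (simp only: D_def distr_fun_def)
    thus ?thesis using z(2) True by (simp add: D_g)
  next
    case False
    have "g (real c / 2 ^ M) \<le> g ((real c + 1) / 2 ^ M)"
      using z by (intro g_mono) (auto intro: divide_right_mono)
    moreover have "piece M c = {g (real c / 2 ^ M)<..g ((real c + 1) / 2 ^ M)}"
      using piece_eq[OF c] False by simp
    ultimately have "(LINT t:piece M c|lebesgue. f t) = D (g ((real c + 1) / 2 ^ M)) - D (g (real c / 2 ^ M))"
      using D_diff[of "g (real c / 2 ^ M)" "g ((real c + 1) / 2 ^ M)"] g_range[OF z(1)] g_range[OF z(2)] by simp
    also have "\<dots> = 1 / 2 ^ M" unfolding D_g[OF z(1)] D_g[OF z(2)] by (simp add: diff_divide_distrib[symmetric])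
    finally show ?thesis .
  qed
qed

text \<open>Strict monotonicity of D takes the place of continuity of g: for r < x one has D r < D
  x, and the rounded values, which are within 2^(-M) below D x, eventually exceed D r.\<close>

lemma index_tendsto:
  assumes x: "x \<in> {l..h}"
  shows "(\<lambda>M. g (real (index M x) / 2 ^ M)) \<longlonglongrightarrow> x"
proof -
  let ?z = "\<lambda>M. real (index M x) / 2 ^ M"
  have zr: "?z M \<in> {0..1}" for M using x by (rule index_unit)
  have up: "g (?z M) \<le> x" for M
  proof -
    have "g (?z M) \<le> g (D x)"
      using zr[of M] D_range[OF x] by (intro g_mono index_bounds(1)[OF x]) (simp_all only: atLeastAtMost_iff)
    thus ?thesis by (simp only: g_D[OF x])
  qed
  have "(\<lambda>M. D x - (1 / 2) ^ M) \<longlonglongrightarrow> D x - 0"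
    by (intro tendsto_intros LIMSEQ_realpow_zero) auto
  hence lim: "(\<lambda>M. D x - (1 / 2) ^ M) \<longlonglongrightarrow> D x" by simp
  have low: "D x - (1 / 2) ^ M \<le> ?z M" for M
    using index_bounds(2)[OF x, of M] by (simp add: add_divide_distrib power_divide)
  show ?thesis
  proof (rule order_tendstoI)
    fix r assume r: "r < x"
    show "\<forall>\<^sub>F M in sequentially. r < g (?z M)"
    proof (cases "r < l")
      case True
      have "r < g (?z M)" for M using g_range[OF zr[of M]] True by simp
      thus ?thesis by simp
    next
      case False
      hence rr: "r \<in> {l..h}" using r x by auto
      have "D r < D x" using D_strict[of r x] rr r x by simp
      hence "\<forall>\<^sub>F M in sequentially. D r < D x - (1 / 2) ^ M" by (rule order_tendstoD(1)[OF lim])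
      thus ?thesis
      proof (rule eventually_mono)
        fix M assume "D r < D x - (1 / 2) ^ M"
        hence "D r < ?z M" using low[of M] by linarith
        hence "\<not> D (g (?z M)) \<le> D r" unfolding D_g[OF zr] by simp
        thus "r < g (?z M)" using D_le_iff[OF g_range[OF zr[of M]] rr] by simp
      qed
    qed
  next
    fix r assume "x < r"
    thus "\<forall>\<^sub>F M in sequentially. g (?z M) < r"
      using up by (intro always_eventually allI) (rule le_less_trans)
  qed
qed

end

section \<open>The product measure and dominated convergence\<close>

lemma sigma_finite_lebesgue: "sigma_finite_measure (lebesgue :: real measure)"
proof (rule sigma_finite_measure.intro)
  obtain A :: "real set set" where A: "countable A" "A \<subseteq> sets lborel" "\<Union>A = space lborel" "\<forall>a\<in>A. emeasure lborel a \<noteq> \<infinity>"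
    using lborel.sigma_finite_countable by blast
  show "\<exists>A::real set set. countable A \<and> A \<subseteq> sets lebesgue \<and> \<Union>A = space lebesgue \<and> (\<forall>a\<in>A. emeasure lebesgue a \<noteq> \<infinity>)"
  proof (intro exI[of _ A] conjI ballI)
    show "A \<subseteq> sets lebesgue" using A(2) by auto
    show "emeasure lebesgue a \<noteq> \<infinity>" if "a \<in> A" for a
      using that A by (subst emeasure_completion) auto
  qed (use A in auto)
qed

text \<open>A product of pieces has mass 2^(-M s) under the product density. The grid average is
  thus the integral of a function \<open>h M\<close>, in which F is evaluated at the grid node of
  the box containing x. Pointwise convergence follows from the Lipschitz estimate, and K times the
  product of the absolute densities dominates.\<close>

lemma lattice_average_tendsto_integral:
  fixes a b :: "nat \<Rightarrow> real" and \<phi> :: "nat \<Rightarrow> real \<Rightarrow> real"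
  assumes distr: "\<And>i. i \<in> {1..s} \<Longrightarrow> invertible_distr (a i) (b i) (\<phi> i)"
    and bound: "\<And>x. x \<in> coord_box a b s \<Longrightarrow> \<bar>F x\<bar> \<le> K"
    and lip: "\<And>x x'. x \<in> coord_box a b s \<Longrightarrow> x' \<in> coord_box a b s \<Longrightarrow>
      \<bar>F x - F x'\<bar> \<le> (\<Sum>i\<in>{1..s}. L i * \<bar>x i - x' i\<bar>)"
    and G: "\<And>i. i \<in> {1..s} \<Longrightarrow> G i = the_inv_into {a i..b i} (distr_fun (a i) (\<phi> i))"
  shows "(\<lambda>M. (\<Sum>\<omega>\<in>(\<Pi>\<^sub>E i\<in>{1..s}. {..<2 ^ M}). F (\<lambda>i\<in>{1..s}. G i (real (\<omega> i) / 2 ^ M))) / (2 ^ M) ^ s)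
    \<longlonglongrightarrow> (LINT x:coord_box a b s|Pi\<^sub>M {1..s} (\<lambda>_. lebesgue). F x * (\<Prod>i=1..s. \<phi> i (x i)))"
proof -
  define N :: "(nat \<Rightarrow> real) measure" where "N = Pi\<^sub>M {1..s} (\<lambda>_. lebesgue)"
  define idx where "idx i = invertible_distr.index (a i) (\<phi> i)" for i
  define pc where "pc i = invertible_distr.piece (a i) (b i) (\<phi> i)" for i
  interpret product_sigma_finite "\<lambda>_::nat. lebesgue :: real measure"
    by (rule product_sigma_finite.intro) (rule sigma_finite_lebesgue)
  have G': "G i = invertible_distr.g (a i) (b i) (\<phi> i)" if "i \<in> {1..s}" for i
    using G[OF that] invertible_distr.g_def[OF distr[OF that]] by simp
  define R where "R M x = (\<lambda>i\<in>{1..s}. G i (real (idx i M (x i)) / 2 ^ M))" for M x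
  define h where "h M x = indicator (coord_box a b s) x *\<^sub>R (F (R M x) * (\<Prod>i=1..s. \<phi> i (x i)))" for M x
  let ?lat = "\<lambda>M. \<Pi>\<^sub>E i\<in>{1..s}. {..<2 ^ M :: nat}"
  let ?p = "\<lambda>M \<omega>. \<lambda>i\<in>{1..s}. G i (real (\<omega> i) / 2 ^ M)"
  define q where "q M c i t = indicator (pc i M c) t *\<^sub>R \<phi> i t" for M c i and t :: real
  have box_iff: "x \<in> coord_box a b s \<longleftrightarrow> (\<forall>i\<in>{1..s}. x i \<in> {a i..b i})" if "x \<in> space N" for x
    using that unfolding N_def coord_box_def space_PiM by (auto simp: PiE_iff)
  have in_box: "R M x \<in> coord_box a b s" if "x \<in> coord_box a b s" for M x
    unfolding coord_box_def R_def
  proof (rule restrict_PiE_iff[THEN iffD2], rule ballI)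
    fix i assume i: "i \<in> {1..s}"
    have xi: "x i \<in> {a i..b i}" using that i unfolding coord_box_def by (rule PiE_mem)
    have "real (idx i M (x i)) / 2 ^ M \<in> {0..1}"
      unfolding idx_def by (rule invertible_distr.index_unit[OF distr[OF i] xi])
    thus "G i (real (idx i M (x i)) / 2 ^ M) \<in> {a i..b i}"
      unfolding G'[OF i] by (rule invertible_distr.g_range[OF distr[OF i]])
  qed
  \<comment> \<open>For x in the box exactly one grid vector contributes, the vector of the indices
    of its coordinates. Outside the box all products vanish.\<close>
  have h_sum: "h M x = (\<Sum>\<omega>\<in>?lat M. F (?p M \<omega>) * (\<Prod>i\<in>{1..s}. q M (\<omega> i) i (x i)))" if x: "x \<in> space N" for M x
  proof (cases "x \<in> coord_box a b s")
    case False
    then obtain i where i: "i \<in> {1..s}" "x i \<notin> {a i..b i}" using box_iff[OF x] by blast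
    have "q M c i (x i) = 0" for c
      using i invertible_distr.piece_subset[OF distr[OF i(1)], of M c] unfolding q_def pc_def by (auto simp: indicator_def)
    hence "(\<Prod>i\<in>{1..s}. q M (\<omega> i) i (x i)) = 0" for \<omega>
      by (intro prod_zero bexI[OF _ i(1)]) auto
    hence "(\<Sum>\<omega>\<in>?lat M. F (?p M \<omega>) * (\<Prod>i\<in>{1..s}. q M (\<omega> i) i (x i))) = 0"
      by (simp only: mult_zero_right sum.neutral_const)
    moreover have "h M x = 0" using False by (simp add: h_def)
    ultimately show ?thesis by (simp only:)
  next
    case True
    define w where "w = (\<lambda>i\<in>{1..s}. idx i M (x i))"
    have xi: "x i \<in> {a i..b i}" if "i \<in> {1..s}" for i using True that box_iff[OF x] by blast
    have w: "w \<in> ?lat M"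
      unfolding w_def
    proof (rule restrict_PiE_iff[THEN iffD2], rule ballI)
      fix i assume i: "i \<in> {1..s}"
      show "idx i M (x i) \<in> {..<2 ^ M}"
        unfolding idx_def lessThan_iff by (rule invertible_distr.index_less[OF distr[OF i] xi[OF i]])
    qed
    have qv: "q M c i (x i) = (if idx i M (x i) = c then \<phi> i (x i) else 0)" if i: "i \<in> {1..s}" for c i
      using xi[OF i] unfolding q_def pc_def idx_def invertible_distr.piece_def[OF distr[OF i]] by (auto simp: indicator_def)
    have "(\<Sum>\<omega>\<in>?lat M. F (?p M \<omega>) * (\<Prod>i\<in>{1..s}. q M (\<omega> i) i (x i)))
        = (\<Sum>\<omega>\<in>{w}. F (?p M \<omega>) * (\<Prod>i\<in>{1..s}. q M (\<omega> i) i (x i)))"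
    proof (rule sum.mono_neutral_right)
      show "finite (?lat M)" by (intro finite_PiE) auto
      show "{w} \<subseteq> ?lat M" using w by blast
      show "\<forall>\<omega>\<in>?lat M - {w}. F (?p M \<omega>) * (\<Prod>i\<in>{1..s}. q M (\<omega> i) i (x i)) = 0"
      proof
        fix \<omega> assume \<omega>: "\<omega> \<in> ?lat M - {w}"
        have "\<exists>i\<in>{1..s}. \<omega> i \<noteq> w i"
        proof (rule ccontr)
          assume "\<not> ?thesis"
          hence "\<omega> i = w i" if "i \<in> {1..s}" for i using that by blast
          hence "\<omega> = w" using \<omega> w by (intro PiE_ext[of \<omega> "{1..s}" "\<lambda>_. {..<2 ^ M}" w]) blast+
          thus False using \<omega> by simp
        qed
        then obtain i where i: "i \<in> {1..s}" "\<omega> i \<noteq> idx i M (x i)" unfolding w_def by auto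
        hence "q M (\<omega> i) i (x i) = 0" using qv by auto
        hence "(\<Prod>i\<in>{1..s}. q M (\<omega> i) i (x i)) = 0" by (intro prod_zero bexI[OF _ i(1)]) auto
        thus "F (?p M \<omega>) * (\<Prod>i\<in>{1..s}. q M (\<omega> i) i (x i)) = 0" by simp
      qed
    qed
    also have "\<dots> = F (?p M w) * (\<Prod>i\<in>{1..s}. q M (w i) i (x i))" by simp
    also have "(\<Prod>i\<in>{1..s}. q M (w i) i (x i)) = (\<Prod>i\<in>{1..s}. \<phi> i (x i))"
      by (intro prod.cong refl) (simp add: qv w_def)
    also have "?p M w = R M x" unfolding R_def w_def by (intro restrict_ext) simp
    finally have eq: "(\<Sum>\<omega>\<in>?lat M. F (?p M \<omega>) * (\<Prod>i\<in>{1..s}. q M (\<omega> i) i (x i)))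
        = F (R M x) * (\<Prod>i\<in>{1..s}. \<phi> i (x i))" .
    show ?thesis unfolding h_def indicator_simps(1)[OF True] scaleR_one eq ..
  qed
  have q_int: "integrable lebesgue (q M c i)" if "i \<in> {1..s}" "c < 2 ^ M" for M c i
    using set_integrable_subset[of lebesgue "{a i..b i}" "\<phi> i" "pc i M c"]
      invertible_distr.dens[OF distr[OF that(1)]] invertible_distr.piece_measurable[OF distr[OF that(1)] that(2)]
      invertible_distr.piece_subset[OF distr[OF that(1)], of M c]
    unfolding prob_density_on_def q_def pc_def set_integrable_def by simp
  have prod_int: "integrable N (\<lambda>x. \<Prod>i\<in>{1..s}. q M (\<omega> i) i (x i))" if "\<omega> \<in> ?lat M" for M \<omega>
    unfolding N_def using that by (intro product_integrable_prod q_int) (auto simp: PiE_iff)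
  have prod_val: "(LINT x|N. (\<Prod>i\<in>{1..s}. q M (\<omega> i) i (x i))) = 1 / (2 ^ M) ^ s" if \<omega>: "\<omega> \<in> ?lat M" for M \<omega>
  proof -
    have \<omega>i: "\<omega> i < 2 ^ M" if "i \<in> {1..s}" for i using \<omega> that by (auto simp: PiE_iff)
    have "(LINT x|N. (\<Prod>i\<in>{1..s}. q M (\<omega> i) i (x i))) = (\<Prod>i\<in>{1..s}. (LINT t|lebesgue. q M (\<omega> i) i t))"
      unfolding N_def using \<omega>i by (intro product_integral_prod q_int) auto
    also have "\<dots> = (\<Prod>i\<in>{1..s}. 1 / 2 ^ M)"
    proof (rule prod.cong[OF refl])
      fix i assume i: "i \<in> {1..s}"
      show "(LINT t|lebesgue. q M (\<omega> i) i t) = 1 / 2 ^ M"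
        using invertible_distr.integral_piece[OF distr[OF i] \<omega>i[OF i]]
        unfolding q_def pc_def set_lebesgue_integral_def .
    qed
    finally show ?thesis by (simp add: power_divide)
  qed
  have h_int: "integrable N (h M)" for M
  proof -
    have "integrable N (\<lambda>x. \<Sum>\<omega>\<in>?lat M. F (?p M \<omega>) * (\<Prod>i\<in>{1..s}. q M (\<omega> i) i (x i)))"
      by (intro Bochner_Integration.integrable_sum integrable_mult_right prod_int)
    thus ?thesis using h_sum by (subst Bochner_Integration.integrable_cong[OF refl]) auto
  qed
  have h_val: "(LINT x|N. h M x) = (\<Sum>\<omega>\<in>?lat M. F (?p M \<omega>)) / (2 ^ M) ^ s" for M
  proof -
    have "(LINT x|N. h M x) = (LINT x|N. (\<Sum>\<omega>\<in>?lat M. F (?p M \<omega>) * (\<Prod>i\<in>{1..s}. q M (\<omega> i) i (x i))))"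
      by (intro Bochner_Integration.integral_cong refl h_sum)
    also have "\<dots> = (\<Sum>\<omega>\<in>?lat M. (LINT x|N. F (?p M \<omega>) * (\<Prod>i\<in>{1..s}. q M (\<omega> i) i (x i))))"
      by (intro Bochner_Integration.integral_sum integrable_mult_right prod_int)
    also have "\<dots> = (\<Sum>\<omega>\<in>?lat M. F (?p M \<omega>) * (1 / (2 ^ M) ^ s))"
    proof (rule sum.cong[OF refl])
      fix \<omega> assume \<omega>: "\<omega> \<in> ?lat M"
      show "(LINT x|N. F (?p M \<omega>) * (\<Prod>i\<in>{1..s}. q M (\<omega> i) i (x i))) = F (?p M \<omega>) * (1 / (2 ^ M) ^ s)"
        unfolding prod_val[OF \<omega>, symmetric] by (rule integral_mult_right_zero)
    qed
    finally show ?thesis by (simp only: sum_divide_distrib times_divide_eq_right mult_1_right)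
  qed
  define H where "H x = indicator (coord_box a b s) x *\<^sub>R (F x * (\<Prod>i=1..s. \<phi> i (x i)))" for x
  have lim: "(\<lambda>M. h M x) \<longlonglongrightarrow> H x" for x
  proof (cases "x \<in> coord_box a b s")
    case False
    thus ?thesis unfolding h_def H_def by simp
  next
    case True
    have "(\<lambda>M. \<Sum>i\<in>{1..s}. L i * \<bar>R M x i - x i\<bar>) \<longlonglongrightarrow> (\<Sum>i\<in>{1..s}. L i * \<bar>x i - x i\<bar>)"
    proof (intro tendsto_sum tendsto_mult tendsto_const tendsto_rabs tendsto_diff)
      fix i assume i: "i \<in> {1..s}"
      have xi: "x i \<in> {a i..b i}" using True i unfolding coord_box_def by (rule PiE_mem)
      show "(\<lambda>M. R M x i) \<longlonglongrightarrow> x i"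
        using invertible_distr.index_tendsto[OF distr[OF i] xi] i unfolding R_def idx_def G'[OF i, symmetric] by simp
    qed
    hence "(\<lambda>M. \<Sum>i\<in>{1..s}. L i * \<bar>R M x i - x i\<bar>) \<longlonglongrightarrow> 0" by simp
    hence "(\<lambda>M. F (R M x) - F x) \<longlonglongrightarrow> 0"
      by (rule Lim_null_comparison[rotated]) (use lip[OF in_box[OF True] True] in auto)
    hence "(\<lambda>M. F (R M x)) \<longlonglongrightarrow> F x" by (rule LIM_zero_cancel)
    thus ?thesis unfolding h_def H_def by (intro tendsto_intros)
  qed
  have "(\<lambda>M. LINT x|N. h M x) \<longlonglongrightarrow> (LINT x|N. H x)"
  proof (rule integral_dominated_convergence)
    show hm: "h M \<in> borel_measurable N" for M using h_int by (rule borel_measurable_integrable)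
    \<comment> \<open>The integrand is measurable as a pointwise limit of the functions
      \<open>h M\<close>, which are finite sums of integrable products.\<close>
    show "H \<in> borel_measurable N" by (rule borel_measurable_LIMSEQ_metric[OF hm]) (rule lim)
    define W where "W i t = \<bar>indicator {a i..b i} t *\<^sub>R \<phi> i t\<bar>" for i and t :: real
    show "integrable N (\<lambda>x. K * (\<Prod>i\<in>{1..s}. W i (x i)))"
      unfolding N_def
    proof (intro integrable_mult_right product_integrable_prod)
      fix i assume "i \<in> {1..s}"
      thus "integrable lebesgue (W i)"
        using invertible_distr.dens[OF distr] unfolding W_def prob_density_on_def set_integrable_def by auto
    qed simp
    show "AE x in N. (\<lambda>M. h M x) \<longlonglongrightarrow> H x" using lim by simp
    show "AE x in N. norm (h M x) \<le> K * (\<Prod>i\<in>{1..s}. W i (x i))" for M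
    proof (rule AE_I2)
      fix x assume "x \<in> space N"
      show "norm (h M x) \<le> K * (\<Prod>i\<in>{1..s}. W i (x i))"
      proof (cases "x \<in> coord_box a b s")
        case True
        have xi: "x i \<in> {a i..b i}" if "i \<in> {1..s}" for i using True that unfolding coord_box_def by (rule PiE_mem)
        have "norm (h M x) = \<bar>F (R M x)\<bar> * (\<Prod>i\<in>{1..s}. \<bar>\<phi> i (x i)\<bar>)"
          using True unfolding h_def by (simp add: abs_mult abs_prod)
        also have "(\<Prod>i\<in>{1..s}. \<bar>\<phi> i (x i)\<bar>) = (\<Prod>i\<in>{1..s}. W i (x i))"
          using xi by (intro prod.cong refl) (simp add: W_def)
        also have "\<bar>F (R M x)\<bar> * \<dots> \<le> K * \<dots>"
          using bound[OF in_box[OF True]] by (intro mult_right_mono prod_nonneg) (auto simp: W_def)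
        finally show ?thesis .
      next
        case False
        then obtain i where i: "i \<in> {1..s}" "x i \<notin> {a i..b i}" using box_iff[OF \<open>x \<in> space N\<close>] by blast
        hence "W i (x i) = 0" by (simp add: W_def)
        hence "(\<Prod>i\<in>{1..s}. W i (x i)) = 0" by (intro prod_zero bexI[OF _ i(1)]) auto
        moreover have "h M x = 0" using False by (simp add: h_def)
        ultimately show ?thesis by (simp only: norm_zero mult_zero_right order_refl)
      qed
    qed
  qed
  thus ?thesis unfolding h_val unfolding H_def N_def set_lebesgue_integral_def .
qed

section \<open>Hoelder inequality and the final estimates\<close>

lemma ennreal_powr_ennreal: "0 \<le> x \<Longrightarrow> ennreal_powr (ennreal x) r = ennreal (x powr r)"
  by (simp add: ennreal_powr_def)

lemma ennreal_powr_le_1_iff: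
  assumes "0 < r" shows "ennreal_powr x r \<le> 1 \<longleftrightarrow> x \<le> 1"
proof (cases x)
  case (real t)
  have "t powr r \<le> 1 \<longleftrightarrow> t \<le> 1"
    using real assms powr_mono2[of r t 1] powr_less_mono2[of r 1 t] by (auto simp: not_le[symmetric])
  thus ?thesis using real by (simp add: ennreal_powr_ennreal)
qed (simp add: ennreal_powr_def top_unique)

lemma one_divide_ennreal: "1 \<le> r \<Longrightarrow> 1 / ennreal r = ennreal (1 / r)"
  using divide_ennreal[of 1 r] by simp

lemma ennreal_conjugate_cases:
  fixes p q :: ennreal
  assumes "1 \<le> p" "1 \<le> q" "1 / p + 1 / q = 1"
  obtains "p = \<infinity>" "q = 1" | "p = 1" "q = \<infinity>"
  | P Q where "p = ennreal P" "q = ennreal Q" "1 < P" "1 < Q" "1 / P + 1 / Q = (1 :: real)"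
proof (cases p)
  case top
  hence q1: "1 / q = 1" using assms(3) by simp
  have "q = 1"
  proof (cases q)
    case top
    thus ?thesis using q1 by simp
  next
    case (real r)
    hence r: "1 \<le> r" using assms(2) by (simp add: ennreal_ge_1)
    have "ennreal (1 / r) = 1" using q1 real one_divide_ennreal[OF r] by (simp only:)
    hence "1 / r = 1" by (simp only: ennreal_eq_1)
    hence "r = 1" using r by (simp add: divide_eq_eq)
    thus ?thesis using real by simp
  qed
  thus ?thesis using that(1) top by simp
next
  case (real P)
  have P1: "1 \<le> P" using real assms(1) by (simp add: ennreal_ge_1)
  have ip: "1 / p = ennreal (1 / P)"
    unfolding real(2) by (rule one_divide_ennreal[OF P1])
  show ?thesis
  proof (cases q)
    case top
    hence "1 / p + 1 / q = 1 / p" by simp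
    hence "ennreal (1 / P) = 1" using assms(3) ip by (simp only:)
    hence "1 / P = 1" by (simp only: ennreal_eq_1)
    hence "P = 1" using P1 by (simp add: divide_eq_eq)
    thus ?thesis using that(2) top real by simp
  next
    case q: (real Q)
    have Q1: "1 \<le> Q" using q assms(2) by (simp add: ennreal_ge_1)
    have iq: "1 / q = ennreal (1 / Q)"
      unfolding q(2) by (rule one_divide_ennreal[OF Q1])
    have nn: "0 \<le> 1 / P" "0 \<le> 1 / Q" using P1 Q1 by auto
    have "ennreal (1 / P + 1 / Q) = 1"
      using assms(3) unfolding ip iq ennreal_plus[OF nn, symmetric] .
    hence eq: "1 / P + 1 / Q = 1" by (simp only: ennreal_eq_1)
    have "1 / P > 0" "1 / Q > 0" using P1 Q1 by auto
    hence "1 / P < 1" "1 / Q < 1" using eq by linarith+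
    hence "1 < P" "1 < Q" using P1 Q1 by (auto simp: divide_less_eq)
    thus ?thesis using that(3) real q eq by blast
  qed
qed

lemma lp_sum_cong:
  assumes "\<And>i. i \<in> I \<Longrightarrow> f i = g i"
  shows "lp_sum p I f = lp_sum p I g"
proof -
  have "f ` I = g ` I" using assms by (rule image_cong[OF refl])
  moreover have "(\<Sum>i\<in>I. ennreal_powr (f i) r) = (\<Sum>i\<in>I. ennreal_powr (g i) r)" for r
    by (rule sum.cong[OF refl]) (simp only: assms)
  ultimately show ?thesis by (simp only: lp_sum_def)
qed

lemma lp_sum_real:
  assumes "\<And>i. i \<in> I \<Longrightarrow> 0 \<le> x i" "1 \<le> P"
  shows "lp_sum (ennreal P) I (\<lambda>i. ennreal (x i)) = ennreal ((\<Sum>i\<in>I. x i powr P) powr (1 / P))"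
proof -
  have "(\<Sum>i\<in>I. ennreal_powr (ennreal (x i)) P) = ennreal (\<Sum>i\<in>I. x i powr P)"
    using assms by (simp add: ennreal_powr_ennreal)
  thus ?thesis using assms by (simp add: lp_sum_def ennreal_powr_ennreal sum_nonneg)
qed

lemma lp_sum_le_1:
  assumes "finite I" "1 \<le> p" "lp_sum p I f \<le> 1" "i \<in> I"
  shows "f i \<le> 1"
proof (cases "p = \<infinity>")
  case True
  hence "Max (f ` I) \<le> 1" using assms by (simp add: lp_sum_def)
  moreover have "f i \<le> Max (f ` I)" using assms by (intro Max_ge) auto
  ultimately show ?thesis by (rule order.trans[rotated])
next
  case False
  then obtain P where P: "p = ennreal P" "P \<ge> 1"
    using assms(2) by (cases p) (auto simp: ennreal_ge_1)
  have "ennreal_powr (\<Sum>i\<in>I. ennreal_powr (f i) P) (1 / P) \<le> 1"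
    using assms(3) P False by (simp add: lp_sum_def)
  hence "(\<Sum>i\<in>I. ennreal_powr (f i) P) \<le> 1"
    using P(2) by (subst (asm) ennreal_powr_le_1_iff) auto
  moreover have "ennreal_powr (f i) P \<le> (\<Sum>i\<in>I. ennreal_powr (f i) P)"
    using assms by (intro member_le_sum) auto
  ultimately have "ennreal_powr (f i) P \<le> 1" by (rule order.trans[rotated])
  thus ?thesis using P(2) by (subst (asm) ennreal_powr_le_1_iff) auto
qed

text \<open>The norm runs over all of \<open>I\<close>, here every subset of the coordinates, the
  pairing only over \<open>J\<close>, which leaves out the empty set. Dropping terms only decreases
  the norm of x. For finite exponents above 1, z is divided by its norm \<open>T\<close> and Young's
  inequality is applied to each term.\<close>

lemma hoelder_lp_sum:
  fixes p q :: ennreal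
  assumes I: "finite I" and J: "J \<subseteq> I" "J \<noteq> {}"
    and pq: "1 \<le> p" "1 \<le> q" "1 / p + 1 / q = 1"
    and x: "\<And>i. i \<in> I \<Longrightarrow> 0 \<le> x i" and z: "\<And>i. i \<in> J \<Longrightarrow> 0 \<le> z i"
    and norm: "lp_sum p I (\<lambda>i. ennreal (x i)) \<le> 1"
  shows "ennreal (\<Sum>i\<in>J. x i * z i) \<le> lp_sum q J (\<lambda>i. ennreal (z i))"
proof -
  have finJ: "finite J" by (rule finite_subset[OF J(1) I])
  have xJ: "0 \<le> x i" if "i \<in> J" for i using x that J by auto
  have x1: "x i \<le> 1" if "i \<in> J" for i
  proof -
    have "ennreal (x i) \<le> 1" using lp_sum_le_1[OF I pq(1) norm] that J by auto
    thus ?thesis by simp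
  qed
  from pq show ?thesis
  proof (cases rule: ennreal_conjugate_cases)
    case 1
    have "(\<Sum>i\<in>J. x i * z i) \<le> (\<Sum>i\<in>J. 1 * z i)"
      using x1 z by (intro sum_mono mult_right_mono) auto
    moreover have "lp_sum q J (\<lambda>i. ennreal (z i)) = ennreal (\<Sum>i\<in>J. z i)"
      using lp_sum_real[of J z 1] z 1 by (simp add: sum_nonneg)
    ultimately show ?thesis by (simp add: ennreal_leI)
  next
    case 2
    have "lp_sum p I (\<lambda>i. ennreal (x i)) = ennreal (\<Sum>i\<in>I. x i)"
      using lp_sum_real[of I x 1] x 2 by (simp add: sum_nonneg)
    hence sI: "(\<Sum>i\<in>I. x i) \<le> 1" using norm by simp
    have "(\<Sum>i\<in>J. x i) \<le> (\<Sum>i\<in>I. x i)" using I J x by (intro sum_mono2) auto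
    hence sJ: "(\<Sum>i\<in>J. x i) \<le> 1" using sI by simp
    define Z where "Z = Max (z ` J)"
    have zZ: "z i \<le> Z" if "i \<in> J" for i unfolding Z_def using finJ that by (intro Max_ge) auto
    have Zin: "Z \<in> z ` J" unfolding Z_def using finJ J by (intro Max_in) auto
    hence Z0: "0 \<le> Z" using z by auto
    have "(\<Sum>i\<in>J. x i * z i) \<le> (\<Sum>i\<in>J. x i * Z)"
      using xJ zZ by (intro sum_mono mult_left_mono) auto
    also have "\<dots> = (\<Sum>i\<in>J. x i) * Z" by (rule sum_distrib_right[symmetric])
    also have "\<dots> \<le> 1 * Z" using sJ Z0 by (rule mult_right_mono)
    finally have "(\<Sum>i\<in>J. x i * z i) \<le> Z" by simp
    hence "ennreal (\<Sum>i\<in>J. x i * z i) \<le> ennreal Z" by (rule ennreal_leI)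
    also have "ennreal Z \<le> Max ((\<lambda>i. ennreal (z i)) ` J)" using finJ Zin by (intro Max_ge) auto
    finally show ?thesis using 2 by (simp add: lp_sum_def)
  next
    case (3 P Q)
    have PQ: "1 \<le> P" "1 \<le> Q" using 3 by auto
    have "(\<Sum>i\<in>I. x i powr P) powr (1 / P) \<le> 1"
      using norm unfolding 3(1) by (subst (asm) lp_sum_real[OF x PQ(1)]) auto
    hence "ennreal_powr (ennreal (\<Sum>i\<in>I. x i powr P)) (1 / P) \<le> 1"
      by (simp add: ennreal_powr_ennreal sum_nonneg)
    hence sI: "(\<Sum>i\<in>I. x i powr P) \<le> 1"
      using PQ by (subst (asm) ennreal_powr_le_1_iff) auto
    have "(\<Sum>i\<in>J. x i powr P) \<le> (\<Sum>i\<in>I. x i powr P)" using I J by (intro sum_mono2) auto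
    hence sJ: "(\<Sum>i\<in>J. x i powr P) \<le> 1" using sI by simp
    define S where "S = (\<Sum>i\<in>J. z i powr Q)"
    define T where "T = S powr (1 / Q)"
    have S0: "0 \<le> S" unfolding S_def by (intro sum_nonneg) auto
    have "(\<Sum>i\<in>J. x i * z i) \<le> T"
    \<comment> \<open>If S is zero, all z vanish and \<open>T\<close> could not be used as a
      divisor.\<close>
    proof (cases "S = 0")
      case True
      hence "\<forall>i\<in>J. z i powr Q = 0" unfolding S_def using finJ by (subst (asm) sum_nonneg_eq_0_iff) auto
      hence "(\<Sum>i\<in>J. x i * z i) = 0" by (intro sum.neutral) auto
      thus ?thesis by (simp add: T_def)
    next
      case False
      hence T0: "0 < T" unfolding T_def using S0 by simp
      have TQ: "T powr Q = S" unfolding T_def using S0 PQ by (simp add: powr_powr)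
      have "(\<Sum>i\<in>J. x i * (z i / T)) \<le> (\<Sum>i\<in>J. x i powr P / P + (z i / T) powr Q / Q)"
        using 3 xJ z T0 by (intro sum_mono Youngs_inequality) auto
      also have "\<dots> = (\<Sum>i\<in>J. x i powr P) / P + (\<Sum>i\<in>J. z i powr Q / S) / Q"
        using z T0 by (simp add: sum.distrib sum_divide_distrib powr_divide TQ)
      also have "(\<Sum>i\<in>J. z i powr Q / S) = 1" using False by (simp add: S_def sum_divide_distrib[symmetric])
      also have "(\<Sum>i\<in>J. x i powr P) / P + 1 / Q \<le> 1 / P + 1 / Q"
        using sJ PQ by (intro add_right_mono divide_right_mono) auto
      finally have "(\<Sum>i\<in>J. x i * (z i / T)) \<le> 1" using 3 by simp
      moreover have "(\<Sum>i\<in>J. x i * (z i / T)) = (\<Sum>i\<in>J. x i * z i) / T"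
        by (simp add: sum_divide_distrib)
      ultimately show ?thesis using T0 by (simp add: divide_le_eq)
    qed
    moreover have "lp_sum q J (\<lambda>i. ennreal (z i)) = ennreal T"
      unfolding 3(2) T_def S_def by (rule lp_sum_real[OF z PQ(2)])
    ultimately show ?thesis by (simp only: ennreal_leI)
  qed
qed

section \<open>Inequalities behind the constants\<close>

text \<open>The k-th power of e x \<le> exp x at x = \<delta> m ln 2 / k. Equality holds at x = 1,
  that is m = k / (\<delta> ln 2), whence the shape of the constant in (i).\<close>

lemma power_le_exp_times:
  fixes \<delta> :: real
  assumes "0 < \<delta>" "1 \<le> k"
  shows "real m ^ k \<le> 2 powr (\<delta> * real m) * (real k / (exp 1 * \<delta> * ln 2)) ^ k"
proof -
  define x where "x = \<delta> * real m * ln 2 / real k"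
  have ln2: "ln (2::real) > 0" by simp
  have c: "0 < real k / (exp 1 * \<delta> * ln 2)" using assms ln2 by simp
  have "x \<le> exp (x - 1)" using exp_ge_add_one_self[of "x - 1"] by simp
  hence "exp 1 * x \<le> exp x" by (simp add: exp_diff field_simps)
  moreover have x0: "0 \<le> x" unfolding x_def using assms by simp
  ultimately have "(exp 1 * x) ^ k \<le> exp x ^ k" by (intro power_mono) auto
  also have "exp x ^ k = exp (real k * x)" by (rule exp_of_nat_mult[symmetric])
  also have "\<dots> = 2 powr (\<delta> * real m)" using assms by (simp add: x_def powr_def)
  finally have le: "(exp 1 * x) ^ k \<le> 2 powr (\<delta> * real m)" .
  have "real m = (exp 1 * x) * (real k / (exp 1 * \<delta> * ln 2))" using assms ln2 by (simp add: x_def)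
  hence "real m ^ k = (exp 1 * x) ^ k * (real k / (exp 1 * \<delta> * ln 2)) ^ k"
    by (metis power_mult_distrib)
  also have "\<dots> \<le> 2 powr (\<delta> * real m) * (real k / (exp 1 * \<delta> * ln 2)) ^ k"
    using le c by (intro mult_right_mono zero_le_power) auto
  finally show ?thesis .
qed

text \<open>Build u by adding its elements in increasing order. When j is added, the set present is
  contained in {1..j - 1}, so its ratio is among those over which the maximum is taken.\<close>

lemma weight_le_prod_ratios:
  fixes \<gamma> :: "nat set \<Rightarrow> real"
  assumes pos: "\<And>u. finite u \<Longrightarrow> u \<subseteq> {1..} \<Longrightarrow> 0 < \<gamma> u" and one: "\<gamma> {} = 1"
    and u: "finite u" "u \<subseteq> {1..}"
  shows "\<gamma> u \<le> (\<Prod>i\<in>u. Max ((\<lambda>v. \<gamma> (v \<union> {i}) / \<gamma> v) ` Pow {1..i - 1}))"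
  using u
proof (induction u rule: finite_linorder_max_induct)
  case empty
  thus ?case using one by simp
next
  case (insert j A)
  let ?r = "\<lambda>i. Max ((\<lambda>v. \<gamma> (v \<union> {i}) / \<gamma> v) ` Pow {1..i - 1})"
  have A: "A \<subseteq> {1..}" "j \<notin> A" using insert by auto
  have "A \<in> Pow {1..j - 1}" using insert.hyps(2) A by force
  hence "\<gamma> (A \<union> {j}) / \<gamma> A \<le> ?r j" by (intro Max_ge) auto
  hence "\<gamma> (insert j A) \<le> ?r j * \<gamma> A"
    using pos[OF insert.hyps(1) A(1)] by (simp add: divide_le_eq)
  also have "\<dots> \<le> ?r j * (\<Prod>i\<in>A. ?r i)"
  proof (rule mult_left_mono)
    show "\<gamma> A \<le> (\<Prod>i\<in>A. ?r i)" using insert A by auto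
    have "0 < \<gamma> (A \<union> {j}) / \<gamma> A"
      using pos[OF insert.hyps(1) A(1)] pos[of "A \<union> {j}"] insert by auto
    thus "0 \<le> ?r j" using \<open>\<gamma> (A \<union> {j}) / \<gamma> A \<le> ?r j\<close> by linarith
  qed
  finally show ?case using insert.hyps A by simp
qed

text \<open>Beyond k the terms add up to at most c. For the factors up to k, X \<ge> 1 gives 1 + t
  \<le> X (1 + t / X) \<le> X exp(t / X), and division by X brings the total of all terms down to c
  as well. Each group costs exp(c y); at most k factors X occur, also when s is smaller than
  k.\<close>

lemma prod_one_plus_bound:
  fixes T :: "nat \<Rightarrow> real" and c X :: real
  assumes T0: "\<And>i. i \<ge> 1 \<Longrightarrow> 0 \<le> T i" and sum: "T summable_on {1..}"
    and c: "0 < c" and X: "X = infsum T {1..} / c" "1 \<le> X" and tail: "infsum T {k + 1..} \<le> c"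
    and y: "0 \<le> y"
  shows "(\<Prod>i\<in>{1..s}. 1 + y * T i) \<le> X ^ k * exp (2 * c * y)"
proof -
  have sub: "T summable_on {k + 1..}" by (rule summable_on_subset_banach[OF sum]) auto
  define A1 A2 where "A1 = {1..s} \<inter> {..k}" and "A2 = {1..s} \<inter> {k + 1..}"
  have split: "{1..s} = A1 \<union> A2" "A1 \<inter> A2 = {}" by (auto simp: A1_def A2_def)
  have fin: "finite A1" "finite A2" by (auto simp: A1_def A2_def)
  have card1: "card A1 \<le> k"
  proof -
    have "card A1 \<le> card {1..k}" unfolding A1_def by (intro card_mono) auto
    thus ?thesis by simp
  qed
  have "(\<Prod>i\<in>A2. 1 + y * T i) \<le> (\<Prod>i\<in>A2. exp (y * T i))"
    using T0 y by (intro prod_mono conjI exp_ge_add_one_self add_nonneg_nonneg mult_nonneg_nonneg) (auto simp: A2_def)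
  also have "\<dots> = exp (y * sum T A2)" using fin by (simp add: exp_sum sum_distrib_left)
  also have "\<dots> \<le> exp (y * c)"
  proof -
    have "sum T A2 \<le> infsum T {k + 1..}"
      using T0 by (intro finite_sum_le_infsum sub fin) (auto simp: A2_def)
    thus ?thesis using tail y by (simp add: mult_left_mono)
  qed
  finally have P2: "(\<Prod>i\<in>A2. 1 + y * T i) \<le> exp (y * c)" .
  have fac: "1 + y * T i \<le> X * exp (y * T i / X)" if "i \<in> A1" for i
  proof -
    have "1 + y * T i / X \<le> exp (y * T i / X)" by (rule exp_ge_add_one_self)
    hence "X * (1 + y * T i / X) \<le> X * exp (y * T i / X)" using X(2) by (intro mult_left_mono) auto
    moreover have "X * (1 + y * T i / X) = X + y * T i" using X(2) by (simp add: field_simps)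
    ultimately show ?thesis using X(2) by linarith
  qed
  have "(\<Prod>i\<in>A1. 1 + y * T i) \<le> (\<Prod>i\<in>A1. X * exp (y * T i / X))"
    using T0 y by (intro prod_mono conjI fac add_nonneg_nonneg mult_nonneg_nonneg) (auto simp: A1_def)
  also have "\<dots> = X ^ card A1 * exp (y * sum T A1 / X)"
    using fin by (simp add: prod.distrib exp_sum sum_distrib_left sum_divide_distrib)
  also have "\<dots> \<le> X ^ k * exp (y * c)"
  proof (intro mult_mono)
    show "X ^ card A1 \<le> X ^ k" using X(2) card1 by (intro power_increasing) auto
    have "sum T A1 \<le> infsum T {1..}"
      using T0 by (intro finite_sum_le_infsum sum fin) (auto simp: A1_def)
    also have "infsum T {1..} = X * c" using X(1) c by simp
    finally have "sum T A1 / X \<le> c" using X(2) by (simp add: divide_le_eq mult.commute)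
    hence "y * (sum T A1 / X) \<le> y * c" using y by (rule mult_left_mono)
    thus "exp (y * sum T A1 / X) \<le> exp (y * c)" by simp
  qed (use X(2) in auto)
  finally have P1: "(\<Prod>i\<in>A1. 1 + y * T i) \<le> X ^ k * exp (y * c)" .
  have "(\<Prod>i\<in>{1..s}. 1 + y * T i) = (\<Prod>i\<in>A1. 1 + y * T i) * (\<Prod>i\<in>A2. 1 + y * T i)"
    unfolding split(1) by (rule prod.union_disjoint[OF fin split(2)])
  also have "\<dots> \<le> (X ^ k * exp (y * c)) * exp (y * c)"
    using T0 y X(2) by (intro mult_mono P1 P2 prod_nonneg add_nonneg_nonneg mult_nonneg_nonneg) (auto simp: A2_def)
  also have "\<dots> = X ^ k * exp (2 * c * y)" by (simp add: mult_exp_exp[symmetric] exp_add[symmetric] algebra_simps)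
  finally show ?thesis .
qed

section \<open>From a single integrand to the worst case\<close>

text \<open>Let M tend to infinity in the comparison with the grid, whose bound is uniform in M, and
  insert the estimate for the degrees of the irreducible polynomials.\<close>

lemma quadrature_error:
  fixes a b :: "nat \<Rightarrow> real" and \<phi> :: "nat \<Rightarrow> real \<Rightarrow> real"
  assumes ab: "\<And>i. i \<ge> 1 \<Longrightarrow> a i < b i"
    and dens: "\<And>i. i \<ge> 1 \<Longrightarrow> prob_density_on (a i) (b i) (\<phi> i)"
    and bij: "\<And>i. i \<ge> 1 \<Longrightarrow> bij_betw (distr_fun (a i) (\<phi> i)) {a i..b i} {0..1}"
    and P: "irreducible_listing P" and \<rho>: "row_numerators P \<rho>"
    and y: "y = digital_net m (nied_matrix P \<rho> m)" and m: "m \<ge> 1"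
    and F: "has_mixed_partials a b s F"
    and B: "\<And>u x. u \<subseteq> {1..s} \<Longrightarrow> x \<in> coord_box a b s \<Longrightarrow> \<bar>mixed_partial a b u F x\<bar> \<le> B u"
  shows "\<bar>(\<Sum>n<2 ^ m. F (inv_distr a b \<phi> s (y n))) / 2 ^ m
      - (LINT x:coord_box a b s|Pi\<^sub>M {1..s} (\<lambda>_. lebesgue). F x * (\<Prod>i=1..s. \<phi> i (x i)))\<bar>
    \<le> (\<Sum>u\<in>Pow {1..s} - {{}}. B u * (\<Prod>i\<in>u. 8 * real m * (real i * log 2 (real i + 2) * (b i - a i)))) / 2 ^ m"
    (is "\<bar>?Q - ?I\<bar> \<le> ?E")
proof -
  define G where "G i = the_inv_into {a i..b i} (distr_fun (a i) (\<phi> i))" for i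
  have distr: "invertible_distr (a i) (b i) (\<phi> i)" if "i \<in> {1..s}" for i
    using that by (intro invertible_distr.intro dens bij) auto
  have G: "G i = invertible_distr.g (a i) (b i) (\<phi> i)" if "i \<in> {1..s}" for i
    unfolding G_def invertible_distr.g_def[OF distr[OF that]] ..
  interpret net_quadrature P \<rho> m y a b s G F B
  proof
    fix i x x' assume i: "i \<in> {1..s}" and x: "0 \<le> (x::real)" "x \<le> x'" "x' \<le> 1"
    show "G i x \<le> G i x'" unfolding G[OF i] by (rule invertible_distr.g_mono[OF distr[OF i] x])
  next
    fix i x assume i: "i \<in> {1..s}" and x: "0 \<le> (x::real)" "x \<le> 1"
    show "G i x \<in> {a i..b i}"
      unfolding G[OF i] by (rule invertible_distr.g_range[OF distr[OF i]]) (simp add: x)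
  qed (fact P \<rho> y F B)+
  have Q: "?Q = (\<Sum>n<2 ^ m. f (y n)) / 2 ^ m"
    unfolding f_def inv_distr_def G_def ..
  let ?L = "\<lambda>M. (\<Sum>\<omega>\<in>lattice M. f (\<lambda>i. real (\<omega> i) / 2 ^ M)) / (2 ^ M) ^ s"
  have lim: "?L \<longlonglongrightarrow> ?I"
    unfolding f_def
  proof (rule lattice_average_tendsto_integral[OF distr _ _ G_def])
    fix x assume "x \<in> coord_box a b s"
    from B[of "{}", OF _ this] show "\<bar>F x\<bar> \<le> B {}" by (simp add: mixed_partial_def)
  next
    fix x x' assume "x \<in> coord_box a b s" "x' \<in> coord_box a b s"
    thus "\<bar>F x - F x'\<bar> \<le> (\<Sum>i\<in>{1..s}. B {i} * \<bar>x i - x' i\<bar>)"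
      by (intro mixed_partials_lipschitz[OF F] B) auto
  qed
  let ?bd = "(\<Sum>u\<in>Pow {1..s} - {{}}. B u * (\<Prod>i\<in>u. (b i - a i) * 2 ^ (e i - 1) * (real m + 1))) / 2 ^ m"
  have "(\<lambda>M. \<bar>?Q - ?L M\<bar>) \<longlonglongrightarrow> \<bar>?Q - ?I\<bar>"
    by (intro tendsto_rabs tendsto_diff tendsto_const lim)
  hence "\<bar>?Q - ?I\<bar> \<le> ?bd"
  proof (rule LIMSEQ_le_const2)
    show "\<exists>N. \<forall>M\<ge>N. \<bar>?Q - ?L M\<bar> \<le> ?bd"
      unfolding Q using net_vs_lattice by blast
  qed
  also have "?bd \<le> ?E"
  proof -
    have "B u * (\<Prod>i\<in>u. (b i - a i) * 2 ^ (e i - 1) * (real m + 1))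
        \<le> B u * (\<Prod>i\<in>u. 8 * real m * (real i * log 2 (real i + 2) * (b i - a i)))"
      if u: "u \<in> Pow {1..s} - {{}}" for u
    proof (rule mult_left_mono)
      show "0 \<le> B u" using u by (intro B_nonneg) auto
      show "(\<Prod>i\<in>u. (b i - a i) * 2 ^ (e i - 1) * (real m + 1))
        \<le> (\<Prod>i\<in>u. 8 * real m * (real i * log 2 (real i + 2) * (b i - a i)))"
      proof (rule prod_mono)
        fix i assume "i \<in> u"
        hence i: "i \<ge> 1" using u by auto
        have w: "0 \<le> b i - a i" using ab[OF i] by simp
        \<comment> \<open>Halving 2^(e i) \<le> 8 i ld (i + 2) leaves the constant 4, and m + 1
          \<le> 2 m, valid as m \<ge> 1, restores 8.\<close>
        have "(2::real) ^ e i = 2 * 2 ^ (e i - 1)" using e_pos[OF i] by (simp flip: power_Suc)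
        hence "2 ^ (e i - 1) \<le> 4 * (real i * log 2 (real i + 2))"
          using two_power_degree_le[OF P i] unfolding e_def by simp
        hence "2 ^ (e i - 1) * (real m + 1) \<le> 4 * (real i * log 2 (real i + 2)) * (2 * real m)"
          using m by (intro mult_mono) auto
        hence "(b i - a i) * (2 ^ (e i - 1) * (real m + 1)) \<le> (b i - a i) * (4 * (real i * log 2 (real i + 2)) * (2 * real m))"
          using w by (rule mult_left_mono)
        hence "(b i - a i) * 2 ^ (e i - 1) * (real m + 1) \<le> 8 * real m * (real i * log 2 (real i + 2) * (b i - a i))"
          by (simp add: mult_ac)
        moreover have "0 \<le> (b i - a i) * 2 ^ (e i - 1) * (real m + 1)" using w by simp
        ultimately show "0 \<le> (b i - a i) * 2 ^ (e i - 1) * (real m + 1) \<and>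
            (b i - a i) * 2 ^ (e i - 1) * (real m + 1) \<le> 8 * real m * (real i * log 2 (real i + 2) * (b i - a i))" by blast
      qed
    qed
    hence "(\<Sum>u\<in>Pow {1..s} - {{}}. B u * (\<Prod>i\<in>u. (b i - a i) * 2 ^ (e i - 1) * (real m + 1)))
        \<le> (\<Sum>u\<in>Pow {1..s} - {{}}. B u * (\<Prod>i\<in>u. 8 * real m * (real i * log 2 (real i + 2) * (b i - a i))))"
      by (rule sum_mono)
    thus ?thesis by (rule divide_right_mono) simp
  qed
  finally show ?thesis .
qed

text \<open>Passes from extended suprema to real bounds; norm at most 1 and positive weights make
  every supremum finite. The pointwise bound by the weight serves (ii), the bound on the whole sum
  serves (i).\<close>

lemma weighted_norm_le_1:
  assumes norm: "weighted_norm a b \<gamma> p s F \<le> 1" and p: "1 \<le> p"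
    and \<gamma>: "\<And>u. u \<subseteq> {1..s} \<Longrightarrow> 0 < \<gamma> u"
  obtains B where "\<And>u. u \<subseteq> {1..s} \<Longrightarrow> 0 \<le> B u" "\<And>u. u \<subseteq> {1..s} \<Longrightarrow> B u \<le> \<gamma> u"
    "\<And>u x. u \<subseteq> {1..s} \<Longrightarrow> x \<in> coord_box a b s \<Longrightarrow> \<bar>mixed_partial a b u F x\<bar> \<le> B u"
    "lp_sum p (Pow {1..s}) (\<lambda>u. ennreal (B u / \<gamma> u)) \<le> 1"
proof -
  define M where "M u = (SUP x\<in>coord_box a b s. ennreal \<bar>mixed_partial a b u F x\<bar>)" for u
  define B where "B u = enn2real (M u)" for u
  have le1: "ennreal (1 / \<gamma> u) * M u \<le> 1" if "u \<subseteq> {1..s}" for u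
    using lp_sum_le_1[OF _ p norm[unfolded weighted_norm_def], of u] that unfolding M_def by simp
  have fin: "M u \<noteq> \<infinity>" if "u \<subseteq> {1..s}" for u
  proof
    assume "M u = \<infinity>"
    hence "ennreal (1 / \<gamma> u) * M u = \<infinity>" using \<gamma>[OF that] by (simp add: ennreal_mult_top)
    thus False using le1[OF that] by (simp add: top_unique)
  qed
  have MB: "M u = ennreal (B u)" if "u \<subseteq> {1..s}" for u
    unfolding B_def using fin[OF that] by (simp add: less_top)
  have B0: "0 \<le> B u" for u by (simp add: B_def)
  have eq: "ennreal (1 / \<gamma> u) * M u = ennreal (B u / \<gamma> u)" if "u \<subseteq> {1..s}" for u
    unfolding MB[OF that] using \<gamma>[OF that] B0 by (simp add: ennreal_mult[symmetric])
  show thesis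
  proof (rule that[of B])
    fix u assume u: "u \<subseteq> {1..s}"
    show "0 \<le> B u" by (rule B0)
    have "ennreal (B u / \<gamma> u) \<le> 1" using le1[OF u] unfolding eq[OF u] .
    hence "B u / \<gamma> u \<le> 1" by simp
    thus "B u \<le> \<gamma> u" using \<gamma>[OF u] by (simp add: divide_le_eq)
    fix x assume "x \<in> coord_box a b s"
    hence "ennreal \<bar>mixed_partial a b u F x\<bar> \<le> M u" unfolding M_def by (intro SUP_upper)
    thus "\<bar>mixed_partial a b u F x\<bar> \<le> B u" unfolding MB[OF u] using B0 by (subst (asm) ennreal_le_iff) auto
  next
    have "lp_sum p (Pow {1..s}) (\<lambda>u. ennreal (B u / \<gamma> u)) = weighted_norm a b \<gamma> p s F"
      unfolding weighted_norm_def M_def[symmetric] by (rule lp_sum_cong) (simp add: eq)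
    thus "lp_sum p (Pow {1..s}) (\<lambda>u. ennreal (B u / \<gamma> u)) \<le> 1" using norm by simp
  qed
qed

theorem theorem6:
  fixes a b :: "nat \<Rightarrow> real"
    and \<phi> :: "nat \<Rightarrow> real \<Rightarrow> real"
    and \<gamma> :: "nat set \<Rightarrow> real"
    and p q :: ennreal
    and m s :: nat
    and P :: "nat \<Rightarrow> bit poly"
    and \<rho> :: "nat \<Rightarrow> nat \<Rightarrow> bit poly"
    and y :: "nat \<Rightarrow> nat \<Rightarrow> real"
  assumes "\<And>i. i \<ge> 1 \<Longrightarrow> a i < b i"
    and "\<And>i. i \<ge> 1 \<Longrightarrow> prob_density_on (a i) (b i) (\<phi> i)"
    and "\<And>i. i \<ge> 1 \<Longrightarrow> bij_betw (distr_fun (a i) (\<phi> i)) {a i..b i} {0..1}"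
    and "\<And>u. finite u \<Longrightarrow> u \<subseteq> {1..} \<Longrightarrow> \<gamma> u > 0"
    and "1 \<le> p" and "1 \<le> q" and "1 / p + 1 / q = 1"
    and "m \<ge> 1" and "s \<ge> 1"
    and "irreducible_listing P" and "row_numerators P \<rho>"
    and "\<And>i. i \<in> {1..s} \<Longrightarrow> invertible_mat (nied_matrix P \<rho> m i)"
    and "y = digital_net m (nied_matrix P \<rho> m)"
  shows "(\<forall>\<delta>::real. 0 < \<delta> \<and> \<delta> < 1 \<and> C_Nied a b \<delta> \<gamma> q < \<infinity> \<longrightarrow>
            wce a b \<phi> \<gamma> p s (2 ^ m) y
              \<le> 3 * C_Nied a b \<delta> \<gamma> q / ennreal (2 powr (real m * (1 - \<delta>))))
       \<and> (nied_term a b \<gamma> summable_on {1..} \<longrightarrow>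
            (\<forall>(\<delta>::real) (k::nat).
               0 < \<delta> \<and> \<delta> < min 1 (16 * S_Nied a b \<gamma> / ln 2) \<and>
               (\<Sum>\<^sub>\<infinity>i\<in>{k + 1..}. nied_term a b \<gamma> i) < \<delta> * ln 2 / 16 \<longrightarrow>
               wce a b \<phi> \<gamma> p s (2 ^ m) y
                 \<le> ennreal (C_Nied_prod a b \<delta> \<gamma> k / 2 powr (real m * (1 - \<delta>)))))"
proof -
  note ab = assms(1) and \<gamma> = assms(4) and m = assms(8)
  define c where "c i = real i * log 2 (real i + 2) * (b i - a i)" for i
  have c0: "0 \<le> c i" if "i \<ge> 1" for i
    using ab[OF that] that unfolding c_def by (intro mult_nonneg_nonneg zero_le_log_cancel_iff[THEN iffD2]) auto
  have \<gamma>s: "0 < \<gamma> u" if "u \<subseteq> {1..s}" for u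
    using that by (intro \<gamma>) (auto intro: finite_subset)
  \<comment> \<open>Replaces the supremum over integrands by a statement about the real vectors B of
    their derivative bounds, common to both parts.\<close>
  have wce_le: "wce a b \<phi> \<gamma> p s (2 ^ m) y \<le> R"
    if R: "\<And>B. (\<And>u. u \<subseteq> {1..s} \<Longrightarrow> 0 \<le> B u) \<Longrightarrow> (\<And>u. u \<subseteq> {1..s} \<Longrightarrow> B u \<le> \<gamma> u) \<Longrightarrow>
      lp_sum p (Pow {1..s}) (\<lambda>u. ennreal (B u / \<gamma> u)) \<le> 1 \<Longrightarrow>
      ennreal ((\<Sum>u\<in>Pow {1..s} - {{}}. B u * (\<Prod>i\<in>u. 8 * real m * c i)) / 2 ^ m) \<le> R" for R
    unfolding wce_def
  proof (rule SUP_least)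
    fix F assume "F \<in> {F. has_mixed_partials a b s F \<and> weighted_norm a b \<gamma> p s F \<le> 1}"
    hence F: "has_mixed_partials a b s F" "weighted_norm a b \<gamma> p s F \<le> 1" by auto
    obtain B where B: "\<And>u. u \<subseteq> {1..s} \<Longrightarrow> 0 \<le> B u" "\<And>u. u \<subseteq> {1..s} \<Longrightarrow> B u \<le> \<gamma> u"
      "\<And>u x. u \<subseteq> {1..s} \<Longrightarrow> x \<in> coord_box a b s \<Longrightarrow> \<bar>mixed_partial a b u F x\<bar> \<le> B u"
      "lp_sum p (Pow {1..s}) (\<lambda>u. ennreal (B u / \<gamma> u)) \<le> 1"
      by (rule weighted_norm_le_1[OF F(2) assms(5) \<gamma>s]) blast+
    have "\<bar>(\<Sum>n<2 ^ m. F (inv_distr a b \<phi> s (y n))) / 2 ^ m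
      - (LINT x:coord_box a b s|Pi\<^sub>M {1..s} (\<lambda>_. lebesgue). F x * (\<Prod>i=1..s. \<phi> i (x i)))\<bar>
      \<le> (\<Sum>u\<in>Pow {1..s} - {{}}. B u * (\<Prod>i\<in>u. 8 * real m * c i)) / 2 ^ m"
      unfolding c_def by (rule quadrature_error[OF assms(1-3,10,11,13,8) F(1) B(3)])
    hence "ennreal \<bar>(\<Sum>n<2 ^ m. F (inv_distr a b \<phi> s (y n))) / 2 ^ m
      - (LINT x:coord_box a b s|Pi\<^sub>M {1..s} (\<lambda>_. lebesgue). F x * (\<Prod>i=1..s. \<phi> i (x i)))\<bar>
      \<le> ennreal ((\<Sum>u\<in>Pow {1..s} - {{}}. B u * (\<Prod>i\<in>u. 8 * real m * c i)) / 2 ^ m)"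
      by (rule ennreal_leI)
    also have "\<dots> \<le> R"
    proof (rule R)
      show "0 \<le> B u" "B u \<le> \<gamma> u" if "u \<subseteq> {1..s}" for u using B(1,2) that by blast+
    qed (rule B(4))
    finally have "ennreal \<bar>(\<Sum>n<2 ^ m. F (inv_distr a b \<phi> s (y n))) / 2 ^ m
      - (LINT x:coord_box a b s|Pi\<^sub>M {1..s} (\<lambda>_. lebesgue). F x * (\<Prod>i=1..s. \<phi> i (x i)))\<bar> \<le> R" .
    thus "ennreal \<bar>(\<Sum>n<2 ^ m. F (inv_distr a b \<phi> s (y n))) / real (2 ^ m)
      - (LINT x:coord_box a b s|Pi\<^sub>M {1..s} (\<lambda>_. lebesgue). F x * (\<Prod>i=1..s. \<phi> i (x i)))\<bar> \<le> R"
      by simp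
  qed
  have scale: "2 powr (\<delta> * real m) / 2 ^ m = 1 / 2 powr (real m * (1 - \<delta>))" for \<delta> :: real
  proof -
    have "2 powr (\<delta> * real m) * 2 powr (real m * (1 - \<delta>)) = 2 powr real m"
      unfolding powr_add[symmetric] by (simp add: algebra_simps)
    thus ?thesis by (simp add: powr_realpow field_simps)
  qed
  show ?thesis
  proof (intro conjI impI allI; (elim conjE)?)
    fix \<delta> :: real
    assume \<delta>: "0 < \<delta>" "\<delta> < 1" and "C_Nied a b \<delta> \<gamma> q < \<infinity>"
    define K where "K u = \<gamma> u * (\<Prod>i\<in>u. 8 * real (card u) * real i / (exp 1 * \<delta> * ln 2)
                                  * log 2 (real i + 2) * (b i - a i))" for u
    define w where "w = 2 powr (real m * (1 - \<delta>))"
    have w0: "0 < w" by (simp add: w_def)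
    have CK: "lp_sum q (Pow {1..s} - {{}}) (\<lambda>u. ennreal (K u)) \<le> C_Nied a b \<delta> \<gamma> q"
      unfolding C_Nied_def K_def using assms(9) by (intro SUP_upper2[of s]) auto
    \<comment> \<open>Isolates the factor depending on \<open>card u\<close>, which is exactly the
      constant needed to absorb \<open>real m ^ card u\<close>.\<close>
    have Keq: "K u = \<gamma> u * (real (card u) / (exp 1 * \<delta> * ln 2)) ^ card u * (\<Prod>i\<in>u. 8 * c i)" if "finite u" for u
    proof -
      have "(\<Prod>i\<in>u. 8 * real (card u) * real i / (exp 1 * \<delta> * ln 2) * log 2 (real i + 2) * (b i - a i))
          = (\<Prod>i\<in>u. real (card u) / (exp 1 * \<delta> * ln 2) * (8 * c i))"
        by (intro prod.cong refl) (simp add: c_def mult_ac)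
      also have "\<dots> = (real (card u) / (exp 1 * \<delta> * ln 2)) ^ card u * (\<Prod>i\<in>u. 8 * c i)"
        by (simp only: prod.distrib prod_constant)
      finally show ?thesis unfolding K_def by (simp only: mult.assoc)
    qed
    have prod0: "0 \<le> (\<Prod>i\<in>u. 8 * c i)" if "u \<subseteq> {1..s}" for u
      using that c0 by (intro prod_nonneg) auto
    have K0: "0 \<le> K u" if "u \<subseteq> {1..s}" for u
      unfolding Keq[OF finite_subset[OF that finite_atLeastAtMost]]
      using \<gamma>s[OF that] prod0[OF that] \<delta> by (intro mult_nonneg_nonneg) auto
    show "wce a b \<phi> \<gamma> p s (2 ^ m) y \<le> 3 * C_Nied a b \<delta> \<gamma> q / ennreal (2 powr (real m * (1 - \<delta>)))"
    proof (rule wce_le)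
      fix B :: "nat set \<Rightarrow> real"
      assume B: "\<And>u. u \<subseteq> {1..s} \<Longrightarrow> 0 \<le> B u" "lp_sum p (Pow {1..s}) (\<lambda>u. ennreal (B u / \<gamma> u)) \<le> 1"
      have "(\<Sum>u\<in>Pow {1..s} - {{}}. B u * (\<Prod>i\<in>u. 8 * real m * c i))
          \<le> (\<Sum>u\<in>Pow {1..s} - {{}}. 2 powr (\<delta> * real m) * (B u / \<gamma> u * K u))"
      proof (rule sum_mono)
        fix u assume u: "u \<in> Pow {1..s} - {{}}"
        hence uS: "u \<subseteq> {1..s}" by simp
        have fu: "finite u" using uS by (rule finite_subset) simp
        have "1 \<le> card u" using u fu by (simp add: Suc_le_eq card_gt_0_iff)
        have "(\<Prod>i\<in>u. 8 * real m * c i) = (\<Prod>i\<in>u. real m * (8 * c i))"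
          by (intro prod.cong refl) simp
        also have "\<dots> = real m ^ card u * (\<Prod>i\<in>u. 8 * c i)" by (simp only: prod.distrib prod_constant)
        also have "\<dots> \<le> 2 powr (\<delta> * real m) * (real (card u) / (exp 1 * \<delta> * ln 2)) ^ card u * (\<Prod>i\<in>u. 8 * c i)"
          by (intro mult_right_mono power_le_exp_times \<delta> prod0[OF uS] \<open>1 \<le> card u\<close>)
        also have "\<dots> = 2 powr (\<delta> * real m) * (K u / \<gamma> u)"
          unfolding Keq[OF fu] using \<gamma>s[OF uS] by simp
        finally have "B u * (\<Prod>i\<in>u. 8 * real m * c i) \<le> B u * (2 powr (\<delta> * real m) * (K u / \<gamma> u))"
          using B(1)[OF uS] by (rule mult_left_mono)
        thus "B u * (\<Prod>i\<in>u. 8 * real m * c i) \<le> 2 powr (\<delta> * real m) * (B u / \<gamma> u * K u)"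
          by (simp add: mult_ac)
      qed
      hence "(\<Sum>u\<in>Pow {1..s} - {{}}. B u * (\<Prod>i\<in>u. 8 * real m * c i)) / 2 ^ m
          \<le> (\<Sum>u\<in>Pow {1..s} - {{}}. 2 powr (\<delta> * real m) * (B u / \<gamma> u * K u)) / 2 ^ m"
        by (rule divide_right_mono) simp
      also have "\<dots> = (2 powr (\<delta> * real m) / 2 ^ m) * (\<Sum>u\<in>Pow {1..s} - {{}}. B u / \<gamma> u * K u)"
        unfolding sum_distrib_left[symmetric] by simp
      also have "\<dots> = (\<Sum>u\<in>Pow {1..s} - {{}}. B u / \<gamma> u * K u) / w"
        unfolding scale w_def by simp
      finally have "ennreal ((\<Sum>u\<in>Pow {1..s} - {{}}. B u * (\<Prod>i\<in>u. 8 * real m * c i)) / 2 ^ m)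
          \<le> ennreal ((\<Sum>u\<in>Pow {1..s} - {{}}. B u / \<gamma> u * K u) / w)" by (rule ennreal_leI)
      also have "\<dots> = ennreal (\<Sum>u\<in>Pow {1..s} - {{}}. B u / \<gamma> u * K u) / ennreal w"
      proof (rule divide_ennreal[symmetric, OF _ w0])
        have "0 \<le> B u / \<gamma> u * K u" if "u \<subseteq> {1..s}" for u
          using B(1)[OF that] \<gamma>s[OF that] K0[OF that] by simp
        thus "0 \<le> (\<Sum>u\<in>Pow {1..s} - {{}}. B u / \<gamma> u * K u)" by (intro sum_nonneg) auto
      qed
      also have "\<dots> \<le> lp_sum q (Pow {1..s} - {{}}) (\<lambda>u. ennreal (K u)) / ennreal w"
      proof (intro divide_right_mono_ennreal hoelder_lp_sum[OF _ _ _ assms(5-7) _ _ B(2)])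
        show "Pow {1..s} - {{}} \<noteq> {}" using assms(9) by (auto intro: exI[of _ "{1}"])
        show "0 \<le> B u / \<gamma> u" if "u \<in> Pow {1..s}" for u
          using B(1)[of u] \<gamma>s[of u] that by simp
        show "0 \<le> K u" if "u \<in> Pow {1..s} - {{}}" for u using that by (intro K0) auto
      qed auto
      \<comment> \<open>The chain up to this point has constant 1; the factor 3 enters by
        monotonicity.\<close>
      also have "\<dots> \<le> 3 * C_Nied a b \<delta> \<gamma> q / ennreal w"
      proof (rule divide_right_mono_ennreal)
        have "1 * C_Nied a b \<delta> \<gamma> q \<le> 3 * C_Nied a b \<delta> \<gamma> q" by (rule mult_right_mono) auto
        thus "lp_sum q (Pow {1..s} - {{}}) (\<lambda>u. ennreal (K u)) \<le> 3 * C_Nied a b \<delta> \<gamma> q"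
          using CK by simp
      qed
      finally show "ennreal ((\<Sum>u\<in>Pow {1..s} - {{}}. B u * (\<Prod>i\<in>u. 8 * real m * c i)) / 2 ^ m)
          \<le> 3 * C_Nied a b \<delta> \<gamma> q / ennreal (2 powr (real m * (1 - \<delta>)))" unfolding w_def .
    qed
  next
    fix \<delta> :: real and k :: nat
    assume sum: "nied_term a b \<gamma> summable_on {1..}" and \<delta>: "0 < \<delta>" "\<delta> < min 1 (16 * S_Nied a b \<gamma> / ln 2)"
      and tail: "(\<Sum>\<^sub>\<infinity>i\<in>{k + 1..}. nied_term a b \<gamma> i) < \<delta> * ln 2 / 16"
    \<comment> \<open>Realises the convention that the empty set has weight 1 in the ratios. On
      nonempty sets the weights agree, and the error sum runs over nonempty sets only.\<close>
    define \<gamma>' where "\<gamma>' = \<gamma>({} := 1)"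
    define r where "r i = Max ((\<lambda>v. \<gamma>' (v \<union> {i}) / \<gamma>' v) ` Pow {1..i - 1})" for i
    define T where "T = nied_term a b \<gamma>"
    have T: "T i = c i * r i" for i
      by (simp add: T_def nied_term_def c_def r_def \<gamma>'_def Let_def)
    have \<gamma>'0: "0 < \<gamma>' u" if "finite u" "u \<subseteq> {1..}" for u using \<gamma>[OF that] by (simp add: \<gamma>'_def)
    have r0: "0 \<le> r i" if "i \<ge> 1" for i
    proof -
      have "\<gamma>' ({} \<union> {i}) / \<gamma>' {} \<le> r i" unfolding r_def by (intro Max_ge) auto
      moreover have "0 < \<gamma>' ({} \<union> {i}) / \<gamma>' {}" using that by (intro divide_pos_pos \<gamma>'0) auto
      ultimately show ?thesis by linarith
    qed
    have T0: "0 \<le> T i" if "i \<ge> 1" for i unfolding T using c0[OF that] r0[OF that] by simp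
    have \<gamma>r: "\<gamma> u \<le> (\<Prod>i\<in>u. r i)" if "u \<subseteq> {1..s}" "u \<noteq> {}" for u
    proof -
      have "finite u" "u \<subseteq> {1..}" using that by (auto intro: finite_subset)
      hence "\<gamma>' u \<le> (\<Prod>i\<in>u. r i)"
        unfolding r_def by (intro weight_le_prod_ratios \<gamma>'0) (simp_all add: \<gamma>'_def)
      thus ?thesis using that by (simp add: \<gamma>'_def)
    qed
    define d where "d = \<delta> * ln 2 / 16"
    define X where "X = infsum T {1..} / d"
    have d0: "0 < d" using \<delta> by (simp add: d_def)
    have S: "S_Nied a b \<gamma> = infsum T {1..}" by (simp add: S_Nied_def T_def)
    have Xeq: "X = 16 * S_Nied a b \<gamma> / (\<delta> * ln 2)" unfolding X_def S d_def by simp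
    \<comment> \<open>The upper bound 16 S / ln 2 on \<delta> says precisely that X exceeds
      1.\<close>
    have X1: "1 \<le> X"
    proof -
      have "\<delta> * ln 2 < 16 * S_Nied a b \<gamma>" using \<delta> by (simp add: less_divide_eq)
      thus ?thesis unfolding Xeq using \<delta> by (simp add: le_divide_eq)
    qed
    \<comment> \<open>With y = 8 m and d = \<delta> ln 2 / 16 the exponent 2 d y becomes \<delta> m
      ln 2; this fixes the constant 16.\<close>
    have main: "(\<Prod>i\<in>{1..s}. 1 + 8 * real m * T i) \<le> X ^ k * 2 powr (\<delta> * real m)"
    proof -
      have "(\<Prod>i\<in>{1..s}. 1 + 8 * real m * T i) \<le> X ^ k * exp (2 * d * (8 * real m))"
        using sum tail T0 by (intro prod_one_plus_bound d0 X_def X1) (auto simp: T_def d_def)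
      also have "2 * d * (8 * real m) = \<delta> * real m * ln 2" by (simp add: d_def)
      also have "exp (\<delta> * real m * ln 2) = 2 powr (\<delta> * real m)" by (simp add: powr_def)
      finally show ?thesis .
    qed
    show "wce a b \<phi> \<gamma> p s (2 ^ m) y \<le> ennreal (C_Nied_prod a b \<delta> \<gamma> k / 2 powr (real m * (1 - \<delta>)))"
    proof (rule wce_le, rule ennreal_leI)
      fix B :: "nat set \<Rightarrow> real"
      assume B: "\<And>u. u \<subseteq> {1..s} \<Longrightarrow> 0 \<le> B u" "\<And>u. u \<subseteq> {1..s} \<Longrightarrow> B u \<le> \<gamma> u"
      have "(\<Sum>u\<in>Pow {1..s} - {{}}. B u * (\<Prod>i\<in>u. 8 * real m * c i))
          \<le> (\<Sum>u\<in>Pow {1..s} - {{}}. \<Prod>i\<in>u. 8 * real m * T i)"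
      proof (rule sum_mono)
        fix u assume "u \<in> Pow {1..s} - {{}}"
        hence u: "u \<subseteq> {1..s}" "u \<noteq> {}" by auto
        have "B u \<le> (\<Prod>i\<in>u. r i)" using B(2)[OF u(1)] \<gamma>r[OF u] by linarith
        moreover have "0 \<le> (\<Prod>i\<in>u. 8 * real m * c i)" using u c0 by (intro prod_nonneg) auto
        ultimately have "B u * (\<Prod>i\<in>u. 8 * real m * c i) \<le> (\<Prod>i\<in>u. r i) * (\<Prod>i\<in>u. 8 * real m * c i)"
          by (rule mult_right_mono)
        also have "\<dots> = (\<Prod>i\<in>u. 8 * real m * T i)"
          unfolding prod.distrib[symmetric] by (intro prod.cong refl) (simp add: T)
        finally show "B u * (\<Prod>i\<in>u. 8 * real m * c i) \<le> (\<Prod>i\<in>u. 8 * real m * T i)" .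
      qed
      \<comment> \<open>Adding the term 1 of the empty set makes the sum over subsets the expansion
        of a product.\<close>
      also have "\<dots> \<le> (\<Sum>u\<in>Pow {1..s}. \<Prod>i\<in>u. 8 * real m * T i)"
        using T0 by (intro sum_mono2 prod_nonneg mult_nonneg_nonneg) auto
      also have "\<dots> = (\<Prod>i\<in>{1..s}. 8 * real m * T i + 1)"
        by (subst prod_add) auto
      also have "\<dots> \<le> X ^ k * 2 powr (\<delta> * real m)" using main by (simp only: add.commute)
      finally have "(\<Sum>u\<in>Pow {1..s} - {{}}. B u * (\<Prod>i\<in>u. 8 * real m * c i)) / 2 ^ m
          \<le> X ^ k * 2 powr (\<delta> * real m) / 2 ^ m" by (rule divide_right_mono) simp
      also have "\<dots> = X ^ k * (2 powr (\<delta> * real m) / 2 ^ m)" by simp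
      also have "\<dots> = X ^ k / 2 powr (real m * (1 - \<delta>))" unfolding scale by simp
      also have "\<dots> \<le> 3 * X ^ k / 2 powr (real m * (1 - \<delta>))"
      proof (rule divide_right_mono)
        have "0 \<le> X ^ k" using X1 by simp
        thus "X ^ k \<le> 3 * X ^ k" by linarith
      qed simp
      finally show "(\<Sum>u\<in>Pow {1..s} - {{}}. B u * (\<Prod>i\<in>u. 8 * real m * c i)) / 2 ^ m
          \<le> C_Nied_prod a b \<delta> \<gamma> k / 2 powr (real m * (1 - \<delta>))"
        unfolding C_Nied_prod_def Xeq .
    qed
  qed
qed

end
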